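(* Let $\lambda=1+\sqrt2$. There is an algorithm which, given integers $m,n\ge1$, computes the domination polynomial of the $m\times n$ torus graph $C_m\square C_n$ in time $O(m^3n^2\lambda^{2m})$ and space $O(mn\lambda^m)$.
   Context: Dominating set: a subset $S\subseteq V$ of the vertices of a graph $G=(V,E)$ such that every vertex of $V$ is in $S$ or has a neighbor in $S$. Domination polynomial of $G$: $D_G(z)=\sum_S z^{|S|}$, the sum over all dominating sets $S$ of $G$; computing it means computing all its coefficients. $C_k$ is the cycle graph on $k$ vertices ($C_1$, $C_2$ being a single vertex and a single edge); $\square$ is the Cartesian product of graphs. Complexity model: each polynomial coefficient is a fixed-width integer that takes one unit of storage, and copying, shifting or adding coefficients takes unit time per coefficient (concretely, the coefficients are computed modulo a fixed prime; the exact integer coefficients are recovered by the Chinese Remainder Theorem from separate runs for different primes, which are not counted in the bounds). A string of length $O(m)$ over a three-letter alphabet is encoded as one integer, which likewise takes one unit of storage and on which elementary operations take unit time; inserting, deleting or looking up an entry in an ordered associative container with $N$ entries takes time $O(\log N)$. The constants in $O(\cdot)$ do not depend on $m$ and $n$. *)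

theory Defs
  imports
    Complex_Main
    "HOL-Computational_Algebra.Polynomial"
    "HOL-Computational_Algebra.Primes"
    "Graph_Theory.Pair_Digraph"
begin

section \<open>Domination polynomials of torus graphs\<close>

text \<open>A finite simple graph is a \<^locale>\<open>pair_graph\<close>: the set of arcs is symmetric and irreflexive,
  and each undirected edge is represented by its two arcs.\<close>

definition dominating_set :: "'a pair_pre_digraph \<Rightarrow> 'a set \<Rightarrow> bool" where
  "dominating_set G S \<longleftrightarrow>
     S \<subseteq> pverts G \<and> (\<forall>v\<in>pverts G. v \<in> S \<or> (\<exists>u\<in>S. (v, u) \<in> parcs G))"

definition domination_poly :: "'a pair_pre_digraph \<Rightarrow> nat poly" where
  "domination_poly G = (\<Sum>S | dominating_set G S. monom 1 (card S))"

text \<open>The condition \<open>i \<noteq> j\<close> only matters for \<open>k = 1\<close>, where it excludes the loop. For \<open>k = 2\<close> both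
  disjuncts describe the same edge.\<close>

definition cycle_graph :: "nat \<Rightarrow> nat pair_pre_digraph" where
  "cycle_graph k = \<lparr> pverts = {..<k},
     parcs = {(i, j). i < k \<and> j < k \<and> i \<noteq> j \<and> (j = (i + 1) mod k \<or> i = (j + 1) mod k)} \<rparr>"

definition cartesian_product ::
    "'a pair_pre_digraph \<Rightarrow> 'b pair_pre_digraph \<Rightarrow> ('a \<times> 'b) pair_pre_digraph" where
  "cartesian_product G H = \<lparr> pverts = pverts G \<times> pverts H,
     parcs = {((u, v), (u', v')).
       (u = u' \<and> u \<in> pverts G \<and> (v, v') \<in> parcs H) \<or>
       (v = v' \<and> v \<in> pverts H \<and> (u, u') \<in> parcs G)} \<rparr>"

definition torus_graph :: "nat \<Rightarrow> nat \<Rightarrow> (nat \<times> nat) pair_pre_digraph" where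
  "torus_graph m n = cartesian_product (cycle_graph m) (cycle_graph n)"

lemma cycle_graph_1: "cycle_graph 1 = \<lparr> pverts = {0}, parcs = {} \<rparr>"
  by (auto simp: cycle_graph_def)

lemma cycle_graph_2: "cycle_graph 2 = \<lparr> pverts = {0, 1}, parcs = {(0, 1), (1, 0)} \<rparr>"
  by (auto simp: cycle_graph_def less_2_cases_iff)

lemma pair_graph_cycle_graph: "pair_graph (cycle_graph k)"
proof
  show "finite (parcs (cycle_graph k))"
    by (rule finite_subset[of _ "{..<k} \<times> {..<k}"]) (auto simp: cycle_graph_def)
qed (auto simp: cycle_graph_def symmetric_def sym_def arcs_ends_def arc_to_ends_def)

lemma pair_graph_cartesian_product:
  assumes "pair_graph G" "pair_graph H"
  shows "pair_graph (cartesian_product G H)"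
proof -
  interpret G: pair_graph G by fact
  interpret H: pair_graph H by fact
  have wf: "parcs (cartesian_product G H) \<subseteq>
      (pverts G \<times> pverts H) \<times> (pverts G \<times> pverts H)"
    by (auto simp: cartesian_product_def dest: G.in_arcsD1 G.in_arcsD2 H.in_arcsD1 H.in_arcsD2)
  have "sym (parcs G)" "sym (parcs H)"
    using G.pair_sym_arcs H.pair_sym_arcs by (auto simp: symmetric_def)
  then have sym: "sym (parcs (cartesian_product G H))"
    unfolding cartesian_product_def sym_def by auto
  show ?thesis
  proof
    show "finite (parcs (cartesian_product G H))"
      using wf by (rule finite_subset) (simp add: G.pair_finite_verts H.pair_finite_verts)
    show "symmetric (with_proj (cartesian_product G H))"
      using sym by (simp add: symmetric_def)
    show "finite (pverts (cartesian_product G H))"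
      by (simp add: cartesian_product_def G.pair_finite_verts H.pair_finite_verts)
  next
    fix e assume e: "e \<in> parcs (cartesian_product G H)"
    show "fst e \<in> pverts (cartesian_product G H)" "snd e \<in> pverts (cartesian_product G H)"
      using subsetD[OF wf e] by (auto simp: cartesian_product_def)
    show "fst e \<noteq> snd e"
      using e by (auto simp: cartesian_product_def dest: G.pair_no_loops H.pair_no_loops)
  qed
qed

lemma pair_graph_torus_graph: "pair_graph (torus_graph m n)"
  unfolding torus_graph_def by (intro pair_graph_cartesian_product pair_graph_cycle_graph)


section \<open>The machine model\<close>

text \<open>
  A program is a finite structured program over registers that hold natural numbers. It has
  \<^item> an integer memory \<open>imem\<close>, addressed by register contents;
  \<^item> a coefficient memory \<open>cmem\<close>, also addressed by register contents, whose cells hold residues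
    modulo \<open>p\<close>, represented by \<open>{0..<p}\<close>. Coefficients can only be set to 0 or 1, copied
    and added. They never flow into the registers, so several coefficients cannot be packed into one
    integer, and control flow cannot depend on them or on \<open>p\<close>;
  \<^item> ordered associative containers \<open>conts 0, conts 1, \<dots>\<close> with integer keys and values.

  Programs refer to registers and containers by literal numbers only, so a program uses a fixed
  finite number of each, whatever its input.
\<close>

record state =
  reg :: "nat \<Rightarrow> nat"
  imem :: "nat \<Rightarrow> nat"
  cmem :: "nat \<Rightarrow> nat"
  conts :: "nat \<Rightarrow> nat \<rightharpoonup> nat"
  icells :: nat  \<comment> \<open>1 + the largest \<open>imem\<close> address accessed so far, or 0\<close>
  ccells :: nat  \<comment> \<open>1 + the largest \<open>cmem\<close> address accessed so far, or 0\<close>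

datatype arith_op = Add | Sub | Mul | Div | Mod

text \<open>In the comments, \<open>r\<close> etc. also stand for the contents of register \<open>r\<close>.\<close>

datatype instr =
    Const nat nat                \<comment> \<open>\<open>Const r k\<close>: \<open>r := k\<close>\<close>
  | Move nat nat                 \<comment> \<open>\<open>Move r a\<close>: \<open>r := a\<close>\<close>
  | Arith arith_op nat nat nat   \<comment> \<open>\<open>Arith f r a b\<close>: \<open>r := f a b\<close>\<close>
  | Load nat nat                 \<comment> \<open>\<open>Load r a\<close>: \<open>r := imem[a]\<close>\<close>
  | Store nat nat                \<comment> \<open>\<open>Store a b\<close>: \<open>imem[a] := b\<close>\<close>
  | CZero nat                    \<comment> \<open>\<open>CZero a\<close>: \<open>cmem[a] := 0\<close>\<close>
  | COne nat                     \<comment> \<open>\<open>COne a\<close>: \<open>cmem[a] := 1\<close>\<close>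
  | CCopy nat nat                \<comment> \<open>\<open>CCopy a b\<close>: \<open>cmem[a] := cmem[b]\<close>\<close>
  | CAdd nat nat                 \<comment> \<open>\<open>CAdd a b\<close>: \<open>cmem[a] := cmem[a] + cmem[b]\<close> modulo \<open>p\<close>\<close>
  | Insert nat nat nat           \<comment> \<open>\<open>Insert i a b\<close>: map key \<open>a\<close> to \<open>b\<close> in container \<open>i\<close>\<close>
  | Delete nat nat               \<comment> \<open>\<open>Delete i a\<close>: remove key \<open>a\<close> from container \<open>i\<close>\<close>
  | Lookup nat nat nat nat       \<comment> \<open>\<open>Lookup i a r f\<close>: if key \<open>a\<close> occurs, \<open>r :=\<close> its value and
                                       \<open>f := 1\<close>; otherwise \<open>f := 0\<close>\<close>
  | LowerBound nat nat nat nat   \<comment> \<open>\<open>LowerBound i a r f\<close>: if some key \<open>\<ge> a\<close> occurs, \<open>r :=\<close> the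
                                       least one and \<open>f := 1\<close>; otherwise \<open>f := 0\<close>\<close>

datatype test = Less nat nat | LessEq nat nat | Equal nat nat

datatype prog =
    Skip
  | Instr instr
  | Seq prog prog
  | Cond test prog prog
  | While test prog

text \<open>Subtraction is truncated and division by zero yields zero, as for \<^typ>\<open>nat\<close>.\<close>

fun arith :: "arith_op \<Rightarrow> nat \<Rightarrow> nat \<Rightarrow> nat" where
  "arith Add a b = a + b"
| "arith Sub a b = a - b"
| "arith Mul a b = a * b"
| "arith Div a b = a div b"
| "arith Mod a b = a mod b"

fun holds :: "test \<Rightarrow> state \<Rightarrow> bool" where
  "holds (Less a b) s \<longleftrightarrow> reg s a < reg s b"
| "holds (LessEq a b) s \<longleftrightarrow> reg s a \<le> reg s b"
| "holds (Equal a b) s \<longleftrightarrow> reg s a = reg s b"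

definition set_reg :: "nat \<Rightarrow> nat \<Rightarrow> state \<Rightarrow> state" where
  "set_reg r v s = s\<lparr>reg := (reg s)(r := v)\<rparr>"

definition touch_i :: "nat \<Rightarrow> state \<Rightarrow> state" where
  "touch_i a s = s\<lparr>icells := max (icells s) (Suc a)\<rparr>"

definition touch_c :: "nat \<Rightarrow> state \<Rightarrow> state" where
  "touch_c a s = s\<lparr>ccells := max (ccells s) (Suc a)\<rparr>"

definition set_coeff :: "nat \<Rightarrow> nat \<Rightarrow> state \<Rightarrow> state" where
  "set_coeff a v s = touch_c a (s\<lparr>cmem := (cmem s)(a := v)\<rparr>)"

definition set_cont :: "nat \<Rightarrow> (nat \<rightharpoonup> nat) \<Rightarrow> state \<Rightarrow> state" where
  "set_cont i M s = s\<lparr>conts := (conts s)(i := M)\<rparr>"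

fun step :: "nat \<Rightarrow> instr \<Rightarrow> state \<Rightarrow> state" where
  "step p (Const r k) s = set_reg r k s"
| "step p (Move r a) s = set_reg r (reg s a) s"
| "step p (Arith f r a b) s = set_reg r (arith f (reg s a) (reg s b)) s"
| "step p (Load r a) s = set_reg r (imem s (reg s a)) (touch_i (reg s a) s)"
| "step p (Store a b) s = touch_i (reg s a) (s\<lparr>imem := (imem s)(reg s a := reg s b)\<rparr>)"
| "step p (CZero a) s = set_coeff (reg s a) 0 s"
| "step p (COne a) s = set_coeff (reg s a) (1 mod p) s"
| "step p (CCopy a b) s = set_coeff (reg s a) (cmem s (reg s b)) (touch_c (reg s b) s)"
| "step p (CAdd a b) s =
     set_coeff (reg s a) ((cmem s (reg s a) + cmem s (reg s b)) mod p) (touch_c (reg s b) s)"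
| "step p (Insert i a b) s = set_cont i ((conts s i)(reg s a \<mapsto> reg s b)) s"
| "step p (Delete i a) s = set_cont i ((conts s i)(reg s a := None)) s"
| "step p (Lookup i a r f) s =
     (case conts s i (reg s a) of
        None \<Rightarrow> set_reg f 0 s
      | Some v \<Rightarrow> set_reg f 1 (set_reg r v s))"
| "step p (LowerBound i a r f) s =
     (if \<exists>k\<in>dom (conts s i). reg s a \<le> k
      then set_reg f 1 (set_reg r (LEAST k. k \<in> dom (conts s i) \<and> reg s a \<le> k) s)
      else set_reg f 0 s)"

text \<open>The summand 2 makes the cost of a container operation positive also for \<open>N = 0\<close>.\<close>

definition cont_cost :: "nat \<Rightarrow> state \<Rightarrow> nat" where
  "cont_cost i s = nat \<lceil>log 2 (real (card (dom (conts s i)) + 2))\<rceil>"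

fun cost :: "instr \<Rightarrow> state \<Rightarrow> nat" where
  "cost (Insert i _ _) s = cont_cost i s"
| "cost (Delete i _) s = cont_cost i s"
| "cost (Lookup i _ _ _) s = cont_cost i s"
| "cost (LowerBound i _ _ _) s = cont_cost i s"
| "cost _ s = 1"

text \<open>Registers are not counted, as their number is a constant of the program. Memory is charged up
  to the largest address accessed, so a sparsely used address range is not free.\<close>

definition space_usage :: "state \<Rightarrow> nat" where
  "space_usage s = icells s + ccells s + card {(i, k). k \<in> dom (conts s i)}"

definition ints_below :: "nat \<Rightarrow> state \<Rightarrow> bool" where
  "ints_below B s \<longleftrightarrow> (\<forall>r. reg s r < B) \<and> (\<forall>a. imem s a < B) \<and>
     (\<forall>i k v. conts s i k = Some v \<longrightarrow> k < B \<and> v < B)"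

text \<open>\<open>exec p B S c s t s'\<close>: with coefficients modulo \<open>p\<close>, the program \<open>c\<close> started in state \<open>s\<close>
  terminates in state \<open>s'\<close> after time \<open>t\<close>; after every instruction, all stored integers are less
  than \<open>B\<close> and at most \<open>S\<close> units of storage are in use. A run that violates these limits has no
  derivation.\<close>

inductive exec :: "nat \<Rightarrow> nat \<Rightarrow> nat \<Rightarrow> prog \<Rightarrow> state \<Rightarrow> nat \<Rightarrow> state \<Rightarrow> bool"
  for p B S :: nat where
  Skip: "exec p B S Skip s 0 s"
| Instr: "ints_below B (step p a s) \<Longrightarrow> space_usage (step p a s) \<le> S \<Longrightarrow>
    exec p B S (Instr a) s (cost a s) (step p a s)"
| Seq: "exec p B S c s t s' \<Longrightarrow> exec p B S d s' u s'' \<Longrightarrow> exec p B S (Seq c d) s (t + u) s''"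
| CondTrue: "holds b s \<Longrightarrow> exec p B S c s t s' \<Longrightarrow> exec p B S (Cond b c d) s (1 + t) s'"
| CondFalse: "\<not> holds b s \<Longrightarrow> exec p B S d s t s' \<Longrightarrow> exec p B S (Cond b c d) s (1 + t) s'"
| WhileTrue: "holds b s \<Longrightarrow> exec p B S c s t s' \<Longrightarrow> exec p B S (While b c) s' u s'' \<Longrightarrow>
    exec p B S (While b c) s (1 + t + u) s''"
| WhileFalse: "\<not> holds b s \<Longrightarrow> exec p B S (While b c) s 1 s"

text \<open>The two inputs are passed in registers 0 and 1; everything else is initially zero or empty.\<close>

definition initial_state :: "nat \<Rightarrow> nat \<Rightarrow> state" where
  "initial_state m n = \<lparr> reg = (\<lambda>_. 0)(0 := m, 1 := n), imem = (\<lambda>_. 0), cmem = (\<lambda>_. 0),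
     conts = (\<lambda>_. Map.empty), icells = 0, ccells = 0 \<rparr>"

text \<open>An integer below \<open>(3 ^ m * n) ^ d = 3 ^ (d * m) * n ^ d\<close> can encode a string of length
  \<open>d * m\<close> over a three-letter alphabet; the power of \<open>n\<close> accommodates loop counters and addresses.
  The bound is independent of \<open>p\<close>.\<close>

definition int_bound :: "nat \<Rightarrow> nat \<Rightarrow> nat \<Rightarrow> nat" where
  "int_bound d m n = (3 ^ m * n) ^ d"

end

theory Submission
  imports Defs
begin

text \<open>The domination polynomial of the torus is the trace of the \<open>n\<close>-th power of a transfer matrix. Given
a set \<open>S\<close> of vertices, describe each row, a cycle of length \<open>m\<close>, by a word over three letters: 2 for
a vertex in \<open>S\<close>, 1 for a vertex outside \<open>S\<close> with a neighbour in \<open>S\<close> in the same or in the previous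
row, 0 for any other vertex, which depends on the next row for being dominated. The word of a row
is determined by the word of the previous row and by the part of \<open>S\<close> in the row, and its letters 2
give back this part of \<open>S\<close>. So a dominating set is the same as a closed walk of length \<open>n\<close> through
words, in which a letter 0 is always followed by a letter 2 in the same column (\<open>closed_run_iff\<close>),
and the polynomial is the sum over all words \<open>w\<close> of the generating polynomial of the walks from \<open>w\<close>
to \<open>w\<close> (\<open>trace_run_poly\<close>). Cycles of length 1 and 2 need no separate treatment: counting a vertex as
its own neighbour, or a neighbour twice, does not affect domination.

The number \<open>\<lambda> = 1 + sqrt 2\<close> enters because a 0 never stands next to a 2. The words with this property
are the walks of length \<open>m - 1\<close> in the complete graph with loops on the letters 0, 1, 2, from which the edge
between 0 and 2 has been removed; its adjacency matrix has the largest eigenvalue \<open>\<lambda>\<close>. Up to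
\<open>2 ^ m\<close> words can follow a given one, which is too many; therefore the program adds the vertices one by one. In the middle of a row the current word
consists of a beginning of the new row and the rest of the old one. The two parts may clash at the seam
between them, but this only costs a constant factor: there are at most \<open>2 * \<lambda> ^ m\<close> such
words (\<open>card_words\<close>).

For each start word, the program keeps a table of the words that can be reached and of their
generating polynomials, and performs \<open>m * n\<close> vertex steps. A step makes at most two vector additions of
length \<open>m * n + 1\<close> and a bounded number of container operations per table entry; each container operation
takes time \<open>O(m)\<close>. One start word thus costs \<open>O(m\<^sup>2 n\<^sup>2 \<lambda> ^ m)\<close>, and there are \<open>O(\<lambda> ^ m)\<close> of them. The start
words are found by testing all \<open>3 ^ m\<close> words in time \<open>O(m)\<close> each, which is affordable since
\<open>3 \<le> \<lambda> ^ 2\<close>. Two tables are stored at a time, with \<open>O(\<lambda> ^ m)\<close> polynomials each, which gives the bound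
on the space.

Correctness and cost are established together in a program logic: \<open>runs c s T Q\<close> says that \<open>c\<close> terminates
from \<open>s\<close> within time \<open>T\<close>, within fixed limits for all memories and integers, in a state that satisfies
\<open>Q\<close>.\<close>


section \<open>Words over three letters\<close>

definition dig :: "nat \<Rightarrow> nat \<Rightarrow> nat" where
  "dig W i = W div 3 ^ i mod 3"

definition set_dig :: "nat \<Rightarrow> nat \<Rightarrow> nat \<Rightarrow> nat" where
  "set_dig W i v = W - dig W i * 3 ^ i + v * 3 ^ i"

lemma dig_less [simp]: "dig W i < 3"
  by (simp add: dig_def)

text \<open>The split of a word into the digits below \<open>i\<close>, the digit at \<open>i\<close> and the digits above, from which the
behaviour of \<open>set_dig\<close> on every digit can be read off.\<close>

lemma set_dig_split: "set_dig W i v = W mod 3 ^ i + 3 ^ i * (v + 3 * (W div 3 ^ Suc i))"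
proof -
  have *: "W = a + q * (d + 3 * h) \<Longrightarrow> W - d * q + v * q = a + q * (v + 3 * h)" for a q d h
    by (simp add: algebra_simps)
  have "W div 3 ^ i = dig W i + 3 * (W div 3 ^ Suc i)"
    by (simp add: dig_def power_Suc2 div_mult2_eq del: power_Suc)
  then have "W = W mod 3 ^ i + 3 ^ i * (dig W i + 3 * (W div 3 ^ Suc i))"
    by (metis mod_mult_div_eq)
  then show ?thesis
    unfolding set_dig_def by (rule *)
qed

lemma div_set_dig:
  assumes "v < 3"
  shows "set_dig W i v div 3 ^ Suc i = W div 3 ^ Suc i"
  using assms unfolding set_dig_split power_Suc2 div_mult2_eq by simp

lemma dig_add_high:
  assumes "j < i"
  shows "dig (c + 3 ^ i * a) j = dig c j"
proof -
  obtain d where d: "i = j + Suc d" using assms less_iff_Suc_add by auto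
  have "c + 3 ^ i * a = c + 3 ^ j * (3 * (3 ^ d * a))"
    unfolding d power_add by simp
  also have "\<dots> div 3 ^ j = 3 * (3 ^ d * a) + c div 3 ^ j"
    by (rule div_mult_self2) simp
  finally show ?thesis by (simp add: dig_def)
qed

lemma dig_mod: "j < i \<Longrightarrow> dig (W mod 3 ^ i) j = dig W j"
  using dig_add_high[of j i "W mod 3 ^ i" "W div 3 ^ i"] by simp

lemma dig_set_dig:
  assumes "v < 3"
  shows "dig (set_dig W i v) j = (if j = i then v else dig W j)"
proof -
  consider "j = i" | "j < i" | "i < j" by linarith
  then show ?thesis
  proof cases
    case 1
    then show ?thesis using assms by (simp add: dig_def set_dig_split)
  next
    case 2
    have "dig (set_dig W i v) j = dig (W mod 3 ^ i) j"
      unfolding set_dig_split using 2 by (rule dig_add_high)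
    also have "\<dots> = dig W j"
      using 2 by (rule dig_mod)
    finally show ?thesis using 2 by simp
  next
    case 3
    then obtain d where d: "j = Suc i + d" using less_iff_Suc_add by auto
    show ?thesis
      using div_set_dig[OF assms, of W i] 3
      unfolding dig_def d power_add div_mult2_eq by (simp del: power_Suc)
  qed
qed

lemma set_dig_less:
  assumes "W < 3 ^ m" "i < m" "v < 3"
  shows "set_dig W i v < 3 ^ m"
proof -
  obtain d where d: "m = Suc i + d" using assms(2) less_iff_Suc_add by auto
  have iff: "x < 3 ^ m \<longleftrightarrow> x div 3 ^ Suc i < 3 ^ d" for x :: nat
    unfolding d power_add by (simp add: div_less_iff_less_mult mult.commute)
  show ?thesis
    using assms(1) unfolding iff div_set_dig[OF assms(3)] .
qed

lemma word_eqI: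
  assumes "W < 3 ^ m" "V < 3 ^ m" "\<And>i. i < m \<Longrightarrow> dig W i = dig V i"
  shows "W = V"
  using assms
proof (induction m arbitrary: W V)
  case (Suc m)
  have sh: "dig (x div 3) i = dig x (Suc i)" for x i
    by (simp add: dig_def div_mult2_eq)
  have "W div 3 = V div 3"
  proof (rule Suc.IH)
    show "W div 3 < 3 ^ m" "V div 3 < 3 ^ m"
      using Suc.prems(1,2) by (simp_all add: div_less_iff_less_mult mult.commute)
    show "dig (W div 3) i = dig (V div 3) i" if "i < m" for i
      unfolding sh using Suc.prems(3)[of "Suc i"] that by simp
  qed
  moreover have "W mod 3 = V mod 3"
    using Suc.prems(3)[of 0] by (simp add: dig_def)
  ultimately show ?case
    by (metis mult_div_mod_eq)
qed simp

lemma word_exists: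
  assumes "\<And>i. i < m \<Longrightarrow> f i < 3"
  shows "\<exists>W < 3 ^ m. \<forall>i<m. dig W i = f i"
  using assms
proof (induction m)
  case (Suc m)
  then obtain W where W: "W < 3 ^ m" "\<forall>i<m. dig W i = f i" by auto
  show ?case
  proof (intro exI[of _ "set_dig W m (f m)"] conjI allI impI)
    show "set_dig W m (f m) < 3 ^ Suc m"
      using W(1) Suc.prems by (intro set_dig_less) (auto intro: order.strict_trans2)
  qed (use W Suc.prems in \<open>auto simp: dig_set_dig less_Suc_eq\<close>)
qed simp

section \<open>Adding one vertex\<close>

text \<open>The column to the right of \<open>j\<close> whose vertex in the new row is already known: column 0 if \<open>j\<close> is the
last one. Otherwise there is none, and \<open>j\<close> itself serves as a default: \<open>put\<close> has just made its letter 2, so that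
\<open>dominate\<close> leaves it alone, and \<open>omit\<close> tests the letter of \<open>j\<close> anyway. In the same way, \<open>j - 1\<close> with
\<open>0 - 1 = 0\<close> stands for the column to the left. This also handles \<open>m = 1\<close> and \<open>m = 2\<close>.\<close>

definition right_of :: "nat \<Rightarrow> nat \<Rightarrow> nat" where
  "right_of m j = (if Suc j = m then 0 else j)"

definition dominate :: "nat \<Rightarrow> nat \<Rightarrow> nat" where
  "dominate i W = (if dig W i = 0 then set_dig W i 1 else W)"

text \<open>The two ways to replace the letter of column \<open>j\<close> by a letter for the vertex below: with that
vertex in the set, or not in the set. In the second case, the vertex above sees its last neighbour,
so its letter must not be 0.\<close>

definition put :: "nat \<Rightarrow> nat \<Rightarrow> nat \<Rightarrow> nat" where
  "put m j W = dominate (right_of m j) (dominate (j - 1) (set_dig W j 2))"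

definition omit :: "nat \<Rightarrow> nat \<Rightarrow> nat \<Rightarrow> nat option" where
  "omit m j W = (if dig W j = 0 then None else Some (set_dig W j
     (if dig W j = 2 \<or> dig W (j - 1) = 2 \<or> dig W (right_of m j) = 2 then 1 else 0)))"

lemma dig_dominate: "dig (dominate i W) j = (if j = i \<and> dig W i = 0 then 1 else dig W j)"
  by (simp add: dominate_def dig_set_dig)

lemma right_of_less: "j < m \<Longrightarrow> right_of m j < m"
  by (auto simp: right_of_def)

lemma put_less: "W < 3 ^ m \<Longrightarrow> j < m \<Longrightarrow> put m j W < 3 ^ m"
  by (simp add: put_def dominate_def set_dig_less right_of_less)

lemma omit_less: "omit m j W = Some V \<Longrightarrow> W < 3 ^ m \<Longrightarrow> j < m \<Longrightarrow> V < 3 ^ m"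
  by (auto simp: omit_def set_dig_less split: if_splits)

lemma dig_put:
  "dig (put m j W) i =
    (if i = j then 2
     else if dig W i = 0 \<and> (i = j - 1 \<or> i = right_of m j) then 1 else dig W i)"
  by (auto simp: put_def dig_dominate dig_set_dig)

section \<open>The number of words\<close>

definition clash :: "nat \<Rightarrow> nat \<Rightarrow> bool" where
  "clash W i \<longleftrightarrow> dig W i = 0 \<and> dig W (Suc i) = 2 \<or> dig W i = 2 \<and> dig W (Suc i) = 0"

text \<open>The words with \<open>j\<close> letters of the new row. Columns \<open>j - 1\<close> and \<open>j\<close> belong to different rows and may
clash; so may columns \<open>m - 1\<close> and 0, which keeps the bound below simple and admits only a
constant factor more words.\<close>

definition words :: "nat \<Rightarrow> nat \<Rightarrow> nat set" where
  "words m j = {W. W < 3 ^ m \<and> (\<forall>i. Suc i < m \<longrightarrow> Suc i \<noteq> j \<longrightarrow> \<not> clash W i)}"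

text \<open>The form in which the program tests for clashes.\<close>

lemma clash_iff_mod: "clash W i \<longleftrightarrow> W div 3 ^ i mod 9 = 2 \<or> W div 3 ^ i mod 9 = 6"
proof -
  have "W div 3 ^ i mod 9 = dig W i + 3 * dig W (Suc i)"
    using mod_mult2_eq[of "W div 3 ^ i" 3 3]
        by (simp add: dig_def div_mult2_eq mult.commute[of 3 "3 ^ i"])
  moreover have "a < 3 \<Longrightarrow> b < 3 \<Longrightarrow>
      (a = 0 \<and> b = 2 \<or> a = 2 \<and> b = 0) = (a + 3 * b = 2 \<or> a + 3 * b = 6)" for a b :: nat
    by presburger
  ultimately show ?thesis
    unfolding clash_def by simp
qed

lemma put_words:
  assumes "W \<in> words m j" "j < m"
  shows "put m j W \<in> words m (Suc j)"
  using assms unfolding words_def clash_def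
  by (auto simp: put_less dig_put split: if_splits)

lemma omit_words:
  assumes "omit m j W = Some V" "W \<in> words m j" "j < m"
  shows "V \<in> words m (Suc j)"
  using assms omit_less[OF assms(1)] unfolding words_def clash_def
  by (auto simp: omit_def dig_set_dig split: if_splits)

lemma words_wrap: "words m m = words m 0"
  by (auto simp: words_def)

lemma finite_words: "finite (words m j)"
  by (rule finite_subset[of _ "{..<3 ^ m}"]) (auto simp: words_def)

definition silver_ratio :: real where "silver_ratio = 1 + sqrt 2"

text \<open>Let \<open>A k d\<close> be the set of words of length \<open>k + 1\<close> with last letter \<open>d\<close>. Appending a letter
multiplies the vector of the bounds \<open>(1, sqrt 2, 1)\<close> for \<open>d = 0, 1, 2\<close> by the eigenvalue \<open>\<lambda>\<close>, of which
it is an eigenvector. At the seam all nine pairs of letters are allowed, and the bounds grow by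
another factor \<open>sqrt 2\<close>, which is the purpose of \<open>c k\<close>. The sum of the entries, \<open>2 + sqrt 2 = sqrt 2 * \<lambda>\<close>, contributes
the second factor \<open>sqrt 2\<close>.\<close>

lemma card_words: "real (card (words m j)) \<le> 2 * silver_ratio ^ m"
proof (cases m)
  case 0
  have "words 0 j = {0}" by (auto simp: words_def)
  then show ?thesis using 0 by simp
next
  case m: (Suc k)
  define A where "A k d = {W. W < 3 ^ Suc k \<and> dig W k = d \<and>
    (\<forall>i<k. Suc i \<noteq> j \<longrightarrow> \<not> clash W i)}" for k d
  have fin: "finite (A k d)" for k d
    by (rule finite_subset[of _ "{..<3 ^ Suc k}"]) (auto simp: A_def)
  have rec: "card (A (Suc k) d) \<le> card (\<Union>d'\<in>E. A k d')"
    if E: "\<And>d'. d' < 3 \<Longrightarrow> d' \<notin> E \<Longrightarrow> Suc k \<noteq> j \<and> (d' = 0 \<and> d = 2 \<or> d' = 2 \<and> d = 0)"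
      and fE: "finite E" for k d E
  proof (rule card_inj_on_le)
    show "inj_on (\<lambda>W. W mod 3 ^ Suc k) (A (Suc k) d)"
    proof (rule inj_onI)
      fix V W assume VW: "V \<in> A (Suc k) d" "W \<in> A (Suc k) d" "V mod 3 ^ Suc k = W mod 3 ^ Suc k"
      have "V div 3 ^ Suc k = d" "W div 3 ^ Suc k = d"
        using VW(1,2) by (auto simp: A_def dig_def div_less_iff_less_mult mod_less simp del: power_Suc)
          (simp_all add: div_less_iff_less_mult)
      then show "V = W" using VW(3) by (metis mod_mult_div_eq)
    qed
    show "(\<lambda>W. W mod 3 ^ Suc k) ` A (Suc k) d \<subseteq> (\<Union>d'\<in>E. A k d')"
    proof safe
      fix W assume W: "W \<in> A (Suc k) d"
      have eq: "i \<le> k \<Longrightarrow> dig (W mod 3 ^ Suc k) i = dig W i" for i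
        by (rule dig_mod) simp
      have "W mod 3 ^ Suc k \<in> A k (dig W k)"
        using W unfolding A_def clash_def by (auto simp: eq simp del: power_Suc)
      moreover have "dig W k \<in> E"
      proof (rule ccontr)
        assume "dig W k \<notin> E"
        then have *: "Suc k \<noteq> j" "dig W k = 0 \<and> d = 2 \<or> dig W k = 2 \<and> d = 0"
          using E[of "dig W k"] by simp_all
        have "dig W (Suc k) = d" "Suc k \<noteq> j \<longrightarrow> \<not> clash W k"
          using W unfolding A_def by simp_all
        with * show False unfolding clash_def by auto
      qed
      ultimately show "W mod 3 ^ Suc k \<in> (\<Union>d'\<in>E. A k d')" by blast
    qed
    show "finite (\<Union>d'\<in>E. A k d')" using fE fin by blast
  qed
  have s2: "sqrt 2 * sqrt 2 = (2 :: real)" by simp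
  have s1: "1 \<le> sqrt (2 :: real)" by simp
  \<comment> \<open>The seam lies before position \<open>j\<close>.\<close>
  define c where "c k = (if 0 < j \<and> j \<le> k then sqrt 2 else 1 :: real)" for k
  have c: "1 \<le> c k" "c k \<le> c (Suc k)" "c k \<le> sqrt 2" for k by (auto simp: c_def)
  have bound: "card (A k 0) \<le> c k * silver_ratio ^ k \<and> card (A k 2) \<le> c k * silver_ratio ^ k \<and>
      card (A k 1) \<le> c k * sqrt 2 * silver_ratio ^ k" for k
  proof (induction k)
    case 0
    have "card (A 0 d) \<le> 1" if "d < 3" for d
    proof -
      have "A 0 d \<subseteq> {d}" by (auto simp: A_def dig_def)
      then show ?thesis using card_mono[of "{d}" "A 0 d"] by simp
    qed
    then have "card (A 0 0) \<le> 1" "card (A 0 1) \<le> 1" "card (A 0 2) \<le> 1" by simp_all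
    moreover have "1 \<le> c 0 * sqrt 2" using c(1)[of 0] s1 by (simp add: c_def)
    ultimately show ?case using c(1)[of 0] by simp
  next
    case (Suc k)
    let ?L = "silver_ratio ^ k"
    have L: "0 < ?L" by (simp add: silver_ratio_def add_pos_pos)
    have un3: "card (A k 0 \<union> A k 1 \<union> A k 2) \<le> card (A k 0) + card (A k 1) + card (A k 2)"
      by (meson add_mono card_Un_le le_trans order_refl)
    have d3: "d < 3 \<Longrightarrow> d = 0 \<or> d = 1 \<or> d = 2" for d :: nat by auto
    have all: "card (A (Suc k) d) \<le> c k * (2 + sqrt 2) * ?L" for d
    proof -
      have "card (A (Suc k) d) \<le> card (\<Union>d'\<in>{0,1,2}. A k d')"
        by (rule rec) (auto dest: d3)
      also have "(\<Union>d'\<in>{0,1,2}. A k d') = A k 0 \<union> A k 1 \<union> A k 2" by auto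
      finally have "card (A (Suc k) d) \<le> card (A k 0) + card (A k 1) + card (A k 2)"
        using un3 by linarith
      then have "real (card (A (Suc k) d)) \<le> real (card (A k 0)) + real (card (A k 1)) + real (card (A k 2))"
        by linarith
      also have "\<dots> \<le> c k * ?L + c k * sqrt 2 * ?L + c k * ?L"
        using Suc.IH by linarith
      finally show ?thesis by (simp add: algebra_simps)
    qed
    have lamS: "sqrt 2 * silver_ratio = 2 + sqrt 2" by (simp add: silver_ratio_def algebra_simps)
    show ?case
    proof (cases "Suc k = j")
      case True
      then have ck: "c k = 1" "c (Suc k) = sqrt 2" by (auto simp: c_def)
      have e: "c (Suc k) * silver_ratio ^ Suc k = c k * (2 + sqrt 2) * ?L"
        unfolding ck lamS[symmetric] by simp
      have "1 * (c (Suc k) * silver_ratio ^ Suc k) \<le> sqrt 2 * (c (Suc k) * silver_ratio ^ Suc k)"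
        using c(1)[of "Suc k"] by (intro mult_right_mono s1) (simp add: silver_ratio_def add_nonneg_nonneg)
      then have f: "c (Suc k) * silver_ratio ^ Suc k \<le> c (Suc k) * sqrt 2 * silver_ratio ^ Suc k"
        by (simp add: mult.assoc mult.left_commute)
      show ?thesis using all[of 0] all[of 1] all[of 2] e f by linarith
    next
      case False
      then have ck: "c (Suc k) = c k" by (auto simp: c_def)
      have two: "card (A (Suc k) d) \<le> c k * silver_ratio ^ Suc k" if "d = 0 \<or> d = 2" for d
      proof -
        have "card (A (Suc k) d) \<le> card (\<Union>d'\<in>{d,1}. A k d')"
          by (rule rec) (use that False in \<open>auto dest!: d3\<close>)
        also have "(\<Union>d'\<in>{d,1}. A k d') = A k d \<union> A k 1" by auto
        also have "card \<dots> \<le> card (A k d) + card (A k 1)" by (rule card_Un_le)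
        finally have "real (card (A (Suc k) d)) \<le> real (card (A k d)) + real (card (A k 1))"
          by linarith
        also have "\<dots> \<le> c k * ?L + c k * sqrt 2 * ?L"
          using Suc.IH that by auto
        finally show ?thesis by (simp add: silver_ratio_def algebra_simps)
      qed
      have "c k * (2 + sqrt 2) * ?L = c k * sqrt 2 * silver_ratio ^ Suc k"
        by (simp add: silver_ratio_def algebra_simps)
      with all[of 1] have one: "card (A (Suc k) 1) \<le> c k * sqrt 2 * silver_ratio ^ Suc k"
        by (rule ord_le_eq_trans)
      show ?thesis unfolding ck using two[of 0] two[of 2] one by blast
    qed
  qed
  have "words m j \<subseteq> A k 0 \<union> A k 1 \<union> A k 2"
  proof
    fix W assume "W \<in> words m j"
    moreover have "dig W k = 0 \<or> dig W k = 1 \<or> dig W k = 2" using dig_less[of W k] by linarith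
    ultimately show "W \<in> A k 0 \<union> A k 1 \<union> A k 2"
      unfolding words_def A_def m by auto
  qed
  then have "card (words m j) \<le> card (A k 0 \<union> A k 1 \<union> A k 2)"
    by (rule card_mono[rotated]) (simp add: fin)
  also have "\<dots> \<le> card (A k 0) + card (A k 1) + card (A k 2)"
    by (meson add_mono card_Un_le le_trans order_refl)
  finally have "real (card (words m j)) \<le> real (card (A k 0)) + real (card (A k 1)) + real (card (A k 2))"
    by linarith
  also have "\<dots> \<le> c k * silver_ratio ^ k + c k * sqrt 2 * silver_ratio ^ k + c k * silver_ratio ^ k"
    using bound[of k] by linarith
  also have "\<dots> = c k * ((2 + sqrt 2) * silver_ratio ^ k)" by (simp add: algebra_simps)
  also have "\<dots> \<le> sqrt 2 * ((2 + sqrt 2) * silver_ratio ^ k)"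
    by (intro mult_right_mono c) (simp add: silver_ratio_def add_nonneg_nonneg)
  also have "\<dots> = 2 * silver_ratio ^ m" by (simp add: m silver_ratio_def algebra_simps)
  finally show ?thesis .
qed

section \<open>The domination polynomial as a trace\<close>

text \<open>The word after \<open>t\<close> vertices, numbered row by row, if \<open>X\<close> is the set and \<open>w\<close> the word of the row before
the first one; undefined once a vertex remains undominated.\<close>

fun run :: "nat \<Rightarrow> nat \<Rightarrow> nat set \<Rightarrow> nat \<Rightarrow> nat option" where
  "run m w X 0 = Some w"
| "run m w X (Suc t) = (case run m w X t of None \<Rightarrow> None
     | Some W \<Rightarrow> if t \<in> X then Some (put m (t mod m) W) else omit m (t mod m) W)"

lemma run_cong: "X \<inter> {..<t} = Y \<inter> {..<t} \<Longrightarrow> run m w X t = run m w Y t"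
proof (induction t)
  case (Suc t)
  have "X \<inter> {..<t} = Y \<inter> {..<t}" "t \<in> X \<longleftrightarrow> t \<in> Y"
    using Suc.prems by (auto simp: set_eq_iff less_Suc_eq)
  then show ?case using Suc.IH by (simp split: option.split)
qed simp

lemma run_less: "run m w X t = Some W \<Longrightarrow> w < 3 ^ m \<Longrightarrow> 0 < m \<Longrightarrow> W < 3 ^ m"
  by (induction t arbitrary: W) (auto split: option.splits if_splits simp: put_less omit_less)

lemma run_prefix: "run m w X (s + t) = Some W \<Longrightarrow> \<exists>V. run m w X s = Some V"
  by (induction t arbitrary: W) (auto split: option.splits)

text \<open>The recursion that the program carries out. By \<open>run_poly_eq\<close> below it computes the generating polynomial of
the sets that lead from \<open>w\<close> to a given word.\<close>

fun run_poly :: "nat \<Rightarrow> nat \<Rightarrow> nat \<Rightarrow> nat \<Rightarrow> nat poly" where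
  "run_poly m w 0 W = (if W = w then 1 else 0)"
| "run_poly m w (Suc t) V = (\<Sum>W<3 ^ m. (if omit m (t mod m) W = Some V then run_poly m w t W else 0) +
     (if put m (t mod m) W = V then pCons 0 (run_poly m w t W) else 0))"

lemma sum_Pow_lessThan_Suc:
  "(\<Sum>X\<in>Pow {..<Suc t}. f X) = (\<Sum>X\<in>Pow {..<t}. f X + f (insert t X))"
proof -
  have "Pow {..<t} \<inter> insert t ` Pow {..<t} = {}" by auto
  moreover have "inj_on (insert t) (Pow {..<t})"
    by (rule inj_onI) (metis Diff_insert_absorb PowD lessThan_iff less_irrefl subsetD)
  ultimately show ?thesis
    unfolding lessThan_Suc Pow_insert
    by (subst sum.union_disjoint) (simp_all add: sum.reindex sum.distrib)
qed

text \<open>The sets of the first \<open>t + 1\<close> vertices are the sets \<open>X\<close> of the first \<open>t\<close> vertices, continued by \<open>omit\<close>, and the sets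
\<open>insert t X\<close>, continued by \<open>put\<close> and counted with one more factor of the variable.\<close>

lemma run_poly_eq:
  assumes "w < 3 ^ m" "0 < m"
  shows "run_poly m w t V = (\<Sum>X\<in>Pow {..<t}. if run m w X t = Some V then monom 1 (card X) else 0)"
proof (induction t arbitrary: V)
  case 0
  then show ?case by (auto simp: monom_eq_1 simp del: One_nat_def)
next
  case (Suc t)
  let ?j = "t mod m"
  let ?R = "\<lambda>X W. if run m w X t = Some W then monom 1 (card X) else (0 :: nat poly)"
  have if_pCons: "(if P then pCons 0 a else 0) = pCons 0 (if P then a else 0)" for P and a :: "nat poly"
    by simp
  have pC: "(\<Sum>x\<in>S. pCons 0 (f x)) = pCons 0 (\<Sum>x\<in>S. f x)" if "finite S"
      for S and f :: "nat set \<Rightarrow> nat poly"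
    using that by (induction S) auto
  have "run_poly m w (Suc t) V = (\<Sum>W<3 ^ m. \<Sum>X\<in>Pow {..<t}.
      (if omit m ?j W = Some V then ?R X W else 0) + (if put m ?j W = V then pCons 0 (?R X W) else 0))"
    unfolding run_poly.simps by (rule sum.cong) (auto simp: Suc pC sum.distrib)
  also have "\<dots> = (\<Sum>X\<in>Pow {..<t}. \<Sum>W<3 ^ m.
      (if omit m ?j W = Some V then ?R X W else 0) + (if put m ?j W = V then pCons 0 (?R X W) else 0))"
    by (rule sum.swap)
  also have "\<dots> = (\<Sum>X\<in>Pow {..<t}. (if run m w X (Suc t) = Some V then monom 1 (card X) else 0) +
      (if run m w (insert t X) (Suc t) = Some V then monom 1 (card (insert t X)) else 0))"
  proof (rule sum.cong[OF refl])
    fix X assume X: "X \<in> Pow {..<t}"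
    then have t: "t \<notin> X" and fin: "finite X" by (auto intro: finite_subset)
    have ins: "run m w (insert t X) t = run m w X t" by (rule run_cong) auto
    show "(\<Sum>W<3 ^ m. (if omit m ?j W = Some V then ?R X W else 0) +
        (if put m ?j W = V then pCons 0 (?R X W) else 0)) =
      (if run m w X (Suc t) = Some V then monom 1 (card X) else 0) +
      (if run m w (insert t X) (Suc t) = Some V then monom 1 (card (insert t X)) else 0)"
    proof (cases "run m w X t")
      case None
      then show ?thesis using ins by (auto intro!: sum.neutral)
    next
      case (Some U)
      then have U: "U < 3 ^ m" using run_less assms by blast
      have "(\<Sum>W<3 ^ m. (if omit m ?j W = Some V then ?R X W else 0) +
          (if put m ?j W = V then pCons 0 (?R X W) else 0)) =
        (\<Sum>W<3 ^ m. if W = U then (if omit m ?j W = Some V then monom 1 (card X) else 0) +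
          (if put m ?j W = V then pCons 0 (monom 1 (card X)) else 0) else 0)"
        by (rule sum.cong) (auto simp: Some)
      also have "\<dots> = (if omit m ?j U = Some V then monom 1 (card X) else 0) +
          (if put m ?j U = V then pCons 0 (monom 1 (card X)) else 0)"
        using U by simp
      finally show ?thesis
        using t fin Some ins by (simp add: monom_Suc)
    qed
  qed
  also have "\<dots> = (\<Sum>X\<in>Pow {..<Suc t}. if run m w X (Suc t) = Some V then monom 1 (card X) else 0)"
    by (rule sum_Pow_lessThan_Suc[symmetric])
  finally show ?case .
qed

text \<open>The letters after the first \<open>j\<close> vertices of a row have been added to the word \<open>W\<close>, where \<open>x\<close> describes
the set within the row. A vertex of the new row only knows the neighbours that have been added; the neighbour
across the boundary of the row becomes known with the last vertex.\<close>

definition row_dig :: "nat \<Rightarrow> (nat \<Rightarrow> bool) \<Rightarrow> nat \<Rightarrow> nat \<Rightarrow> nat \<Rightarrow> nat" where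
  "row_dig m x W j i =
    (if j \<le> i then dig W i
     else if x i then 2
     else if dig W i = 2 \<or> 0 < i \<and> x (i - 1) \<or> Suc i < j \<and> x (Suc i) \<or>
       i = 0 \<and> j = m \<and> x (m - 1) \<or> Suc i = m \<and> x 0
     then 1 else 0)"

lemma dig_put_row:
  assumes V: "\<And>i. i < m \<Longrightarrow> dig V i = row_dig m x W j i" and "j < m" "x j" "i < m"
  shows "dig (put m j V) i = row_dig m x W (Suc j) i"
proof -
  consider "i = j" | "j < i" | "i < j" "Suc i = j" | "i < j" "Suc i \<noteq> j" by linarith
  then show ?thesis
  proof cases
    case 3
    then have ij: "i = j - 1" by simp
    show ?thesis
      unfolding dig_put V[OF \<open>i < m\<close>] using 3 assms(2-) ij by (simp add: row_dig_def)
  next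
    case 4
    then have "i \<noteq> j - 1" "i \<noteq> j" by auto
    then show ?thesis
      unfolding dig_put V[OF \<open>i < m\<close>] right_of_def
      using 4 assms(2-) by (cases "Suc j = m"; cases "i = 0") (auto simp: row_dig_def)
  qed (use assms(2-) in \<open>auto simp: dig_put V right_of_def row_dig_def\<close>)
qed

lemma dig_omit_row:
  assumes V: "\<And>i. i < m \<Longrightarrow> dig V i = row_dig m x W j i" and "j < m" "\<not> x j" "i < m"
    and omit: "omit m j V = Some U"
  shows "dig U i = row_dig m x W (Suc j) i"
proof (cases "i = j")
  case True
  have 0: "dig V j \<noteq> 0" using omit by (auto simp: omit_def split: if_splits)
  have d1: "dig V j = dig W j" using V[OF \<open>j < m\<close>] by (simp add: row_dig_def)
  have d2: "dig V (j - 1) = 2 \<longleftrightarrow> (if j = 0 then dig W 0 = 2 else x (j - 1))"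
    using V[of "j - 1"] \<open>j < m\<close> by (cases j) (auto simp: row_dig_def)
  have d3: "dig V (right_of m j) = 2 \<longleftrightarrow> (if Suc j = m \<and> j \<noteq> 0 then x 0 else dig W j = 2)"
    using V[of "right_of m j"] \<open>j < m\<close>
    by (cases "Suc j = m"; cases "j = 0") (auto simp: row_dig_def right_of_def)
  have "dig U i = (if dig V j = 2 \<or> dig V (j - 1) = 2 \<or> dig V (right_of m j) = 2 then 1 else 0)"
    using omit 0 True unfolding omit_def by (auto simp only: if_False option.inject dig_set_dig) (auto simp: dig_set_dig)
  then show ?thesis
    unfolding d1 d2 d3 True using \<open>j < m\<close> \<open>\<not> x j\<close> by (auto simp: row_dig_def)
next
  case False
  have "dig U i = dig V i"
    using omit False by (auto simp: omit_def dig_set_dig split: if_splits)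
  also have "\<dots> = row_dig m x W (Suc j) i"
    unfolding V[OF \<open>i < m\<close>] using False assms(2-4) by (auto simp: row_dig_def less_Suc_eq)
  finally show ?thesis .
qed

lemma run_row:
  assumes W: "run m w X (r * m) = Some W" "W < 3 ^ m" and "j \<le> m"
  shows "case run m w X (r * m + j) of
      None \<Rightarrow> \<exists>i<j. dig W i = 0 \<and> r * m + i \<notin> X
    | Some V \<Rightarrow> V < 3 ^ m \<and> (\<forall>i<j. dig W i = 0 \<longrightarrow> r * m + i \<in> X) \<and>
        (\<forall>i<m. dig V i = row_dig m (\<lambda>i. r * m + i \<in> X) W j i)"
  using \<open>j \<le> m\<close>
proof (induction j)
  case 0
  then show ?case using W by (simp add: row_dig_def)
next
  case (Suc j)
  then have j: "j < m" and mod: "(r * m + j) mod m = j" by auto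
  let ?x = "\<lambda>i. r * m + i \<in> X"
  show ?case
  proof (cases "run m w X (r * m + j)")
    case None
    then show ?thesis using Suc by (auto simp: less_Suc_eq)
  next
    case (Some V)
    have V: "V < 3 ^ m" "\<forall>i<j. dig W i = 0 \<longrightarrow> ?x i"
      and dV: "\<And>i. i < m \<Longrightarrow> dig V i = row_dig m ?x W j i"
      using Suc j Some by simp_all
    have Vj: "dig V j = dig W j" using dV[OF j] by (simp add: row_dig_def)
    show ?thesis
    proof (cases "?x j")
      case True
      then have run: "run m w X (r * m + Suc j) = Some (put m j V)"
        using Some mod by simp
      have "\<forall>i<m. dig (put m j V) i = row_dig m ?x W (Suc j) i"
        using dig_put_row[where x = ?x and W = W, OF dV j True] by blast
      then show ?thesis
        unfolding run using V put_less[OF V(1) j] True by (simp add: less_Suc_eq all_conj_distrib)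
    next
      case False
      then have run: "run m w X (r * m + Suc j) = omit m j V"
        using Some mod by simp
      show ?thesis
      proof (cases "omit m j V")
        case None
        then have "dig W j = 0" using Vj by (simp add: omit_def split: if_splits)
        then show ?thesis unfolding run None using False by auto
      next
        case (Some U)
        then have "dig W j \<noteq> 0" using Vj by (auto simp: omit_def split: if_splits)
        moreover have "\<forall>i<m. dig U i = row_dig m ?x W (Suc j) i"
          using dig_omit_row[where x = ?x and W = W, OF dV j False _ Some] by blast
        ultimately show ?thesis
          unfolding run Some using V omit_less[OF Some V(1) j] by (auto simp: less_Suc_eq)
      qed
    qed
  qed
qed

text \<open>The word of a row in terms of the set in this row (\<open>x\<close>) and in the previous row (\<open>y\<close>). Adding \<open>m - 1\<close> modulo \<open>m\<close> is
a step to the left.\<close>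

definition profile :: "nat \<Rightarrow> (nat \<Rightarrow> bool) \<Rightarrow> (nat \<Rightarrow> bool) \<Rightarrow> nat \<Rightarrow> nat" where
  "profile m x y i =
    (if x i then 2 else if y i \<or> x ((i + 1) mod m) \<or> x ((i + (m - 1)) mod m) then 1 else 0)"

lemma pred_mod: "i < m \<Longrightarrow> (i + (m - 1)) mod m = (if i = 0 then m - 1 else i - (1 :: nat))"
  by (cases i) (simp_all add: mod_if)

lemma succ_mod: "i < m \<Longrightarrow> (i + 1) mod m = (if Suc i = m then 0 else Suc i)"
  by auto

lemma run_full_row:
  assumes W: "run m w X (r * m) = Some W" "W < 3 ^ m" and "0 < m"
  shows "case run m w X (Suc r * m) of
      None \<Rightarrow> \<exists>i<m. dig W i = 0 \<and> r * m + i \<notin> X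
    | Some V \<Rightarrow> V < 3 ^ m \<and> (\<forall>i<m. dig W i = 0 \<longrightarrow> r * m + i \<in> X) \<and>
        (\<forall>i<m. dig V i = profile m (\<lambda>i. r * m + i \<in> X) (\<lambda>i. dig W i = 2) i)"
proof -
  have eq: "Suc r * m = r * m + m" by simp
  show ?thesis
  proof (cases "run m w X (r * m + m)")
    case None
    then show ?thesis using run_row[OF W order_refl] unfolding eq by simp
  next
    case (Some V)
    let ?x = "\<lambda>i. r * m + i \<in> X"
    from Some have V: "V < 3 ^ m" "\<forall>i<m. dig W i = 0 \<longrightarrow> ?x i"
      and d: "\<And>i. i < m \<Longrightarrow> dig V i = row_dig m ?x W m i"
      using run_row[OF W order_refl] by simp_all
    have "row_dig m x W m i = profile m x (\<lambda>i. dig W i = 2) i" if "i < m" for i x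
      unfolding profile_def pred_mod[OF that] succ_mod[OF that] row_dig_def
      using that by (cases "i = 0"; cases "Suc i = m") auto
    then have "\<forall>i<m. dig V i = profile m ?x (\<lambda>i. dig W i = 2) i"
      using d by simp
    then show ?thesis unfolding eq Some using V by simp
  qed
qed

lemma dominating_torus_iff:
  assumes "0 < m" "0 < n"
  shows "dominating_set (torus_graph m n) S \<longleftrightarrow> S \<subseteq> {..<m} \<times> {..<n} \<and>
    (\<forall>r<n. \<forall>i<m. (i, r) \<in> S \<or> ((i + 1) mod m, r) \<in> S \<or> ((i + (m - 1)) mod m, r) \<in> S \<or>
       (i, (r + 1) mod n) \<in> S \<or> (i, (r + (n - 1)) mod n) \<in> S)"
proof -
  have cyc: "i = (j + 1) mod k \<longleftrightarrow> j = (i + (k - 1)) mod k" if "i < k" "j < k" for i j k :: nat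
    unfolding pred_mod[OF that(1)] succ_mod[OF that(2)] using that by auto
  have nb: "(i, j) \<in> parcs (cycle_graph k) \<longleftrightarrow>
      j \<noteq> i \<and> (j = (i + 1) mod k \<or> j = (i + (k - 1)) mod k)" if "i < k" for i j k
    using that cyc[of i k j] by (auto simp: cycle_graph_def)
  have key: "(i, r) \<in> S \<or> (\<exists>u\<in>S. ((i, r), u) \<in> parcs (torus_graph m n)) \<longleftrightarrow>
      (i, r) \<in> S \<or> ((i + 1) mod m, r) \<in> S \<or> ((i + (m - 1)) mod m, r) \<in> S \<or>
       (i, (r + 1) mod n) \<in> S \<or> (i, (r + (n - 1)) mod n) \<in> S" if "i < m" "r < n" for i r
  proof -
    have "((i, r), (i', r')) \<in> parcs (torus_graph m n) \<longleftrightarrow>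
        i' = i \<and> r' \<noteq> r \<and> (r' = (r + 1) mod n \<or> r' = (r + (n - 1)) mod n) \<or>
        r' = r \<and> i' \<noteq> i \<and> (i' = (i + 1) mod m \<or> i' = (i + (m - 1)) mod m)" for i' r'
      using that by (auto simp: torus_graph_def cartesian_product_def nb)
        (auto simp: cycle_graph_def)
    then show ?thesis
      unfolding Bex_def split_paired_Ex by metis
  qed
  have verts: "pverts (torus_graph m n) = {..<m} \<times> {..<n}"
    by (simp add: torus_graph_def cartesian_product_def cycle_graph_def)
  have "(\<forall>v\<in>{..<m} \<times> {..<n}. v \<in> S \<or> (\<exists>u\<in>S. (v, u) \<in> parcs (torus_graph m n))) \<longleftrightarrow>
      (\<forall>r<n. \<forall>i<m. (i, r) \<in> S \<or> (\<exists>u\<in>S. ((i, r), u) \<in> parcs (torus_graph m n)))"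
    by auto
  then show ?thesis
    unfolding dominating_set_def verts by (simp only: key cong: imp_cong)
qed

text \<open>Domination in the torus, with vertices as numbers \<open>r * m + i\<close>.\<close>

definition covered :: "nat \<Rightarrow> nat \<Rightarrow> nat set \<Rightarrow> bool" where
  "covered m n X \<longleftrightarrow> (\<forall>r<n. \<forall>i<m. r * m + i \<in> X \<or> r * m + (i + 1) mod m \<in> X \<or>
     r * m + (i + (m - 1)) mod m \<in> X \<or> (r + 1) mod n * m + i \<in> X \<or> (r + (n - 1)) mod n * m + i \<in> X)"

lemma domination_poly_torus:
  assumes "0 < m" "0 < n"
  shows "domination_poly (torus_graph m n) =
    (\<Sum>X | X \<subseteq> {..<m * n} \<and> covered m n X. monom 1 (card X))"
  unfolding domination_poly_def
proof (rule sum.reindex_bij_witness)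
  let ?f = "\<lambda>S. (\<lambda>(i, r). r * m + i) ` S" and ?g = "\<lambda>X. (\<lambda>t. (t mod m, t div m)) ` X"
  have inv: "?g (?f S) = S" if "S \<subseteq> {..<m} \<times> {..<n}" for S
    using that by (force simp: image_image)
  have inv': "?f (?g X) = X" for X
    by (simp add: image_image)
  have mem: "r * m + i \<in> ?f S \<longleftrightarrow> (i, r) \<in> S" if "i < m" "S \<subseteq> {..<m} \<times> {..<n}" for i r S
  proof
    assume "r * m + i \<in> ?f S"
    then obtain i' r' where 1: "(i', r') \<in> S" "r * m + i = r' * m + i'" by auto
    then have "i' < m" using that by auto
    then have "i = i'" "r = r'"
      using that(1) arg_cong[OF 1(2), of "\<lambda>x. x mod m"] arg_cong[OF 1(2), of "\<lambda>x. x div m"] by simp_all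
    then show "(i, r) \<in> S" using 1 by simp
  qed force
  have cov: "covered m n (?f S) \<longleftrightarrow> dominating_set (torus_graph m n) S" if "S \<subseteq> {..<m} \<times> {..<n}" for S
    unfolding covered_def dominating_torus_iff[OF assms]
    using that assms by (simp add: mem)
  {
    fix S assume "S \<in> {S. dominating_set (torus_graph m n) S}"
    then have S: "S \<subseteq> {..<m} \<times> {..<n}" "covered m n (?f S)"
      using dominating_torus_iff[OF assms] cov by auto
    show "?g (?f S) = S" using S(1) by (rule inv)
    have "r * m + i < m * n" if "i < m" "r < n" for i r
    proof -
      have "r * m + i < Suc r * m" using that by simp
      also have "\<dots> \<le> n * m" using that by (intro mult_le_mono1) simp
      finally show ?thesis by (simp add: mult.commute)
    qed
    then show "?f S \<in> {X. X \<subseteq> {..<m * n} \<and> covered m n X}"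
      using S by auto
    have "inj_on (\<lambda>(i, r). r * m + i) S"
      using inv[OF S(1)] by (intro inj_on_inverseI[where g = "\<lambda>t. (t mod m, t div m)"])
          (use S(1) in auto)
    then show "monom 1 (card (?f S)) = monom 1 (card S)" by (simp add: card_image)
  next
    fix X assume X: "X \<in> {X. X \<subseteq> {..<m * n} \<and> covered m n X}"
    then have sub: "?g X \<subseteq> {..<m} \<times> {..<n}"
      using assms by (auto simp: less_mult_imp_div_less mult.commute)
    show "?f (?g X) = X" by (rule inv')
    show "?g X \<in> {S. dominating_set (torus_graph m n) S}"
      using X cov[OF sub] by (simp add: inv')
  }
qed

text \<open>In a closed run, the letters 2 of each word are known: those of the start word are those of the last
word, hence the set in the last row. So every word, the start word included, is the profile
of its row, and a run fails to exist only if a letter 0 is not followed by a 2, which means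
that the vertex is not dominated.\<close>

lemma closed_run_iff:
  assumes "0 < m" "0 < n" "w < 3 ^ m"
  shows "run m w X (n * m) = Some w \<longleftrightarrow> covered m n X \<and>
    (\<forall>i<m. dig w i = profile m (\<lambda>i. (n - 1) * m + i \<in> X) (\<lambda>i. (n - 1 + (n - 1)) mod n * m + i \<in> X) i)"
proof -
  define x where "x r i \<longleftrightarrow> r * m + i \<in> X" for r i
  define pr where "pr r = (r + (n - 1)) mod n" for r
  define P where "P r = profile m (x r) (x (pr r))" for r
  have pr: "pr r = (if r = 0 then n - 1 else r - 1)" if "r < n" for r
    unfolding pr_def using that by (rule pred_mod)
  have P2: "P r i = 2 \<longleftrightarrow> x r i" for r i by (simp add: P_def profile_def)
  have P0: "P r i = 0 \<longleftrightarrow> \<not> (x r i \<or> x r ((i + 1) mod m) \<or> x r ((i + (m - 1)) mod m) \<or> x (pr r) i)" for r i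
    by (auto simp: P_def profile_def)
  have pcong: "profile m a b i = profile m a b' i" if "b i \<longleftrightarrow> b' i" for a b b' i
    using that by (simp add: profile_def)
  have cov: "covered m n X \<longleftrightarrow> (\<forall>r<n. \<forall>i<m. P r i = 0 \<longrightarrow> x ((r + 1) mod n) i)"
    unfolding covered_def P0 x_def pr_def by blast
  show ?thesis (is "?run \<longleftrightarrow> covered m n X \<and> ?w")
  proof
    assume ?run
    have "\<exists>V. run m w X (r * m) = Some V" if "r \<le> n" for r
      using run_prefix[of m w X "r * m" "(n - r) * m" w] \<open>?run\<close> that
      by (simp add: distrib_right[symmetric])
    then obtain V where V: "\<And>r. r \<le> n \<Longrightarrow> run m w X (r * m) = Some (V r)"
      by metis
    have V0: "V 0 = w" using V[of 0] by simp
    have Vn: "V n = w" using V[of n] \<open>?run\<close> by simp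
    have Vless: "V r < 3 ^ m" if "r \<le> n" for r
      using run_less[OF V[OF that]] assms by simp
    have row: "(\<forall>i<m. dig (V r) i = 0 \<longrightarrow> x r i) \<and>
        (\<forall>i<m. dig (V (Suc r)) i = profile m (x r) (\<lambda>i. dig (V r) i = 2) i)" if "r < n" for r
      using run_full_row[OF V Vless \<open>0 < m\<close>, of r] V[of "Suc r"] that by (simp add: x_def[abs_def])
    have two: "dig (V (Suc r)) i = 2 \<longleftrightarrow> x r i" if "r < n" "i < m" for r i
      using row[of r] that by (simp add: profile_def)
    have two': "dig (V r) i = 2 \<longleftrightarrow> x (pr r) i" if "r < n" "i < m" for r i
    proof (cases r)
      case 0
      then show ?thesis using two[of "n - 1" i] that assms V0 Vn by (simp add: pr)
    next
      case (Suc r')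
      then show ?thesis using two[of r' i] that by (simp add: pr)
    qed
    have VP: "dig (V (Suc r)) i = P r i" if "r < n" "i < m" for r i
      using row[of r] pcong[where b = "\<lambda>i. dig (V r) i = 2" and b' = "x (pr r)", of i] two'[OF that] that by (simp add: P_def)
    have "covered m n X"
      unfolding cov
    proof (intro allI impI)
      fix r i assume ri: "r < n" "i < m" "P r i = 0"
      then have d: "dig (V (Suc r)) i = 0" using VP by simp
      show "x ((r + 1) mod n) i"
      proof (cases "Suc r = n")
        case True
        then show ?thesis using row[of 0] d ri assms V0 Vn by auto
      next
        case False
        then show ?thesis using row[of "Suc r"] d ri by simp
      qed
    qed
    moreover have ?w
      using VP[of "n - 1"] assms Vn by (simp add: P_def x_def[abs_def] pr_def)
    ultimately show "covered m n X \<and> ?w" ..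
  next
    assume R: "covered m n X \<and> ?w"
    have w: "dig w i = P (n - 1) i" if "i < m" for i
      using R that by (simp add: P_def x_def[abs_def] pr_def)
    have "\<exists>V < 3 ^ m. run m w X (r * m) = Some V
        \<and> (\<forall>i<m. dig V i = P (if r = 0 then n - 1 else r - 1) i)"
      if "r \<le> n" for r
      using that
    proof (induction r)
      case 0
      then show ?case using assms w by simp
    next
      case (Suc r)
      then obtain V where V: "V < 3 ^ m" "run m w X (r * m) = Some V"
        "\<And>i. i < m \<Longrightarrow> dig V i = P (pr r) i"
        using pr[of r] by auto
      have r: "r < n" using Suc.prems by simp
      have step: "(pr r + 1) mod n = r" "pr r < n" using r by (auto simp: pr)
      have ok: "\<forall>i<m. dig V i = 0 \<longrightarrow> r * m + i \<in> X"
        using R step V(3) unfolding cov x_def by metis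
      then obtain U where U: "run m w X (Suc r * m) = Some U" "U < 3 ^ m"
          "\<forall>i<m. dig U i = profile m (x r) (\<lambda>i. dig V i = 2) i"
        using run_full_row[OF V(2,1) \<open>0 < m\<close>] by (auto split: option.splits simp: x_def[abs_def])
      have "dig U i = P r i" if "i < m" for i
        using U(3) that pcong[where b = "\<lambda>i. dig V i = 2" and b' = "x (pr r)", of i] V(3)[OF that] P2
        by (simp add: P_def)
      then show ?case using U by auto
    qed
    from this[of n] obtain V where V: "V < 3 ^ m" "run m w X (n * m) = Some V"
        "\<forall>i<m. dig V i = P (n - 1) i" using assms by auto
    have "V = w"
      using V(1) assms(3) by (rule word_eqI) (use V(3) w in simp)
    then show ?run using V by simp
  qed
qed

text \<open>By \<open>closed_run_iff\<close>, each dominating set has a run that closes up for exactly one start word, the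
profile of its last row. A profile has no clashes, so summing over \<open>words m 0\<close> loses nothing.\<close>

lemma trace_run_poly:
  assumes "0 < m" "0 < n"
  shows "(\<Sum>w\<in>words m 0. run_poly m w (m * n) w) = domination_poly (torus_graph m n)"
proof -
  let ?N = "n * m"
  have "(\<Sum>w\<in>words m 0. run_poly m w ?N w) =
      (\<Sum>w\<in>words m 0. \<Sum>X\<in>Pow {..<?N}. if run m w X ?N = Some w then monom 1 (card X) else 0)"
    using assms by (intro sum.cong refl run_poly_eq) (auto simp: words_def)
  also have "\<dots> = (\<Sum>X\<in>Pow {..<?N}. \<Sum>w\<in>words m 0. if run m w X ?N = Some w then monom 1 (card X) else 0)"
    by (rule sum.swap)
  also have "\<dots> = (\<Sum>X\<in>Pow {..<?N}. if covered m n X then monom 1 (card X) else 0)"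
  proof (rule sum.cong[OF refl])
    fix X
    let ?p = "profile m (\<lambda>i. (n - 1) * m + i \<in> X) (\<lambda>i. (n - 1 + (n - 1)) mod n * m + i \<in> X)"
    have "?p i < 3" for i by (simp add: profile_def)
    then obtain v where v: "v < 3 ^ m" "\<forall>i<m. dig v i = ?p i"
      using word_exists[of m ?p] by blast
    have "\<not> clash v i" if "Suc i < m" for i
    proof -
      have "(i + 1) mod m = Suc i" "(Suc i + (m - 1)) mod m = i"
        using that pred_mod[of "Suc i" m] by simp_all
      then show ?thesis
        using v(2) that unfolding clash_def by (simp add: profile_def)
    qed
    then have vw: "v \<in> words m 0" using v by (simp add: words_def)
    have "run m w X ?N = Some w \<longleftrightarrow> covered m n X \<and> w = v" if "w \<in> words m 0" for w
      using closed_run_iff[OF assms, of w X] word_eqI[of w m v] that v by (auto simp: words_def)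
    then have "(\<Sum>w\<in>words m 0. if run m w X ?N = Some w then monom 1 (card X) else 0) =
        (\<Sum>w\<in>words m 0. if w = v then (if covered m n X then monom 1 (card X) else 0) else (0 :: nat poly))"
      by (intro sum.cong) auto
    then show "(\<Sum>w\<in>words m 0. if run m w X ?N = Some w then monom 1 (card X) else 0) =
        (if covered m n X then monom 1 (card X) else (0 :: nat poly))"
      using vw finite_words by simp
  qed
  also have "\<dots> = (\<Sum>X | X \<in> Pow {..<?N} \<and> covered m n X. monom 1 (card X))"
    by (rule sum.inter_filter[symmetric]) simp
  finally show ?thesis
    using assms by (simp add: domination_poly_torus mult.commute)
qed

definition contrib :: "nat \<Rightarrow> nat \<Rightarrow> (nat \<Rightarrow> nat poly) \<Rightarrow> nat \<Rightarrow> nat \<Rightarrow> nat poly" where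
  "contrib m j T W U = (if omit m j W = Some U then T W else 0) +
     (if put m j W = U then pCons 0 (T W) else 0)"

lemma run_poly_Suc: "run_poly m w (Suc t) U = (\<Sum>W<3 ^ m. contrib m (t mod m) (run_poly m w t) W U)"
  by (simp add: contrib_def)

lemma monom_1_mult: "monom 1 1 * q = pCons 0 (q :: nat poly)"
  by (simp add: poly_eq_iff coeff_monom_mult coeff_pCons split: nat.split)

section \<open>A program logic with time and space bounds\<close>

abbreviation (input) "rZero \<equiv> 10 :: nat"
abbreviation (input) "rOne \<equiv> 2 :: nat"

text \<open>The loop variable is tested against the current contents of \<open>l\<close>; the rules below ask the body to preserve both.\<close>

definition For :: "nat \<Rightarrow> nat \<Rightarrow> prog \<Rightarrow> prog" where
  "For i l c = Seq (Instr (Const i 0)) (While (Less i l) (Seq c (Instr (Arith Add i i rOne))))"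

fun block :: "prog list \<Rightarrow> prog" where
  "block [] = Skip"
| "block (c # cs) = Seq c (block cs)"

lemma set_reg_simps [simp]:
  "reg (set_reg r v s) = (reg s)(r := v)"
  "imem (set_reg r v s) = imem s"
  "cmem (set_reg r v s) = cmem s"
  "conts (set_reg r v s) = conts s"
  "icells (set_reg r v s) = icells s"
  "ccells (set_reg r v s) = ccells s"
  by (simp_all add: set_reg_def)

lemma touch_simps [simp]:
  "reg (touch_i a s) = reg s" "imem (touch_i a s) = imem s" "cmem (touch_i a s) = cmem s"
  "conts (touch_i a s) = conts s" "icells (touch_i a s) = max (icells s) (Suc a)"
  "ccells (touch_i a s) = ccells s"
  "reg (touch_c a s) = reg s" "imem (touch_c a s) = imem s" "cmem (touch_c a s) = cmem s"
  "conts (touch_c a s) = conts s" "icells (touch_c a s) = icells s"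
  "ccells (touch_c a s) = max (ccells s) (Suc a)"
  by (simp_all add: touch_i_def touch_c_def)

lemma set_coeff_simps [simp]:
  "reg (set_coeff a v s) = reg s" "imem (set_coeff a v s) = imem s"
  "cmem (set_coeff a v s) = (cmem s)(a := v)"
  "conts (set_coeff a v s) = conts s" "icells (set_coeff a v s) = icells s"
  "ccells (set_coeff a v s) = max (ccells s) (Suc a)"
  by (simp_all add: set_coeff_def)

lemma set_cont_simps [simp]:
  "reg (set_cont i M s) = reg s" "imem (set_cont i M s) = imem s" "cmem (set_cont i M s) = cmem s"
  "conts (set_cont i M s) = (conts s)(i := M)" "icells (set_cont i M s) = icells s"
  "ccells (set_cont i M s) = ccells s"
  by (simp_all add: set_cont_def)

text \<open>\<open>B\<close> bounds the integers, and \<open>I\<close>, \<open>C\<close>, \<open>K\<close> bound the integer memory, the coefficient memory and the only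
container in use, number 0. Every container operation then costs at most \<open>D\<close>.\<close>

locale machine =
  fixes p B I C K D :: nat
  assumes B: "2 \<le> B" and IB: "I \<le> B" and CB: "C \<le> B" and KD: "K + 2 \<le> 2 ^ D" 
begin

definition ok :: "state \<Rightarrow> bool" where
  "ok s \<longleftrightarrow> ints_below B s \<and> icells s \<le> I \<and> ccells s \<le> C \<and> (\<forall>i. i \<noteq> 0 \<longrightarrow> conts s i = Map.empty) \<and>
     finite (dom (conts s 0)) \<and> card (dom (conts s 0)) \<le> K"

lemma ok_reg: "ok s \<Longrightarrow> reg s r < B"
  by (simp add: ok_def ints_below_def)

lemma ok_imem: "ok s \<Longrightarrow> imem s a < B"
  by (simp add: ok_def ints_below_def)

lemma ok_conts: "ok s \<Longrightarrow> conts s i k = Some v \<Longrightarrow> k < B \<and> v < B"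
  by (auto simp add: ok_def ints_below_def)

lemma ok_space:
  assumes "ok s"
  shows "space_usage s \<le> I + C + K"
proof -
  have "i = 0" if "conts s i k = Some v" for i k v
    using assms that by (cases "i = 0") (auto simp: ok_def)
  then have "{(i, k). k \<in> dom (conts s i)} = {0} \<times> dom (conts s 0)" by auto
  then have "card {(i, k). k \<in> dom (conts s i)} \<le> K"
    using assms by (simp add: card_cartesian_product ok_def)
  then show ?thesis using assms by (simp add: space_usage_def ok_def)
qed

lemma ok_cont_cost:
  assumes "ok s"
  shows "cont_cost i s \<le> D"
proof -
  have "card (dom (conts s i)) \<le> K"
    using assms by (cases "i = 0") (auto simp: ok_def)
  then have "card (dom (conts s i)) + 2 \<le> 2 ^ D" using KD by linarith
  then have "real (card (dom (conts s i)) + 2) \<le> 2 ^ D"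
    by (metis of_nat_le_iff of_nat_numeral of_nat_power)
  then have "log 2 (real (card (dom (conts s i)) + 2)) \<le> real D"
    by (subst log_le_iff) (auto simp: powr_realpow)
  then show ?thesis unfolding cont_cost_def by (simp add: nat_le_iff ceiling_le_iff)
qed

text \<open>What an instruction must satisfy so that it stays within the limits, given that they hold before it.\<close>

fun safe :: "instr \<Rightarrow> state \<Rightarrow> bool" where
  "safe (Const r k) s \<longleftrightarrow> k < B"
| "safe (Move r a) s \<longleftrightarrow> True"
| "safe (Arith f r a b) s \<longleftrightarrow> arith f (reg s a) (reg s b) < B"
| "safe (Load r a) s \<longleftrightarrow> reg s a < I"
| "safe (Store a b) s \<longleftrightarrow> reg s a < I"
| "safe (CZero a) s \<longleftrightarrow> reg s a < C"
| "safe (COne a) s \<longleftrightarrow> reg s a < C"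
| "safe (CCopy a b) s \<longleftrightarrow> reg s a < C \<and> reg s b < C"
| "safe (CAdd a b) s \<longleftrightarrow> reg s a < C \<and> reg s b < C"
| "safe (Insert i a b) s \<longleftrightarrow> i = 0 \<and> card (insert (reg s a) (dom (conts s 0))) \<le> K"
| "safe (Delete i a) s \<longleftrightarrow> i = 0"
| "safe (Lookup i a r f) s \<longleftrightarrow> True"
| "safe (LowerBound i a r f) s \<longleftrightarrow> False"

lemma ok_set_reg: "ok s \<Longrightarrow> v < B \<Longrightarrow> ok (set_reg r v s)"
  by (auto simp: ok_def ints_below_def)

lemma ok_touch_i: "ok s \<Longrightarrow> a < I \<Longrightarrow> ok (touch_i a s)"
  by (auto simp: ok_def ints_below_def)

lemma ok_touch_c: "ok s \<Longrightarrow> a < C \<Longrightarrow> ok (touch_c a s)"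
  by (auto simp: ok_def ints_below_def)

lemma ok_set_coeff: "ok s \<Longrightarrow> a < C \<Longrightarrow> ok (set_coeff a v s)"
  by (auto simp: ok_def ints_below_def)

lemma ok_step:
  assumes "ok s" "safe a s"
  shows "ok (step p a s)"
  using assms
proof (cases a)
  case (Store a b)
  then show ?thesis using assms by (auto simp: ok_def ints_below_def)
next
  case (Insert i a b)
  then show ?thesis using assms by (auto simp: ok_def ints_below_def)
next
  case (Delete i a)
  then show ?thesis using assms
    by (auto simp: ok_def ints_below_def intro: le_trans[OF card_mono[of "dom (conts s 0)" "dom (conts s 0) - {reg s a}"]])
next
  case (Lookup i a r f)
  then show ?thesis using assms B
    by (auto split: option.splits intro!: ok_set_reg dest: ok_conts)
qed (use B in \<open>auto intro!: ok_set_reg ok_touch_i ok_touch_c ok_set_coeff ok_reg ok_imem\<close>)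

fun icost :: "instr \<Rightarrow> nat" where
  "icost (Insert i _ _) = D"
| "icost (Delete i _) = D"
| "icost (Lookup i _ _ _) = D"
| "icost (LowerBound i _ _ _) = D"
| "icost _ = 1"

lemma cost_le_icost: "ok s \<Longrightarrow> cost a s \<le> icost a"
  by (cases a) (simp_all add: ok_cont_cost)

definition runs :: "prog \<Rightarrow> state \<Rightarrow> nat \<Rightarrow> (state \<Rightarrow> bool) \<Rightarrow> bool" where
  "runs c s T Q \<longleftrightarrow> (\<exists>t s'. exec p B (I + C + K) c s t s' \<and> t \<le> T \<and> ok s' \<and> Q s')"

lemma runs_mono: "runs c s T Q \<Longrightarrow> T \<le> T' \<Longrightarrow> (\<And>s'. ok s' \<Longrightarrow> Q s' \<Longrightarrow> R s') \<Longrightarrow> runs c s T' R"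
  unfolding runs_def by (meson le_trans)

lemma runs_Skip: "ok s \<Longrightarrow> Q s \<Longrightarrow> runs Skip s 0 Q"
  unfolding runs_def using exec.Skip by blast

lemma runs_Instr:
  assumes "ok s" "safe a s" "Q (step p a s)"
  shows "runs (Instr a) s (icost a) Q"
proof -
  have ok': "ok (step p a s)" using assms by (simp add: ok_step)
  then have "exec p B (I + C + K) (Instr a) s (cost a s) (step p a s)"
    by (intro exec.Instr ok_space) (simp add: ok_def)
  then show ?thesis
    using assms ok' cost_le_icost unfolding runs_def by blast
qed

lemma runs_Seq:
  assumes "runs c s T R" "\<And>s'. ok s' \<Longrightarrow> R s' \<Longrightarrow> runs d s' U Q"
  shows "runs (Seq c d) s (T + U) Q"
proof -
  obtain t s' where 1: "exec p B (I + C + K) c s t s'" "t \<le> T" "ok s'" "R s'"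
    using assms(1) unfolding runs_def by blast
  then obtain u s'' where "exec p B (I + C + K) d s' u s''" "u \<le> U" "ok s''" "Q s''"
    using assms(2) unfolding runs_def by blast
  then show ?thesis
    using 1 exec.Seq add_mono unfolding runs_def by blast
qed

lemma runs_Cond:
  assumes "holds b s \<Longrightarrow> runs c s T Q" "\<not> holds b s \<Longrightarrow> runs d s T Q"
  shows "runs (Cond b c d) s (1 + T) Q"
proof (cases "holds b s")
  case True
  then obtain t s' where "exec p B (I + C + K) c s t s'" "t \<le> T" "ok s'" "Q s'"
    using assms(1) unfolding runs_def by blast
  then show ?thesis
    using exec.CondTrue[OF True] add_left_mono[of t T 1] unfolding runs_def by blast
next
  case False
  then obtain t s' where "exec p B (I + C + K) d s t s'" "t \<le> T" "ok s'" "Q s'"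
    using assms(2) unfolding runs_def by blast
  then show ?thesis
    using exec.CondFalse[OF False] add_left_mono[of t T 1] unfolding runs_def by blast
qed

text \<open>Weakest preconditions of loop-free code. They turn such code into one simplification task; composite programs
and loops are treated with the rules for \<open>runs\<close>.\<close>

fun wp :: "prog \<Rightarrow> (state \<Rightarrow> bool) \<Rightarrow> state \<Rightarrow> bool" where
  "wp Skip Q s \<longleftrightarrow> Q s"
| "wp (Instr a) Q s \<longleftrightarrow> safe a s \<and> Q (step p a s)"
| "wp (Seq c d) Q s \<longleftrightarrow> wp c (wp d Q) s"
| "wp (Cond b c d) Q s \<longleftrightarrow> (if holds b s then wp c Q s else wp d Q s)"
| "wp (While b c) Q s \<longleftrightarrow> False"

fun time :: "prog \<Rightarrow> nat" where
  "time Skip = 0"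
| "time (Instr a) = icost a"
| "time (Seq c d) = time c + time d"
| "time (Cond b c d) = 1 + max (time c) (time d)"
| "time (While b c) = 0"

lemma runs_wp: "ok s \<Longrightarrow> wp c Q s \<Longrightarrow> runs c s (time c) Q"
proof (induction c arbitrary: s Q)
  case (Seq c d)
  from Seq.prems have "runs c s (time c) (wp d Q)" by (intro Seq.IH) simp_all
  then show ?case using runs_Seq Seq.IH by simp
next
  case (Cond b c d)
  show ?case unfolding time.simps
  proof (rule runs_Cond)
    show "runs c s (max (time c) (time d)) Q" if "holds b s"
      using Cond.IH(1)[of s Q] Cond.prems that by (auto elim: runs_mono)
    show "runs d s (max (time c) (time d)) Q" if "\<not> holds b s"
      using Cond.IH(2)[of s Q] Cond.prems that by (auto elim: runs_mono)
  qed
qed (simp_all add: runs_Skip runs_Instr)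

lemma runs_straight: "ok s \<Longrightarrow> time c \<le> T \<Longrightarrow> wp c Q s \<Longrightarrow> runs c s T Q"
  using runs_wp runs_mono by blast

lemma runs_While:
  fixes n :: nat and T :: "nat \<Rightarrow> nat"
  assumes "ok s" "Inv k s" "k \<le> n"
    and step: "\<And>k s. k < n \<Longrightarrow> ok s \<Longrightarrow> Inv k s \<Longrightarrow> holds b s \<and> runs c s (T k) (Inv (Suc k))"
    and stop: "\<And>s. ok s \<Longrightarrow> Inv n s \<Longrightarrow> \<not> holds b s"
  shows "runs (While b c) s (1 + (\<Sum>i=k..<n. T i + 1)) (Inv n)"
  using assms(1-3)
proof (induction "n - k" arbitrary: k s)
  case 0
  then have "k = n" by simp
  then show ?case
    using 0 stop exec.WhileFalse unfolding runs_def by fastforce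
next
  case (Suc d)
  then have k: "k < n" by simp
  then obtain t s' where 1: "holds b s" "exec p B (I + C + K) c s t s'" "t \<le> T k" "ok s'" "Inv (Suc k) s'"
    using step[OF k] Suc.prems unfolding runs_def by blast
  have "runs (While b c) s' (1 + (\<Sum>i=Suc k..<n. T i + 1)) (Inv n)"
    using Suc.hyps(2) k by (intro Suc.hyps(1) 1) simp_all
  then obtain u s'' where 2: "exec p B (I + C + K) (While b c) s' u s''"
      "u \<le> 1 + (\<Sum>i=Suc k..<n. T i + 1)" "ok s''" "Inv n s''"
    unfolding runs_def by blast
  have "(\<Sum>i=k..<n. T i + 1) = (T k + 1) + (\<Sum>i=Suc k..<n. T i + 1)"
    using k by (rule sum.atLeast_Suc_lessThan)
  then have "1 + t + u \<le> 1 + (\<Sum>i=k..<n. T i + 1)"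
    using 1(3) 2(2) by simp
  then show ?case
    using exec.WhileTrue[OF 1(1,2) 2(1)] 2 unfolding runs_def by blast
qed

text \<open>The invariant is stated for the value that the loop variable has after its increment, as the body leaves
that variable alone. The time of the body may depend on the iteration, which the loop over all start words
needs: only few of them are processed at length.\<close>

lemma runs_For:
  assumes s: "ok s" "reg s l = n" "i \<noteq> l" "Inv 0 (set_reg i 0 s)"
    and body: "\<And>k s. k < n \<Longrightarrow> ok s \<Longrightarrow> reg s i = k \<Longrightarrow> reg s l = n \<Longrightarrow> Inv k s \<Longrightarrow>
      runs c s (T k) (\<lambda>s'. reg s' i = k \<and> reg s' l = n \<and> reg s' rOne = 1
          \<and> Inv (Suc k) (set_reg i (Suc k) s'))"
    and post: "\<And>s. ok s \<Longrightarrow> reg s l = n \<Longrightarrow> Inv n s \<Longrightarrow> Q s"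
  shows "runs (For i l c) s (2 + (\<Sum>k<n. T k + 2)) Q"
proof -
  define J where "J k s \<longleftrightarrow> reg s i = k \<and> reg s l = n \<and> Inv k s" for k s
  have "runs (While (Less i l) (Seq c (Instr (Arith Add i i rOne)))) s'
      (1 + (\<Sum>k=0..<n. (T k + 1) + 1)) (J n)" if s': "ok s'" "J 0 s'" for s'
  proof (rule runs_While)
    fix k s assume k: "k < n" and s: "ok s" "J k s"
    have "runs (Seq c (Instr (Arith Add i i rOne))) s (T k + 1) (J (Suc k))"
    proof (rule runs_Seq)
      show "runs c s (T k) (\<lambda>s'. reg s' i = k \<and> reg s' l = n \<and> reg s' rOne = 1
          \<and> Inv (Suc k) (set_reg i (Suc k) s'))"
        using k s by (intro body) (auto simp: J_def)
      fix s' assume s': "ok s'" "reg s' i = k \<and> reg s' l = n \<and> reg s' rOne = 1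
          \<and> Inv (Suc k) (set_reg i (Suc k) s')"
      have "Suc k < B"
        using k s' ok_reg[of s' l] by simp
      then have "runs (Instr (Arith Add i i rOne)) s' (time (Instr (Arith Add i i rOne))) (J (Suc k))"
        using s' \<open>i \<noteq> l\<close> by (intro runs_wp) (auto simp: J_def)
      then show "runs (Instr (Arith Add i i rOne)) s' 1 (J (Suc k))" by simp
    qed
    then show "holds (Less i l) s \<and> runs (Seq c (Instr (Arith Add i i rOne))) s (T k + 1) (J (Suc k))"
      using k s by (simp add: J_def)
  qed (use s' in \<open>auto simp: J_def\<close>)
  moreover have "runs (Instr (Const i 0)) s (time (Instr (Const i 0))) (J 0)"
    using s B by (intro runs_wp) (auto simp: J_def)
  ultimately have "runs (For i l c) s (time (Instr (Const i 0)) + (1 + (\<Sum>k=0..<n. (T k + 1) + 1))) (J n)"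
    unfolding For_def by (intro runs_Seq)
  then show ?thesis
    by (rule runs_mono) (auto simp: J_def post atLeast0LessThan intro!: sum_mono)
qed

lemma runs_For_const:
  assumes "ok s" "reg s l = n" "i \<noteq> l" "Inv 0 (set_reg i 0 s)"
    and "\<And>k s. k < n \<Longrightarrow> ok s \<Longrightarrow> reg s i = k \<Longrightarrow> reg s l = n \<Longrightarrow> Inv k s \<Longrightarrow>
      runs c s T (\<lambda>s'. reg s' i = k \<and> reg s' l = n \<and> reg s' rOne = 1
          \<and> Inv (Suc k) (set_reg i (Suc k) s'))"
    and "\<And>s. ok s \<Longrightarrow> reg s l = n \<Longrightarrow> Inv n s \<Longrightarrow> Q s"
  shows "runs (For i l c) s (2 + n * (T + 2)) Q"
proof -
  have "runs (For i l c) s (2 + (\<Sum>k<n. T + 2)) Q"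
  proof (rule runs_For[where Inv = Inv and T = "\<lambda>_. T" and n = n and s = s])
    show "runs c s T (\<lambda>s'. reg s' i = k \<and> reg s' l = n \<and> reg s' rOne = 1
        \<and> Inv (Suc k) (set_reg i (Suc k) s'))"
      if "k < n" "ok s" "reg s i = k" "reg s l = n" "Inv k s" for k s
      using that by (rule assms(5))
    show "Q s" if "ok s" "reg s l = n" "Inv n s" for s
      using that by (rule assms(6))
  qed (fact assms)+
  then show ?thesis by simp
qed

end

section \<open>The program\<close>

text \<open>Registers 0 to 12, which include \<open>rOne\<close> and \<open>rZero\<close>, keep the input and constants and are fixed after the
initialisation.\<close>

abbreviation (input) "rM \<equiv> 0 :: nat"
abbreviation (input) "rTwo \<equiv> 3 :: nat"
abbreviation (input) "rThree \<equiv> 4 :: nat"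
abbreviation (input) "rN \<equiv> 5 :: nat"
abbreviation (input) "rN1 \<equiv> 6 :: nat"
abbreviation (input) "rStr \<equiv> 7 :: nat"
abbreviation (input) "rP \<equiv> 8 :: nat"
abbreviation (input) "rM1 \<equiv> 9 :: nat"
abbreviation (input) "rNine \<equiv> 11 :: nat"
abbreviation (input) "rSix \<equiv> 12 :: nat"

text \<open>The remaining registers are variables: \<open>rW0\<close> is the start word; \<open>rT\<close> counts the vertices; \<open>rJ\<close> is the
column \<open>j\<close>, and \<open>rPj\<close>, \<open>rPl\<close>, \<open>rPr\<close> hold the powers of 3 for the columns \<open>j\<close>, \<open>j - 1\<close> and \<open>right_of m j\<close>; \<open>rB\<close> and
\<open>rBn\<close> tell which of the two tables is the old and which the new one; \<open>rCnt\<close> and \<open>rCnt2\<close> are their lengths.\<close>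

abbreviation (input) "rW0 \<equiv> 13 :: nat"
abbreviation (input) "rT \<equiv> 14 :: nat"
abbreviation (input) "rJ \<equiv> 15 :: nat"
abbreviation (input) "rPj \<equiv> 16 :: nat"
abbreviation (input) "rPl \<equiv> 17 :: nat"
abbreviation (input) "rPr \<equiv> 18 :: nat"
abbreviation (input) "rB \<equiv> 19 :: nat"
abbreviation (input) "rBn \<equiv> 20 :: nat"
abbreviation (input) "rCnt \<equiv> 21 :: nat"
abbreviation (input) "rCnt2 \<equiv> 22 :: nat"
abbreviation (input) "rQ \<equiv> 23 :: nat"
abbreviation (input) "rW \<equiv> 24 :: nat"
abbreviation (input) "rV \<equiv> 25 :: nat"
abbreviation (input) "rX \<equiv> 26 :: nat"
abbreviation (input) "rSrc \<equiv> 27 :: nat"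
abbreviation (input) "rDst \<equiv> 28 :: nat"
abbreviation (input) "rK \<equiv> 29 :: nat"
abbreviation (input) "rA \<equiv> 30 :: nat"
abbreviation (input) "rA2 \<equiv> 31 :: nat"
abbreviation (input) "rF \<equiv> 32 :: nat"
abbreviation (input) "rSlot \<equiv> 33 :: nat"
abbreviation (input) "rDj \<equiv> 34 :: nat"
abbreviation (input) "rI \<equiv> 35 :: nat"

abbreviation (input) "const_instr r k \<equiv> Instr (Const r k)"
abbreviation (input) "move_instr r a \<equiv> Instr (Move r a)"
abbreviation (input) "arith_instr f r a b \<equiv> Instr (Arith f r a b)"

definition add_poly :: prog where
  "add_poly = For rK rN1 (block
     [arith_instr Add rA rSrc rK, arith_instr Add rA2 rDst rK, Instr (CAdd rA2 rA)])"

definition zero_poly :: prog where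
  "zero_poly = For rK rN1 (block [arith_instr Add rA rDst rK, Instr (CZero rA)])"

text \<open>Slot \<open>q\<close> of table \<open>b\<close> has its word at address \<open>2 * q + b\<close> of the integer memory and its polynomial from address
\<open>(2 * q + b + 1) * (m * n + 2)\<close> on in the coefficient memory. Interleaving the two tables
avoids having to know their sizes in advance. The cells before the first slot are left to the result.
Each polynomial has a spare cell at the end, which receives the garbage when a vector is added with a shift by 1.\<close>

definition poly_addr :: "nat \<Rightarrow> nat \<Rightarrow> nat \<Rightarrow> prog" where
  "poly_addr r q b = block [arith_instr Mul r q rTwo, arith_instr Add r r b, arith_instr Add r r rOne,
     arith_instr Mul r r rStr]"

text \<open>The container maps the words of the new table to their slots. The slots of the new
table may still hold polynomials from earlier steps and are cleared when they are taken into use.\<close>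

definition find_slot :: prog where
  "find_slot = Seq (Instr (Lookup 0 rV rSlot rF)) (Cond (Equal rF rOne) Skip
     (Seq (block [Instr (Insert 0 rV rCnt2), arith_instr Mul rA rCnt2 rTwo, arith_instr Add rA rA rBn,
        Instr (Store rA rV), move_instr rSlot rCnt2, poly_addr rDst rSlot rBn])
       (Seq zero_poly (arith_instr Add rCnt2 rCnt2 rOne))))"

text \<open>Adds the polynomial at \<open>rSrc\<close>, times the power of the variable given by \<open>rX\<close>, to the new entry of the word \<open>rV\<close>.\<close>

definition scatter :: prog where
  "scatter = Seq find_slot (Seq (Seq (poly_addr rDst rSlot rBn) (arith_instr Add rDst rDst rX)) add_poly)"

definition omit_word :: prog where
  "omit_word = (let add = arith_instr Add rV rV rPj in
     block [arith_instr Mul rA rDj rPj, arith_instr Sub rV rW rA,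
       Cond (Equal rDj rTwo) add (block
         [arith_instr Div rA rW rPl, arith_instr Mod rA rA rThree,
          Cond (Equal rA rTwo) add (block
            [arith_instr Div rA rW rPr, arith_instr Mod rA rA rThree, Cond (Equal rA rTwo) add Skip])]),
       const_instr rX 0])"

definition dominate_at :: "nat \<Rightarrow> prog" where
  "dominate_at r = block [arith_instr Div rA rV r, arith_instr Mod rA rA rThree,
     Cond (Equal rA rZero) (arith_instr Add rV rV r) Skip]"

definition put_word :: prog where
  "put_word = Seq (block [arith_instr Mul rA rDj rPj, arith_instr Sub rV rW rA, arith_instr Mul rA rTwo rPj,
       arith_instr Add rV rV rA])
     (Seq (dominate_at rPl) (Seq (dominate_at rPr) (const_instr rX 1)))"

definition load_word :: prog where
  "load_word = block [arith_instr Mul rA rQ rTwo, arith_instr Add rA rA rB, Instr (Load rW rA),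
     poly_addr rSrc rQ rB, arith_instr Div rDj rW rPj, arith_instr Mod rDj rDj rThree]"

definition process :: prog where
  "process = Seq load_word
     (Seq (Cond (Equal rDj rZero) Skip (Seq omit_word scatter))
       (Seq put_word scatter))"

text \<open>After the old table has been scattered, the container is emptied by means of the list of words of the new
table, and the tables swap their roles.\<close>

definition vertex_step :: prog where
  "vertex_step =
     Seq (block [arith_instr Add rA rJ rOne, Cond (Equal rA rM) (const_instr rPr 1) (move_instr rPr rPj),
       const_instr rCnt2 0, arith_instr Sub rBn rOne rB])
     (Seq (For rQ rCnt process)
     (Seq (For rQ rCnt2 (block [arith_instr Mul rA rQ rTwo, arith_instr Add rA rA rBn, Instr (Load rV rA),
        Instr (Delete 0 rV)]))
     (block [move_instr rCnt rCnt2, move_instr rB rBn, arith_instr Add rJ rJ rOne,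
       Cond (Equal rJ rM) (block [const_instr rJ 0, const_instr rPj 1, const_instr rPl 1])
         (block [move_instr rPl rPj, arith_instr Mul rPj rPj rThree])])))"

definition sweep :: prog where
  "sweep =
     Seq (block [const_instr rB 0, const_instr rCnt 1, Instr (Store rZero rW0), move_instr rDst rStr])
     (Seq zero_poly
     (Seq (block [Instr (COne rDst), const_instr rJ 0, const_instr rPj 1, const_instr rPl 1])
     (Seq (For rT rN vertex_step)
     (For rQ rCnt
       (Seq (block [arith_instr Mul rA rQ rTwo, arith_instr Add rA rA rB, Instr (Load rV rA)])
         (Cond (Equal rV rW0) (Seq (block [poly_addr rSrc rQ rB, const_instr rDst 0]) add_poly) Skip))))))"

text \<open>Register \<open>rF\<close> becomes 1 if the start word has no clashes. Only \<open>m - 1\<close> pairs are inspected, since the digits from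
position \<open>m\<close> on are zeros that do not belong to the word.\<close>

definition check_word :: prog where
  "check_word = Seq (block [const_instr rF 1, move_instr rV rW0])
     (For rI rM1 (block [arith_instr Mod rA rV rNine,
       Cond (Equal rA rTwo) (const_instr rF 0) (Cond (Equal rA rSix) (const_instr rF 0) Skip),
       arith_instr Div rV rV rThree]))"

definition torus_prog :: prog where
  "torus_prog =
     Seq (block [const_instr rOne 1, const_instr rTwo 2, const_instr rThree 3, const_instr rSix 6, const_instr rNine 9,
       arith_instr Mul rN 0 1, arith_instr Add rN1 rN rOne, arith_instr Add rStr rN1 rOne,
       arith_instr Sub rM1 rM rOne, const_instr rP 1])
     (Seq (For rI rM (arith_instr Mul rP rP rThree))
     (For rW0 rP (Seq check_word (Cond (Equal rF rOne) sweep Skip))))"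

section \<open>Operations on polynomials\<close>

definition keeps :: "nat set \<Rightarrow> state \<Rightarrow> state \<Rightarrow> bool" where
  "keeps R s s' \<longleftrightarrow> (\<forall>r. r \<notin> R \<longrightarrow> reg s' r = reg s r)"

lemma keeps_trans: "keeps R s s' \<Longrightarrow> keeps R' s' s'' \<Longrightarrow> R \<subseteq> U \<Longrightarrow> R' \<subseteq> U \<Longrightarrow> keeps U s s''"
  unfolding keeps_def by (metis subsetD)

locale torus_machine = machine p B I C K D for p B I C K D :: nat +
  fixes m n N :: nat
  assumes m_pos: "0 < m" and n_pos: "0 < n" and N_eq: "N = m * n"
    and card_words_K: "\<And>j. card (words m j) \<le> K"
    and I_K: "2 * K \<le> I" and C_K: "(2 * K + 1) * (N + 2) \<le> C"
    and B_word: "9 * 3 ^ m + 10 \<le> B"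
begin

definition fixed_regs :: "state \<Rightarrow> bool" where
  "fixed_regs s \<longleftrightarrow> reg s rM = m \<and> reg s rOne = 1 \<and> reg s rTwo = 2 \<and> reg s rThree = 3 \<and>
     reg s rSix = 6 \<and> reg s rNine = 9 \<and> reg s rZero = 0 \<and> reg s rN = N \<and> reg s rN1 = N + 1 \<and>
     reg s rStr = N + 2 \<and> reg s rP = 3 ^ m \<and> reg s rM1 = m - 1"

lemma fixed_regs_keeps:
  assumes "fixed_regs s" "keeps R s s'" "R \<inter> {0..12} = {}"
  shows "fixed_regs s'"
proof -
  have "reg s' r = reg s r" if "r \<le> 12" for r
    using assms(2,3) that unfolding keeps_def by (metis IntI atLeastAtMost_iff empty_iff zero_le)
  then show ?thesis using assms(1) unfolding fixed_regs_def by simp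
qed

definition slot_addr :: "nat \<Rightarrow> nat \<Rightarrow> nat" where
  "slot_addr b q = (2 * q + b + 1) * (N + 2)"

lemma slot_addr_div: "k < N + 2 \<Longrightarrow> (slot_addr b q + k) div (N + 2) = 2 * q + b + 1"
  using div_mult_self3[of "N + 2" "2 * q + b + 1" k] unfolding slot_addr_def
      by (simp del: add_2_eq_Suc' mult_Suc_right)

lemma slot_addr_eq:
  assumes "slot_addr b q + k = slot_addr b' q' + k'" "k < N + 2" "k' < N + 2" "b \<le> 1" "b' \<le> 1"
  shows "b = b' \<and> q = q' \<and> k = k'"
proof -
  have "2 * q + b + 1 = 2 * q' + b' + 1"
    using assms slot_addr_div by metis
  then have "b = b' \<and> q = q'" using assms(4,5) by presburger
  then show ?thesis using assms(1) by simp
qed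

lemma slot_addr_ge: "N + 2 \<le> slot_addr b q"
  by (simp add: slot_addr_def)

lemma slot_addr_less:
  assumes "q < K" "b \<le> 1" "k < N + 2"
  shows "slot_addr b q + k < C"
proof -
  have "slot_addr b q + k < (2 * q + b + 2) * (N + 2)"
    using assms(3) by (simp add: slot_addr_def)
  also have "\<dots> \<le> (2 * K + 1) * (N + 2)"
    using assms by (intro mult_le_mono1) linarith
  finally show ?thesis using C_K by linarith
qed

lemma slot_less:
  assumes "q < K" "b \<le> 1"
  shows "2 * q + b < I"
  using assms I_K by linarith

lemma run_add_poly:
  assumes s: "ok s" "fixed_regs s" "reg s rSrc = a" "reg s rDst = d"
    and bd: "a + N < C" "d + N < C" "a + N < d \<or> d + N < a"
  shows "runs add_poly s (5 * N + 7) (\<lambda>s'. keeps {rK, rA, rA2} s s' \<and> imem s' = imem s \<and>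
    conts s' = conts s \<and> (\<forall>k\<le>N. cmem s' (d + k) = (cmem s (d + k) + cmem s (a + k)) mod p) \<and>
    (\<forall>x. x < d \<or> d + N < x \<longrightarrow> cmem s' x = cmem s x))" (is "runs _ _ _ ?Q")
proof -
  define Inv where "Inv k s' \<longleftrightarrow> keeps {rK, rA, rA2} s s' \<and> imem s' = imem s \<and> conts s' = conts s \<and>
    cmem s' = (\<lambda>x. if d \<le> x \<and> x < d + k then (cmem s x + cmem s (a + (x - d))) mod p else cmem s x)"
        for k s'
  have "runs add_poly s (2 + (N + 1) * (3 + 2)) ?Q"
    unfolding add_poly_def
  proof (rule runs_For_const[where Inv = Inv])
    show "Inv 0 (set_reg rK 0 s)" by (auto simp: Inv_def keeps_def)
    show "reg s rN1 = N + 1" using s by (simp add: fixed_regs_def)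
    fix k t assume k: "k < N + 1" and t: "ok t" "reg t rK = k" "reg t rN1 = N + 1" "Inv k t"
    have r: "reg t rSrc = a" "reg t rDst = d" "reg t rOne = 1"
      using t(4) s by (simp_all add: Inv_def keeps_def fixed_regs_def)
    have CB': "a + k < B" "d + k < B" using bd k CB by simp_all
    have bd': "a + k < C" "d + k < C" using bd k by simp_all
    have "cmem t (d + k) = cmem s (d + k)" "cmem t (a + k) = cmem s (a + k)"
      using t(4) bd(3) k by (auto simp: Inv_def)
    let ?c = "block [arith_instr Add rA rSrc rK, arith_instr Add rA2 rDst rK, Instr (CAdd rA2 rA)]"
    show "runs ?c t 3 (\<lambda>s'. reg s' rK = k \<and> reg s' rN1 = N + 1 \<and> reg s' rOne = 1
        \<and> Inv (Suc k) (set_reg rK (Suc k) s'))"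
    proof (rule runs_straight[OF t(1)])
      show "wp ?c (\<lambda>s'. reg s' rK = k \<and> reg s' rN1 = N + 1 \<and> reg s' rOne = 1
          \<and> Inv (Suc k) (set_reg rK (Suc k) s')) t"
        using t r bd' CB' bd(3) k by (auto simp: Inv_def keeps_def fun_eq_iff)
    qed simp   
  next
    fix t assume "ok t" "reg t rN1 = N + 1" "Inv (N + 1) t"
    then show "?Q t" unfolding Inv_def by auto
  qed (use s in simp_all)
  then show ?thesis by (simp add: algebra_simps)
qed

lemma run_zero_poly:
  assumes s: "ok s" "fixed_regs s" "reg s rDst = d" and bd: "d + N < C"
  shows "runs zero_poly s (4 * N + 6) (\<lambda>s'. keeps {rK, rA} s s' \<and> imem s' = imem s \<and>
    conts s' = conts s \<and> (\<forall>k\<le>N. cmem s' (d + k) = 0) \<and>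
    (\<forall>x. x < d \<or> d + N < x \<longrightarrow> cmem s' x = cmem s x))" (is "runs _ _ _ ?Q")
proof -
  define Inv where "Inv k s' \<longleftrightarrow> keeps {rK, rA} s s' \<and> imem s' = imem s \<and> conts s' = conts s \<and>
    cmem s' = (\<lambda>x. if d \<le> x \<and> x < d + k then 0 else cmem s x)" for k s'
  have "runs zero_poly s (2 + (N + 1) * (2 + 2)) ?Q"
    unfolding zero_poly_def
  proof (rule runs_For_const[where Inv = Inv])
    show "Inv 0 (set_reg rK 0 s)" by (auto simp: Inv_def keeps_def)
    show "reg s rN1 = N + 1" using s by (simp add: fixed_regs_def)
    fix k t assume k: "k < N + 1" and t: "ok t" "reg t rK = k" "reg t rN1 = N + 1" "Inv k t"
    have r: "reg t rDst = d" "reg t rOne = 1"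
      using t(4) s by (simp_all add: Inv_def keeps_def fixed_regs_def)
    have bd': "d + k < C" "d + k < B" using bd k CB by simp_all
    let ?c = "block [arith_instr Add rA rDst rK, Instr (CZero rA)]"
    show "runs ?c t 2 (\<lambda>s'. reg s' rK = k \<and> reg s' rN1 = N + 1 \<and> reg s' rOne = 1
        \<and> Inv (Suc k) (set_reg rK (Suc k) s'))"
    proof (rule runs_straight[OF t(1)])
      show "wp ?c (\<lambda>s'. reg s' rK = k \<and> reg s' rN1 = N + 1 \<and> reg s' rOne = 1
          \<and> Inv (Suc k) (set_reg rK (Suc k) s')) t"
        using t r bd' k by (auto simp: Inv_def keeps_def fun_eq_iff)
    qed simp   
  next
    fix t assume "ok t" "reg t rN1 = N + 1" "Inv (N + 1) t"
    then show "?Q t" unfolding Inv_def by auto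
  qed (use s in simp_all)
  then show ?thesis by (simp add: algebra_simps)
qed

section \<open>Operations on tables\<close>

text \<open>Table \<open>b\<close> holds the polynomials \<open>T\<close>. The list \<open>L\<close> of the words in the order of their slots depends on the history of
the run; words outside it implicitly have the polynomial 0.\<close>

definition stored :: "nat \<Rightarrow> nat list \<Rightarrow> (nat \<Rightarrow> nat poly) \<Rightarrow> state \<Rightarrow> bool" where
  "stored b L T s \<longleftrightarrow> distinct L \<and> (\<forall>W. W \<notin> set L \<longrightarrow> T W = 0) \<and>
     (\<forall>q<length L. imem s (2 * q + b) = L ! q) \<and>
     (\<forall>q<length L. \<forall>k\<le>N. cmem s (slot_addr b q + k) = coeff (T (L ! q)) k mod p)"

lemma stored_cong:
  assumes "stored b L T s"
    and "\<And>q. q < length L \<Longrightarrow> imem s' (2 * q + b) = imem s (2 * q + b)"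
    and "\<And>q k. q < length L \<Longrightarrow> k \<le> N \<Longrightarrow> cmem s' (slot_addr b q + k) = cmem s (slot_addr b q + k)"
  shows "stored b L T s'"
  using assms unfolding stored_def by simp

definition indexed :: "nat list \<Rightarrow> state \<Rightarrow> bool" where
  "indexed L s \<longleftrightarrow> (\<forall>W q. conts s 0 W = Some q \<longleftrightarrow> q < length L \<and> L ! q = W)"

lemma indexed_dom: "indexed L s \<Longrightarrow> dom (conts s 0) = set L"
  by (auto simp: indexed_def dom_def in_set_conv_nth)

lemma length_le_K: "distinct L \<Longrightarrow> set L \<subseteq> words m j \<Longrightarrow> length L \<le> K"
  using card_mono[OF finite_words, of "set L" m j] card_words_K[of j] by (simp add: distinct_card)

text \<open>The situation within a vertex step: the old table \<open>b\<close> is complete, the new table \<open>b'\<close> is under construction and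
indexed by the container.\<close>

definition mid_step :: "nat \<Rightarrow> nat \<Rightarrow> nat list \<Rightarrow> (nat \<Rightarrow> nat poly) \<Rightarrow> nat list \<Rightarrow> (nat \<Rightarrow> nat poly) \<Rightarrow> state \<Rightarrow> bool" where
  "mid_step b b' L T L' T' s \<longleftrightarrow> fixed_regs s \<and> b \<le> 1 \<and> b' \<le> 1 \<and> b \<noteq> b' \<and>
     reg s rB = b \<and> reg s rBn = b' \<and> reg s rCnt2 = length L' \<and>
     stored b L T s \<and> stored b' L' T' s \<and> indexed L' s"

lemma stored_set_reg [simp]: "stored b L T (set_reg r v s) \<longleftrightarrow> stored b L T s"
  by (simp add: stored_def)

lemma indexed_set_reg [simp]: "indexed L (set_reg r v s) \<longleftrightarrow> indexed L s"
  by (simp add: indexed_def)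

lemma slot_addr_bounds:
  assumes "q < K" "b \<le> 1"
  shows "q * 2 < B" "q * 2 + b < B" "q * 2 + b < I" "Suc (q * 2 + b) < B"
    "Suc (q * 2 + b) * (N + 2) < B" "Suc (q * 2 + b) * (N + 2) = slot_addr b q" "slot_addr b q + N < C"
    "slot_addr b q < B" "slot_addr b q < C"
proof -
  show i: "q * 2 + b < I" using slot_less[OF assms] by (simp add: mult.commute)
  then show "q * 2 < B" "q * 2 + b < B" using IB by simp_all
  show e: "Suc (q * 2 + b) * (N + 2) = slot_addr b q" by (simp add: slot_addr_def mult.commute)
  show a: "slot_addr b q + N < C" using slot_addr_less[OF assms, of N] by simp
  then show c: "slot_addr b q < B" "slot_addr b q < C" using CB by simp_all
  then show "Suc (q * 2 + b) * (N + 2) < B" using e by simp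
  have "Suc (q * 2 + b) \<le> Suc (q * 2 + b) * (N + 2)"
      using mult_le_mono2[of 1 "N + 2" "Suc (q * 2 + b)"] by simp
  then show "Suc (q * 2 + b) < B" using c(1) e by linarith
qed

lemma run_find_slot:
  assumes s: "ok s" "mid_step b b' L T L' T' s" "reg s rV = V" and V: "V \<in> words m j" "set L' \<subseteq> words m j"
  shows "runs find_slot s (2 * D + 4 * N + 20) (\<lambda>s'. keeps {rK, rA, rDst, rSlot, rF, rCnt2} s s' \<and>
    (\<exists>L''. set L'' = insert V (set L') \<and> mid_step b b' L T L'' T' s' \<and>
       reg s' rSlot < length L'' \<and> L'' ! reg s' rSlot = V) \<and>
    (\<forall>k\<le>N. cmem s' k = cmem s k))" (is "runs _ _ _ ?Q")
proof (cases "V \<in> set L'")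
  case True
  then obtain q where q: "q < length L'" "L' ! q = V" by (auto simp: in_set_conv_nth)
  then have c: "conts s 0 V = Some q" using s(2) by (simp add: mid_step_def indexed_def)
  have "mid_step b b' L T L' T' (set_reg rF 1 (set_reg rSlot q s))"
    using s(2) by (simp add: mid_step_def fixed_regs_def)
  then have Q: "?Q (set_reg rF 1 (set_reg rSlot q s))"
    using q by (auto simp: keeps_def intro!: exI[of _ L'] simp del: One_nat_def)
  have one: "reg s rOne = 1" using s(2) by (simp add: mid_step_def fixed_regs_def)
  have "wp find_slot ?Q s"
    unfolding find_slot_def wp.simps using one c s(3) Q by (simp del: One_nat_def)
  then show ?thesis
    by (intro runs_straight s) (simp_all add: find_slot_def zero_poly_def For_def poly_addr_def)
next
  case False
  let ?l = "length L'"
  have W: "fixed_regs s" "b \<le> 1" "reg s rB = b" "reg s rBn = b'" "reg s rCnt2 = ?l"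
    "stored b L T s" "stored b' L' T' s" "indexed L' s" "b' \<le> 1" "b \<noteq> b'" using s(2)
        by (simp_all add: mid_step_def)
  have dist: "distinct (L' @ [V])" using W(7) False by (simp add: stored_def)
  then have lK: "?l < K" using length_le_K[of "L' @ [V]" j] V by simp
  note b1 = W(9)
  note bds = slot_addr_bounds[OF lK b1]
  have none: "conts s 0 V = None"
    using indexed_dom[OF W(8)] False by (metis domIff)
  have card_le: "card (insert V (dom (conts s 0))) \<le> K"
    using indexed_dom[OF W(8)] lK dist by (simp add: distinct_card)
  let ?blk = "block [Instr (Insert 0 rV rCnt2), arith_instr Mul rA rCnt2 rTwo, arith_instr Add rA rA rBn,
        Instr (Store rA rV), move_instr rSlot rCnt2, poly_addr rDst rSlot rBn]"
  let ?Q2 = "\<lambda>s2. keeps {rF, rA, rSlot, rDst} s s2 \<and> imem s2 = (imem s)(2 * ?l + b' := V) \<and>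
     cmem s2 = cmem s \<and> conts s2 = (conts s)(0 := (conts s 0)(V \<mapsto> ?l)) \<and>
     reg s2 rSlot = ?l \<and> reg s2 rDst = slot_addr b' ?l"
  have r1: "runs (Instr (Lookup 0 rV rSlot rF)) s D (\<lambda>s1. s1 = set_reg rF 0 s)"
    by (rule runs_straight[OF s(1)]) (use none s(3) in simp_all)
  have r2: "runs ?blk s1 (D + 8) ?Q2" if "ok s1" "s1 = set_reg rF 0 s" for s1
    by (rule runs_straight[OF that(1)])
      (use that(2) W s(3) card_le bds in \<open>auto simp: poly_addr_def fixed_regs_def keeps_def mult.commute simp del: mult_Suc mult_Suc_right\<close>)
  have r3: "runs zero_poly s2 (4 * N + 6) (\<lambda>s3. keeps {rF, rA, rSlot, rDst, rK} s s3
      \<and> imem s3 = (imem s)(2 * ?l + b' := V) \<and>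
      conts s3 = (conts s)(0 := (conts s 0)(V \<mapsto> ?l)) \<and> reg s3 rSlot = ?l \<and>
      (\<forall>k\<le>N. cmem s3 (slot_addr b' ?l + k) = 0) \<and>
      (\<forall>x. x < slot_addr b' ?l \<or> slot_addr b' ?l + N < x \<longrightarrow> cmem s3 x = cmem s x))" (is "runs _ _ _ ?Q3")
    if s2: "ok s2" "?Q2 s2" for s2
  proof (rule runs_mono[OF run_zero_poly[OF s2(1), of "slot_addr b' ?l"]])
    show "fixed_regs s2" using W(1) s2(2) by (auto intro: fixed_regs_keeps)
    show "reg s2 rDst = slot_addr b' ?l" using s2(2) by simp
    show "slot_addr b' ?l + N < C" by (rule bds)
    fix s3 assume "ok s3" and s3: "keeps {rK, rA} s2 s3 \<and> imem s3 = imem s2 \<and> conts s3 = conts s2 \<and>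
      (\<forall>k\<le>N. cmem s3 (slot_addr b' ?l + k) = 0) \<and>
      (\<forall>x. x < slot_addr b' ?l \<or> slot_addr b' ?l + N < x \<longrightarrow> cmem s3 x = cmem s2 x)"
    have "keeps {rF, rA, rSlot, rDst, rK} s s3"
      using s2(2) s3 by (auto intro: keeps_trans)
    moreover have "reg s3 rSlot = ?l" using s2(2) s3 by (auto simp: keeps_def)
    ultimately show "?Q3 s3" using s2(2) s3 by simp
  qed simp
  have r4: "runs (arith_instr Add rCnt2 rCnt2 rOne) s3 1 ?Q" if s3: "ok s3" "?Q3 s3" for s3
  proof (rule runs_straight[OF s3(1)])
    let ?s = "set_reg rCnt2 (Suc ?l) s3"
    have r: "reg s3 rCnt2 = ?l" "reg s3 rOne = 1"
      using s3(2) W by (simp_all add: keeps_def fixed_regs_def)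
    have k: "keeps {rK, rA, rDst, rSlot, rF, rCnt2} s ?s"
      using s3(2) by (auto simp: keeps_def)
    have fr: "fixed_regs ?s" using W(1) k by (rule fixed_regs_keeps) auto
    note bb = W(10)
    have imem: "imem s3 (2 * q + c) = imem s (2 * q + c)" if "c \<noteq> b' \<or> q \<noteq> ?l" "c \<le> 1" for q c
    proof -
      have "2 * q + c \<noteq> 2 * ?l + b'" using that b1 by presburger
      then show ?thesis using s3(2) by simp
    qed
    have cmem: "cmem s3 (slot_addr c q + k) = cmem s (slot_addr c q + k)"
        if "c \<noteq> b' \<or> q \<noteq> ?l" "c \<le> 1" "k \<le> N" for q c k
    proof -
      have "\<not> (slot_addr b' ?l \<le> slot_addr c q + k \<and> slot_addr c q + k \<le> slot_addr b' ?l + N)"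
      proof
        assume *: "slot_addr b' ?l \<le> slot_addr c q + k \<and> slot_addr c q + k \<le> slot_addr b' ?l + N"
        then obtain k' where "slot_addr c q + k = slot_addr b' ?l + k'" "k' \<le> N"
          by (metis add_le_cancel_left le_iff_add)
        then show False using slot_addr_eq[of c q k b' ?l k'] that b1 by auto
      qed
      then show ?thesis using s3(2) by (metis not_le)
    qed
    have t1: "stored b L T ?s"
      using W(6) by (rule stored_cong) (use imem cmem bb W(2) in auto)
    have t2: "stored b' L' T' ?s"
      using W(7) by (rule stored_cong) (use imem cmem b1 in auto)
    have T'V: "T' V = 0" using W(7) False by (simp add: stored_def)
    have "imem s3 (2 * ?l + b') = V" "\<forall>k\<le>N. cmem s3 (slot_addr b' ?l + k) = 0"
      using s3(2) by auto
    then have t3: "stored b' (L' @ [V]) T' ?s"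
      using t2 dist T'V unfolding stored_def by (simp add: nth_append less_Suc_eq)
    have ix: "indexed (L' @ [V]) ?s"
      using s3(2) W(8) dist unfolding indexed_def
      by (auto simp: nth_append less_Suc_eq in_set_conv_nth)
    have "mid_step b b' L T (L' @ [V]) T' ?s"
      using fr W(2) t1 t3 ix k W by (simp add: mid_step_def keeps_def)
    moreover have "reg ?s rSlot = ?l" using s3(2) by simp
    moreover have "\<forall>k\<le>N. cmem ?s k = cmem s k"
      using s3(2) slot_addr_ge[of b' ?l] by auto
    ultimately have "?Q ?s" using k by (auto intro!: exI[of _ "L' @ [V]"])
    then show "wp (arith_instr Add rCnt2 rCnt2 rOne) ?Q s3"
      using r lK bds by simp
  qed simp
  have r34: "runs (Seq zero_poly (arith_instr Add rCnt2 rCnt2 rOne)) s2 (4 * N + 6 + 1) ?Q"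
    if "ok s2" "?Q2 s2" for s2
    using r3[OF that] r4 by (rule runs_Seq)
  have r24: "runs (Seq ?blk (Seq zero_poly (arith_instr Add rCnt2 rCnt2 rOne))) s1 ((D + 8) + (4 * N + 6 + 1)) ?Q"
    if "ok s1" "s1 = set_reg rF 0 s" for s1
    using r2[OF that] r34 by (rule runs_Seq)
  have "runs (Cond (Equal rF rOne) Skip (Seq ?blk (Seq zero_poly (arith_instr Add rCnt2 rCnt2 rOne)))) s1
      (1 + ((D + 8) + (4 * N + 6 + 1))) ?Q" if s1: "ok s1" "s1 = set_reg rF 0 s" for s1
  proof (rule runs_Cond)
    assume "holds (Equal rF rOne) s1"
    then show "runs Skip s1 ((D + 8) + (4 * N + 6 + 1)) ?Q"
      using s1(2) W(1) by (simp add: fixed_regs_def)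
  qed (rule r24[OF s1])
  with r1 have "runs find_slot s (D + (1 + ((D + 8) + (4 * N + 6 + 1)))) ?Q"
    unfolding find_slot_def by (rule runs_Seq)
  then show ?thesis by (rule runs_mono) simp_all
qed

definition same_mem :: "state \<Rightarrow> state \<Rightarrow> bool" where
  "same_mem s s' \<longleftrightarrow> imem s' = imem s \<and> cmem s' = cmem s \<and> conts s' = conts s"

definition same_result :: "state \<Rightarrow> state \<Rightarrow> bool" where
  "same_result s s' \<longleftrightarrow> (\<forall>k\<le>N. cmem s' k = cmem s k)"

lemma same_result_trans: "same_result s s' \<Longrightarrow> same_result s' s'' \<Longrightarrow> same_result s s''"
  by (simp add: same_result_def)

lemma same_mem_result: "same_mem s s' \<Longrightarrow> same_result s s'"
  by (simp add: same_result_def same_mem_def)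

lemma mid_step_keeps:
  assumes "mid_step b b' L T L' T' s" "keeps R s s'" "same_mem s s'"
    and "R \<inter> {0..12} = {}" "rB \<notin> R" "rBn \<notin> R" "rCnt2 \<notin> R"
  shows "mid_step b b' L T L' T' s'"
proof -
  have "fixed_regs s'" using assms(1) fixed_regs_keeps[OF _ assms(2,4)] by (simp add: mid_step_def)
  then show ?thesis
    using assms by (simp add: mid_step_def keeps_def same_mem_def stored_def indexed_def)
qed

lemma slot_addr_disjoint:
  assumes "b \<noteq> b' \<or> q \<noteq> q'" "b \<le> 1" "b' \<le> 1"
  shows "slot_addr b q + (N + 2) \<le> slot_addr b' q' \<or> slot_addr b' q' + (N + 2) \<le> slot_addr b q"
proof -
  have le: "u * (N + 2) + (N + 2) \<le> v * (N + 2)" if "u < v" for u v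
    using that mult_le_mono1[of "Suc u" v "N + 2"] by simp
  have "2 * q + b + 1 < 2 * q' + b' + 1 \<or> 2 * q' + b' + 1 < 2 * q + b + 1"
    using assms by presburger
  then show ?thesis unfolding slot_addr_def using le by blast
qed

text \<open>Coefficient \<open>k\<close> of the new entry receives coefficient \<open>k - x\<close> of the old one. The addition starts \<open>x\<close> cells after
the beginning of the slot and therefore ends \<open>x\<close> cells beyond coefficient \<open>m * n\<close>, in the spare cell.\<close>

lemma run_scatter:
  assumes s: "ok s" "mid_step b b' L T L' T' s" "reg s rV = V" "reg s rX = x" "reg s rSrc = slot_addr b q"
    and V: "V \<in> words m j" "set L' \<subseteq> words m j" and x: "x \<le> 1" and q: "q < length L" "q < K"
  shows "runs scatter s (2 * D + 9 * N + 33) (\<lambda>s'. keeps {rK, rA, rA2, rDst, rSlot, rF, rCnt2} s s' \<and>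
    (\<exists>L''. set L'' = insert V (set L') \<and>
       mid_step b b' L T L'' (T'(V := T' V + monom 1 x * T (L ! q))) s') \<and> same_result s s')"
    (is "runs _ _ _ ?Q")
proof -
  let ?Q1 = "\<lambda>s1. keeps {rK, rA, rDst, rSlot, rF, rCnt2} s s1 \<and>
    (\<exists>L''. set L'' = insert V (set L') \<and> mid_step b b' L T L'' T' s1 \<and>
       reg s1 rSlot < length L'' \<and> L'' ! reg s1 rSlot = V) \<and>
    (\<forall>k\<le>N. cmem s1 k = cmem s k)"
  have r1: "runs find_slot s (2 * D + 4 * N + 20) ?Q1"
    using s(1-3) V by (rule run_find_slot)
  have r2: "runs (Seq (Seq (poly_addr rDst rSlot rBn) (arith_instr Add rDst rDst rX)) add_poly) s1
      (5 + (5 * N + 7)) ?Q" if s1: "ok s1" "?Q1 s1" for s1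
  proof -
    obtain L1 z where L1: "set L1 = insert V (set L')" "mid_step b b' L T L1 T' s1"
       "reg s1 rSlot = z" "z < length L1" "L1 ! z = V" using s1(2) by blast
    have W: "fixed_regs s1" "b \<le> 1" "b' \<le> 1" "b \<noteq> b'" "reg s1 rB = b" "reg s1 rBn = b'"
      "reg s1 rCnt2 = length L1" "stored b L T s1" "stored b' L1 T' s1" "indexed L1 s1"
      using L1(2) by (simp_all add: mid_step_def)
    have k1: "reg s1 rX = x" "reg s1 rSrc = slot_addr b q" using s1(2) s by (simp_all add: keeps_def)
    have "length L1 \<le> K"
      using W(9) L1(1) V by (intro length_le_K[of _ j]) (simp_all add: stored_def)
    then have zK: "z < K" using L1(4) by simp
    note bds = slot_addr_bounds[OF zK W(3)]
    let ?d = "slot_addr b' z + x"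
    have d: "?d + N < C" "?d < B" using slot_addr_less[OF zK W(3), of "x + N"] x CB
        by (simp_all add: add.assoc)
    have disj: "slot_addr b q + (N + 2) \<le> slot_addr b' z \<or> slot_addr b' z + (N + 2) \<le> slot_addr b q"
      using W by (intro slot_addr_disjoint) simp_all
    let ?Q2 = "\<lambda>s2. keeps {rDst} s1 s2 \<and> same_mem s1 s2 \<and> reg s2 rDst = ?d"
    have r3: "runs (Seq (poly_addr rDst rSlot rBn) (arith_instr Add rDst rDst rX)) s1 5 ?Q2"
      by (rule runs_straight[OF s1(1)])
        (use W L1(3) k1 bds d in \<open>auto simp: poly_addr_def fixed_regs_def keeps_def same_mem_def simp del: mult_Suc mult_Suc_right\<close>)
    have r4: "runs add_poly s2 (5 * N + 7) ?Q" if s2: "ok s2" "?Q2 s2" for s2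
    proof (rule runs_mono[OF run_add_poly[OF s2(1), of "slot_addr b q" ?d]])
      show "fixed_regs s2" using W(1) s2(2) by (auto intro: fixed_regs_keeps)
      show "reg s2 rSrc = slot_addr b q" "reg s2 rDst = ?d" using s2(2) k1 by (simp_all add: keeps_def)
      show "slot_addr b q + N < C" using slot_addr_less[OF q(2) W(2), of N] by simp
      show "?d + N < C" by (rule d)
      show "slot_addr b q + N < ?d \<or> ?d + N < slot_addr b q" using disj x by auto
      fix s3 assume "ok s3" and s3: "keeps {rK, rA, rA2} s2 s3 \<and> imem s3 = imem s2
          \<and> conts s3 = conts s2 \<and>
        (\<forall>k\<le>N. cmem s3 (?d + k) = (cmem s2 (?d + k) + cmem s2 (slot_addr b q + k)) mod p) \<and>
        (\<forall>y. y < ?d \<or> ?d + N < y \<longrightarrow> cmem s3 y = cmem s2 y)"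
      have k13: "keeps {rK, rA, rA2, rDst} s1 s3" 
        using s2(2) s3 by (auto intro: keeps_trans)
      have k: "keeps {rK, rA, rA2, rDst, rSlot, rF, rCnt2} s s3"
        using s1(2) k13 by (auto intro: keeps_trans)
      have add: "cmem s3 (?d + k) = (cmem s1 (?d + k) + cmem s1 (slot_addr b q + k)) mod p" if "k \<le> N"
          for k
        using s2(2) s3 that by (simp add: same_mem_def)
      have far: "cmem s3 y = cmem s1 y" if "y < ?d \<or> ?d + N < y" for y
        using s2(2) s3 that by (auto simp: same_mem_def)
      have out: "cmem s3 (slot_addr c y + k) = cmem s1 (slot_addr c y + k)"
          if "c \<noteq> b' \<or> y \<noteq> z" "c \<le> 1" "k \<le> N" for c y k
        using slot_addr_disjoint[OF that(1,2) W(3)] that(3) x by (intro far) auto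
      have mem: "imem s3 = imem s1" "conts s3 = conts s1" using s2(2) s3 by (simp_all add: same_mem_def)
      let ?P = "monom 1 x * T (L ! q)"
      have t1: "stored b L T s3"
        using W(8) by (rule stored_cong) (use mem out W in auto)
      have "cmem s3 (slot_addr b' z + k) = coeff (T' V + ?P) k mod p" if k: "k \<le> N" for k
      proof (cases "k < x")
        case True
        then have "cmem s3 (slot_addr b' z + k) = cmem s1 (slot_addr b' z + k)" by (intro far) simp
        also have "\<dots> = coeff (T' V) k mod p" using W(9) L1 k by (simp add: stored_def)
        also have "\<dots> = coeff (T' V + ?P) k mod p" using True by (simp add: coeff_monom_mult)
        finally show ?thesis .
      next
        case False
        then have kx: "k = x + (k - x)" by simp
        have "cmem s3 (slot_addr b' z + k) = cmem s3 (?d + (k - x))" using False by simp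
        also have "\<dots> = (cmem s1 (slot_addr b' z + k) + cmem s1 (slot_addr b q + (k - x))) mod p"
          using add[of "k - x"] k False by simp
        also have "\<dots> = (coeff (T' V) k mod p + coeff (T (L ! q)) (k - x) mod p) mod p"
          using W(8,9) L1 k q by (simp add: stored_def)
        also have "\<dots> = coeff (T' V + ?P) k mod p"
          using False by (simp add: coeff_monom_mult mod_add_eq)
        finally show ?thesis .
      qed
      note cell = this
      have dist: "distinct L1" using W(9) by (simp add: stored_def)
      have t2: "stored b' L1 (T'(V := T' V + ?P)) s3"
        unfolding stored_def
      proof (intro conjI allI impI)
        show "distinct L1" by (rule dist)
        show "(T'(V := T' V + ?P)) U = 0" if "U \<notin> set L1" for U
          using that W(9) L1(1) by (auto simp: stored_def)
        show "imem s3 (2 * y + b') = L1 ! y" if "y < length L1" for y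
          using that W(9) mem by (simp add: stored_def)
        show "cmem s3 (slot_addr b' y + k) = coeff ((T'(V := T' V + ?P)) (L1 ! y)) k mod p"
          if y: "y < length L1" "k \<le> N" for y k
        proof (cases "y = z")
          case True
          then show ?thesis using cell[OF y(2)] L1(5) by simp
        next
          case False
          then have "L1 ! y \<noteq> V" using dist y L1(4,5) nth_eq_iff_index_eq by blast
          then show ?thesis using out[of b' y k] False W y by (simp add: stored_def)
        qed
      qed
      have "mid_step b b' L T L1 (T'(V := T' V + ?P)) s3"
        unfolding mid_step_def
      proof (intro conjI)
        show "fixed_regs s3" using W(1) k13 by (rule fixed_regs_keeps) auto
        show "indexed L1 s3" using W(10) mem by (simp add: indexed_def)
        show "reg s3 rB = b" "reg s3 rBn = b'" "reg s3 rCnt2 = length L1"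
          using W k13 by (simp_all add: keeps_def)
      qed (use W t1 t2 in simp_all)
      moreover have "same_result s s3"
        using s1(2) far slot_addr_ge[of b' z] by (simp add: same_result_def)
      ultimately show "?Q s3" using k L1(1) by auto
    qed simp
    show ?thesis using r3 r4 by (rule runs_Seq)
  qed
  have "runs scatter s ((2 * D + 4 * N + 20) + (5 + (5 * N + 7))) ?Q"
    unfolding scatter_def using r1 r2 by (rule runs_Seq)
  then show ?thesis by (rule runs_mono) simp_all
qed

lemma word_bounds:
  assumes "W < 3 ^ m" "i < m" "v < 3"
  shows "W < B" "W div 3 ^ i < B" "set_dig W i v < B" "W + 3 ^ i < B" "W + 2 * 3 ^ i < B" "2 * 3 ^ i < B"
    "W - v < B" "dig W i * 3 ^ i < B" "dig W i < B"
proof -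
  have p: "(3::nat) ^ i < 3 ^ m" using assms by simp
  show W: "W < B" "W + 3 ^ i < B" "W + 2 * 3 ^ i < B" "2 * 3 ^ i < B"
    using assms(1) B_word p by linarith+
  then show "W div 3 ^ i < B" "W - v < B" 
    by (meson div_le_dividend diff_le_self le_less_trans)+
  show "set_dig W i v < B" using set_dig_less[OF assms] B_word by linarith
  have "dig W i * 3 ^ i \<le> W" 
    using dig_def by (metis div_times_less_eq_dividend le_trans mod_less_eq_dividend mult_le_mono1)
  then show "dig W i * 3 ^ i < B" using W by simp
  show "dig W i < B" using dig_less[of W i] B_word by linarith
qed

lemma run_dominate_at:
  assumes s: "ok s" "fixed_regs s" "reg s rV = U" "reg s r = 3 ^ i" and U: "U < 3 ^ m" "i < m"
    and r: "r \<noteq> rV" "r \<noteq> rA"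
  shows "runs (dominate_at r) s 4 (\<lambda>s'. keeps {rA, rV} s s' \<and> same_mem s s' \<and> reg s' rV = dominate i U)"
proof (rule runs_straight[OF s(1)])
  note bds = word_bounds[OF U, of 0, simplified]
  have [simp]: "U div 3 ^ i mod 3 = dig U i" by (simp add: dig_def)
  show "wp (dominate_at r) (\<lambda>s'. keeps {rA, rV} s s' \<and> same_mem s s' \<and> reg s' rV = dominate i U) s"
    using s r bds
    by (auto simp: dominate_at_def fixed_regs_def keeps_def same_mem_def dominate_def set_dig_def)
qed (simp add: dominate_at_def)

lemma run_put_word:
  assumes s: "ok s" "fixed_regs s" "reg s rW = W" "reg s rDj = dig W j" "reg s rPj = 3 ^ j"
    "reg s rPl = 3 ^ (j - 1)" "reg s rPr = 3 ^ right_of m j" and W: "W < 3 ^ m" "j < m"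
  shows "runs put_word s 13 (\<lambda>s'. keeps {rA, rV, rX} s s' \<and> same_mem s s' \<and>
    reg s' rV = put m j W \<and> reg s' rX = 1)" (is "runs _ _ _ ?Q")
proof -
  note bds = word_bounds[OF W, of 2, simplified]
  have sd: "W - dig W j * 3 ^ j + 2 * 3 ^ j = set_dig W j 2" by (simp add: set_dig_def)
  let ?b1 = "block [arith_instr Mul rA rDj rPj, arith_instr Sub rV rW rA, arith_instr Mul rA rTwo rPj, arith_instr Add rV rV rA]"
  let ?Q1 = "\<lambda>s'. keeps {rA, rV} s s' \<and> same_mem s s' \<and> reg s' rV = set_dig W j 2"
  let ?Q2 = "\<lambda>s'. keeps {rA, rV} s s' \<and> same_mem s s' \<and> reg s' rV = dominate (j - 1) (set_dig W j 2)"
  let ?Q3 = "\<lambda>s'. keeps {rA, rV} s s' \<and> same_mem s s' \<and> reg s' rV = put m j W"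
  have Wd: "W - dig W j * 3 ^ j < B" using bds(1) by simp
  have r1: "runs ?b1 s 4 ?Q1"
    by (rule runs_straight[OF s(1)])
      (use s bds Wd sd in \<open>simp_all add: fixed_regs_def keeps_def same_mem_def\<close>)
  have l1: "set_dig W j 2 < 3 ^ m" using W by (simp add: set_dig_less)
  then have l2: "dominate (j - 1) (set_dig W j 2) < 3 ^ m"
    using W by (simp add: dominate_def set_dig_less)
  have q1: "runs (dominate_at rPl) s1 4 ?Q2" if s1: "ok s1" "?Q1 s1" for s1
  proof (rule runs_mono[OF run_dominate_at[OF s1(1)]])
    show "fixed_regs s1" using s(2) s1(2) by (auto intro: fixed_regs_keeps)
    show "reg s1 rV = set_dig W j 2" "reg s1 rPl = 3 ^ (j - 1)" using s s1(2)
        by (simp_all add: keeps_def)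
    fix s' assume "keeps {rA, rV} s1 s' \<and> same_mem s1 s' \<and> reg s' rV = dominate (j - 1) (set_dig W j 2)"
    then show "?Q2 s'" using s1(2) by (auto simp: same_mem_def keeps_def)
  qed (use l1 W in simp_all)
  have q2: "runs (dominate_at rPr) s1 4 ?Q3" if s1: "ok s1" "?Q2 s1" for s1
  proof (rule runs_mono[OF run_dominate_at[OF s1(1)]])
    show "fixed_regs s1" using s(2) s1(2) by (auto intro: fixed_regs_keeps)
    show "reg s1 rV = dominate (j - 1) (set_dig W j 2)" "reg s1 rPr = 3 ^ right_of m j"
      using s s1(2) by (simp_all add: keeps_def)
    fix s' assume "keeps {rA, rV} s1 s' \<and> same_mem s1 s'
        \<and> reg s' rV = dominate (right_of m j) (dominate (j - 1) (set_dig W j 2))"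
    then show "?Q3 s'" using s1(2) by (auto simp: same_mem_def keeps_def put_def)
  qed (use l2 W in \<open>simp_all add: right_of_less\<close>)
  have q3: "runs (const_instr rX 1) s1 1 ?Q" if s1: "ok s1" "?Q3 s1" for s1
    by (rule runs_straight[OF s1(1)]) (use s1(2) B in \<open>auto simp: keeps_def same_mem_def\<close>)
  have q23: "runs (Seq (dominate_at rPr) (const_instr rX 1)) s1 (4 + 1) ?Q" if s1: "ok s1" "?Q2 s1"
      for s1
    using q2[OF s1] q3 by (rule runs_Seq)
  have q13: "runs (Seq (dominate_at rPl) (Seq (dominate_at rPr) (const_instr rX 1))) s1 (4 + (4 + 1)) ?Q"
    if s1: "ok s1" "?Q1 s1" for s1
    using q1[OF s1] q23 by (rule runs_Seq)
  have "runs put_word s (4 + (4 + (4 + 1))) ?Q"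
    unfolding put_word_def using r1 q13 by (rule runs_Seq)
  then show ?thesis by (rule runs_mono) simp_all
qed

section \<open>One vertex step\<close>

definition at_col :: "nat \<Rightarrow> state \<Rightarrow> bool" where
  "at_col j s \<longleftrightarrow> j < m \<and> reg s rPj = 3 ^ j \<and> reg s rPl = 3 ^ (j - 1) \<and> reg s rPr = 3 ^ right_of m j"

lemma run_omit_word:
  assumes s: "ok s" "fixed_regs s" "reg s rW = W" "reg s rDj = dig W j" "at_col j s"
    and W: "W < 3 ^ m" "dig W j \<noteq> 0"
  shows "runs omit_word s 12 (\<lambda>s'. keeps {rA, rV, rX} s s' \<and> same_mem s s' \<and>
    (\<exists>V. omit m j W = Some V \<and> reg s' rV = V) \<and> reg s' rX = 0)" (is "runs _ _ _ ?Q")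
proof (rule runs_straight[OF s(1)])
  have j: "j < m" using s(5) by (simp add: at_col_def)
  note bds = word_bounds[OF W(1) j, of 1, simplified]
  have wd: "W div 3 ^ i < B" for i using bds(1) by (meson div_le_dividend le_less_trans)
  have Wd: "W - dig W j * 3 ^ j < B" "W - dig W j * 3 ^ j + 3 ^ j < B" using bds(1,4) by linarith+
  have [simp]: "W div 3 ^ i mod 3 = dig W i" for i by (simp add: dig_def)
  have dB: "dig W i < B" for i using dig_less[of W i] B_word by linarith
  show "wp omit_word ?Q s"
    using s W(2) bds wd Wd dB B
    by (auto simp: omit_word_def Let_def fixed_regs_def keeps_def same_mem_def at_col_def omit_def set_dig_def)
qed (simp add: omit_word_def Let_def)

lemma run_load_word:
  assumes s: "ok s" "fixed_regs s" "stored b L T s" "reg s rB = b" "b \<le> 1" "reg s rQ = q" "reg s rPj = 3 ^ j"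
    and q: "q < length L" "q < K" and W: "L ! q < 3 ^ m"
  shows "runs load_word s 9 (\<lambda>s'. keeps {rA, rW, rSrc, rDj} s s' \<and> same_mem s s' \<and>
    reg s' rW = L ! q \<and> reg s' rSrc = slot_addr b q \<and> reg s' rDj = dig (L ! q) j)" (is "runs _ _ _ ?Q")
proof (rule runs_straight[OF s(1)])
  note bds = slot_addr_bounds[OF q(2) s(5)]
  have im: "imem s (q * 2 + b) = L ! q" using s(3) q(1) by (simp add: stored_def mult.commute)
  have WB: "L ! q < B" using W B_word by linarith
  have wd: "L ! q div 3 ^ j < B" using WB by (meson div_le_dividend le_less_trans)
  have [simp]: "L ! q div 3 ^ j mod 3 = dig (L ! q) j" by (simp add: dig_def)
  have dB: "dig (L ! q) j < B" using dig_less[of "L ! q" j] B_word by linarith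
  show "wp load_word ?Q s"
    using s bds im WB wd dB
    by (auto simp: load_word_def poly_addr_def fixed_regs_def keeps_def same_mem_def simp del: mult_Suc mult_Suc_right)
qed (simp add: load_word_def poly_addr_def)

text \<open>Both successors of a word belong to \<open>words m (Suc j)\<close>, so this set bounds the number of slots while the new
table is filled.\<close>

lemma run_process:
  assumes s: "ok s" "mid_step b b' L T L' T' s" "at_col j s" "reg s rQ = q"
    and q: "q < length L" and L: "set L \<subseteq> words m j" and L': "set L' \<subseteq> words m (Suc j)"
  shows "runs process s (4 * D + 18 * N + 110) (\<lambda>s'.
    keeps {rA, rA2, rW, rV, rX, rSrc, rDst, rK, rF, rSlot, rDj, rCnt2} s s' \<and>
    (\<exists>L''. set L'' \<subseteq> words m (Suc j) \<and> mid_step b b' L T L'' (\<lambda>U. T' U + contrib m j T (L ! q) U) s') \<and>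
    same_result s s')" (is "runs _ _ _ ?Q")
proof -
  define W where "W = L ! q"
  have Wm: "W \<in> words m j" using L q by (auto simp: W_def)
  then have Wl: "W < 3 ^ m" by (simp add: words_def)
  have j: "j < m" using s(3) by (simp add: at_col_def)
  have WW: "fixed_regs s" "stored b L T s" "reg s rB = b" "b \<le> 1" using s(2)
      by (simp_all add: mid_step_def)
  have qK: "q < K"
    using q length_le_K[of L j] L WW(2) by (simp add: stored_def)
  let ?Q1 = "\<lambda>s'. keeps {rA, rW, rSrc, rDj} s s' \<and> same_mem s s' \<and>
    reg s' rW = W \<and> reg s' rSrc = slot_addr b q \<and> reg s' rDj = dig W j"
  have r1: "runs load_word s 9 ?Q1"
    unfolding W_def using s(1) WW s(4) _ q qK Wl[unfolded W_def]
    by (rule run_load_word) (use s(3) in \<open>simp add: at_col_def\<close>)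
  let ?R = "{rA, rA2, rV, rX, rDst, rK, rF, rSlot, rCnt2}"
  let ?T1 = "\<lambda>U. T' U + (if omit m j W = Some U then T W else 0)"
  let ?Q2 = "\<lambda>s1 s2. keeps ?R s1 s2 \<and> (\<exists>L''. set L'' \<subseteq> words m (Suc j) \<and> mid_step b b' L T L'' ?T1 s2)
      \<and> same_result s1 s2"
  have r2: "runs (Cond (Equal rDj rZero) Skip (Seq omit_word scatter)) s1
      (1 + (12 + (2 * D + 9 * N + 33))) (?Q2 s1)" if s1: "ok s1" "?Q1 s1" for s1
  proof -
    have work1: "mid_step b b' L T L' T' s1"
      using s(2) s1(2) by (auto intro: mid_step_keeps)
    then have fr1: "fixed_regs s1" by (simp add: mid_step_def)
    have col1: "at_col j s1" using s(3) s1(2) by (simp add: at_col_def keeps_def)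
    show ?thesis
    proof (rule runs_Cond)
      assume "holds (Equal rDj rZero) s1"
      then have "omit m j W = None" using s1(2) fr1 by (simp add: fixed_regs_def omit_def)
      then have "?Q2 s1 s1" using work1 L' by (auto simp: keeps_def same_result_def)
      then show "runs Skip s1 (12 + (2 * D + 9 * N + 33)) (?Q2 s1)"
        using s1(1) by (intro runs_straight) simp_all
    next
      assume "\<not> holds (Equal rDj rZero) s1"
      then have nz: "dig W j \<noteq> 0" using s1(2) fr1 by (simp add: fixed_regs_def)
      let ?O = "\<lambda>s'. keeps {rA, rV, rX} s1 s' \<and> same_mem s1 s' \<and>
        (\<exists>V. omit m j W = Some V \<and> reg s' rV = V) \<and> reg s' rX = 0"
      have o: "runs omit_word s1 12 ?O"
        using s1 fr1 col1 Wl nz by (intro run_omit_word) simp_all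
      have "runs scatter s2 (2 * D + 9 * N + 33) (?Q2 s1)" if s2: "ok s2" "?O s2" for s2
      proof -
        obtain V where V: "omit m j W = Some V" "reg s2 rV = V" using s2(2) by blast
        have work2: "mid_step b b' L T L' T' s2"
          using work1 s2(2) by (auto intro: mid_step_keeps)
        have Vm: "V \<in> words m (Suc j)" using omit_words[OF V(1) Wm j] .
        have x: "reg s2 rX = 0" "reg s2 rSrc = slot_addr b q"
          using s1(2) s2(2) by (simp_all add: keeps_def)
        show ?thesis
        proof (rule runs_mono[OF run_scatter[OF s2(1) work2 V(2) x Vm L' _ q qK]])
          fix s3 assume s3: "keeps {rK, rA, rA2, rDst, rSlot, rF, rCnt2} s2 s3 \<and>
            (\<exists>L''. set L'' = insert V (set L') \<and>
               mid_step b b' L T L'' (T'(V := T' V + monom 1 0 * T (L ! q))) s3) \<and> same_result s2 s3"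
          have eq: "T'(V := T' V + monom 1 0 * T (L ! q)) = ?T1"
            using V(1) by (auto simp: fun_eq_iff W_def monom_eq_1 simp del: One_nat_def)
          obtain L'' where L'': "set L'' = insert V (set L')" "mid_step b b' L T L'' ?T1 s3"
            using s3 unfolding eq by blast
          then have "set L'' \<subseteq> words m (Suc j)" using Vm L' by simp
          moreover have "keeps ?R s1 s3"
            using s2(2) s3 by (auto intro: keeps_trans)
          moreover have "same_result s1 s3" using s2(2) s3 same_mem_result same_result_trans by blast
          ultimately show "?Q2 s1 s3" using L''(2) by blast
        qed simp_all
      qed
      with o show "runs (Seq omit_word scatter) s1 (12 + (2 * D + 9 * N + 33)) (?Q2 s1)"
        by (rule runs_Seq)
    qed
  qed
  have r3: "runs (Seq put_word scatter) s2 (13 + (2 * D + 9 * N + 33)) ?Q"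
    if s1: "?Q1 s1" and s2: "ok s2" "?Q2 s1 s2" for s1 s2
  proof -
    obtain L1 where L1: "set L1 \<subseteq> words m (Suc j)" "mid_step b b' L T L1 ?T1 s2" using s2(2) by blast
    have k: "reg s2 rW = W" "reg s2 rDj = dig W j" "reg s2 rSrc = slot_addr b q"
      using s1 s2(2) by (simp_all add: keeps_def)
    have k12: "keeps ({rA, rW, rSrc, rDj} \<union> ?R) s s2"
      by (rule keeps_trans[OF conjunct1[OF s1] conjunct1[OF s2(2)]]) auto
    then have col: "reg s2 rPj = 3 ^ j" "reg s2 rPl = 3 ^ (j - 1)" "reg s2 rPr = 3 ^ right_of m j"
      using s(3) by (simp_all add: at_col_def keeps_def)
    have fr: "fixed_regs s2" using L1(2) by (simp add: mid_step_def)
    let ?O = "\<lambda>s'. keeps {rA, rV, rX} s2 s' \<and> same_mem s2 s' \<and> reg s' rV = put m j W \<and> reg s' rX = 1"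
    have o: "runs put_word s2 13 ?O"
      using s2(1) fr k(1,2) col Wl j by (rule run_put_word)
    have "runs scatter s3 (2 * D + 9 * N + 33) ?Q" if s3: "ok s3" "?O s3" for s3
    proof -
      have work3: "mid_step b b' L T L1 ?T1 s3"
        using L1(2) s3(2) by (auto intro: mid_step_keeps)
      have Vm: "put m j W \<in> words m (Suc j)" using put_words[OF Wm j] .
      have x: "reg s3 rV = put m j W" "reg s3 rX = 1" "reg s3 rSrc = slot_addr b q"
        using k s3(2) by (simp_all add: keeps_def)
      show ?thesis
      proof (rule runs_mono[OF run_scatter[OF s3(1) work3 x Vm L1(1) _ q qK]])
        let ?T2 = "?T1(put m j W := ?T1 (put m j W) + monom 1 1 * T (L ! q))"
        fix s4 assume s4: "keeps {rK, rA, rA2, rDst, rSlot, rF, rCnt2} s3 s4 \<and>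
          (\<exists>L''. set L'' = insert (put m j W) (set L1) \<and> mid_step b b' L T L'' ?T2 s4)
              \<and> same_result s3 s4"
        have eq: "?T2 = (\<lambda>U. T' U + contrib m j T (L ! q) U)"
          unfolding monom_1_mult contrib_def W_def by (auto simp: fun_eq_iff add.assoc)
        obtain L'' where L'': "set L'' = insert (put m j W) (set L1)"
            "mid_step b b' L T L'' (\<lambda>U. T' U + contrib m j T (L ! q) U) s4"
          using s4 unfolding eq by blast
        then have "set L'' \<subseteq> words m (Suc j)" using Vm L1(1) by simp
        moreover have "keeps {rA, rA2, rW, rV, rX, rSrc, rDst, rK, rF, rSlot, rDj, rCnt2} s s4"
        proof -
          have "keeps ?R s2 s4" using s3(2) s4 by (auto intro: keeps_trans)
          then show ?thesis using k12 by (auto intro: keeps_trans)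
        qed
        moreover have "same_result s s4"
          using s1 s2(2) s3(2) s4 by (simp add: same_result_def same_mem_def)
        ultimately show "?Q s4" using L''(2) by blast
      qed simp_all
    qed
    with o show ?thesis by (rule runs_Seq)
  qed
  have r23: "runs (Seq (Cond (Equal rDj rZero) Skip (Seq omit_word scatter)) (Seq put_word scatter)) s1
      ((1 + (12 + (2 * D + 9 * N + 33))) + (13 + (2 * D + 9 * N + 33))) ?Q" if s1: "ok s1" "?Q1 s1"
          for s1
    using r2[OF s1] r3[OF s1(2)] by (rule runs_Seq)
  have "runs process s (9 + ((1 + (12 + (2 * D + 9 * N + 33))) + (13 + (2 * D + 9 * N + 33)))) ?Q"
    unfolding process_def using r1 r23 by (rule runs_Seq)
  then show ?thesis by (rule runs_mono) simp_all
qed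

definition has_table :: "nat \<Rightarrow> (nat \<Rightarrow> nat poly) \<Rightarrow> state \<Rightarrow> bool" where
  "has_table j T s \<longleftrightarrow> (\<exists>b L. b \<le> 1 \<and> reg s rB = b \<and> reg s rCnt = length L \<and> stored b L T s \<and>
     set L \<subseteq> words m j)"

definition ready :: "nat \<Rightarrow> (nat \<Rightarrow> nat poly) \<Rightarrow> state \<Rightarrow> bool" where
  "ready j T s \<longleftrightarrow> j < m \<and> fixed_regs s \<and> has_table j T s \<and> conts s 0 = Map.empty \<and> reg s rJ = j \<and>
     reg s rPj = 3 ^ j \<and> reg s rPl = 3 ^ (j - 1)"

abbreviation (input) vertex_regs :: "nat set" where
  "vertex_regs \<equiv> {rA, rA2, rW, rV, rX, rSrc, rDst, rK, rF, rSlot, rDj, rCnt2, rQ, rCnt, rB, rBn, rJ, rPj, rPl, rPr}"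

lemma run_clear:
  assumes s: "ok s" "mid_step b b' L T L' T' s" and L': "length L' \<le> K"
  shows "runs (For rQ rCnt2 (block [arith_instr Mul rA rQ rTwo, arith_instr Add rA rA rBn, Instr (Load rV rA),
      Instr (Delete 0 rV)])) s (2 + K * (D + 5))
    (\<lambda>s'. keeps {rQ, rA, rV} s s' \<and> imem s' = imem s \<and> cmem s' = cmem s \<and> conts s' 0 = Map.empty)"
    (is "runs (For _ _ ?c) _ _ ?Q")
proof -
  have W: "fixed_regs s" "b' \<le> 1" "reg s rBn = b'" "reg s rCnt2 = length L'" "stored b' L' T' s" "indexed L' s"
    using s(2) by (simp_all add: mid_step_def)
  define Inv where "Inv k s' \<longleftrightarrow> keeps {rQ, rA, rV} s s' \<and> imem s' = imem s \<and> cmem s' = cmem s \<and>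
    conts s' 0 = (\<lambda>U. if \<exists>i<k. L' ! i = U then None else conts s 0 U)" for k s'
  have "runs (For rQ rCnt2 ?c) s (2 + length L' * ((D + 3) + 2)) ?Q"
  proof (rule runs_For_const[where Inv = Inv])
    show "Inv 0 (set_reg rQ 0 s)" by (simp add: Inv_def keeps_def)
    fix k t assume k: "k < length L'" and t: "ok t" "reg t rQ = k" "reg t rCnt2 = length L'" "Inv k t"
    have kK: "k < K" using k L' by simp
    note bds = slot_addr_bounds[OF kK W(2)]
    have r: "reg t rTwo = 2" "reg t rBn = b'" "reg t rOne = 1"
      using t(4) W by (simp_all add: Inv_def keeps_def fixed_regs_def)
    have im: "imem t (k * 2 + b') = L' ! k"
      using t(4) W(5) k by (simp add: Inv_def stored_def mult.commute)
    show "runs ?c t (D + 3) (\<lambda>s'. reg s' rQ = k \<and> reg s' rCnt2 = length L' \<and> reg s' rOne = 1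
        \<and> Inv (Suc k) (set_reg rQ (Suc k) s'))"
      by (rule runs_straight[OF t(1)])
        (use t r bds im in \<open>auto simp: Inv_def keeps_def fun_eq_iff less_Suc_eq simp del: mult_Suc mult_Suc_right\<close>)
  next
    fix t assume t: "Inv (length L') t"
    have "conts t 0 U = None" for U
    proof (cases "U \<in> set L'")
      case True
      then show ?thesis using t by (auto simp: Inv_def in_set_conv_nth)
    next
      case False
      then have "conts s 0 U = None" using indexed_dom[OF W(6)] by (metis domIff)
      then show ?thesis using t by (simp add: Inv_def)
    qed
    then show "?Q t" using t by (simp add: Inv_def fun_eq_iff)
  qed (use s W in simp_all)
  then show ?thesis
    by (rule runs_mono) (use mult_le_mono1[OF L', of "D + 5"] in \<open>simp_all add: add.commute\<close>)
qed

lemma run_vertex_step: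
  assumes s: "ok s" "ready j T s"
  shows "runs vertex_step s (K * (5 * D + 18 * N + 117) + 20) (\<lambda>s'. keeps vertex_regs s s' \<and>
    ready (Suc j mod m) (\<lambda>U. \<Sum>W<3 ^ m. contrib m j T W U) s' \<and> same_result s s')" (is "runs _ _ _ ?Q")
proof -
  have j: "j < m" and fr: "fixed_regs s" and emp: "conts s 0 = Map.empty" and
    r: "reg s rJ = j" "reg s rPj = 3 ^ j" "reg s rPl = 3 ^ (j - 1)" and tb: "has_table j T s"
    using s(2) by (simp_all add: ready_def)
  obtain b L where bL: "b \<le> 1" "reg s rB = b" "reg s rCnt = length L" "stored b L T s" "set L \<subseteq> words m j"
    using tb unfolding has_table_def by blast
  define b' where "b' = 1 - b"
  have b': "b' \<le> 1" "b \<noteq> b'" "1 - b = b'" using bL(1) by (cases b; simp add: b'_def)+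
  have lK: "length L \<le> K" using bL by (intro length_le_K[of _ j]) (simp_all add: stored_def)
  have mB: "m < B" "Suc j < B" using ok_reg[OF s(1), of rM] fr j by (simp_all add: fixed_regs_def)
  let ?c1 = "block [arith_instr Add rA rJ rOne, Cond (Equal rA rM) (const_instr rPr 1) (move_instr rPr rPj),
       const_instr rCnt2 0, arith_instr Sub rBn rOne rB]"
  let ?Q1 = "\<lambda>s1. keeps {rA, rPr, rCnt2, rBn} s s1 \<and> same_mem s s1 \<and>
    mid_step b b' L T [] (\<lambda>_. 0) s1 \<and> at_col j s1"
  have r1: "runs ?c1 s 6 ?Q1"
    by (rule runs_straight[OF s(1)])
      (use fr r bL mB B b' j emp in \<open>auto simp: keeps_def same_mem_def mid_step_def fixed_regs_def at_col_def
        stored_def indexed_def right_of_def\<close>)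
  let ?R = "{rA, rA2, rW, rV, rX, rSrc, rDst, rK, rF, rSlot, rDj, rCnt2, rQ}"
  let ?S = "\<lambda>k U. \<Sum>i<k. contrib m j T (L ! i) U"
  let ?Q2 = "\<lambda>s1 s2. keeps ?R s1 s2 \<and> same_result s1 s2 \<and>
    (\<exists>L'. set L' \<subseteq> words m (Suc j) \<and> mid_step b b' L T L' (?S (length L)) s2)"
  have r2: "runs (For rQ rCnt process) s1 (2 + length L * ((4 * D + 18 * N + 110) + 2)) (?Q2 s1)"
    if s1: "ok s1" "?Q1 s1" for s1
  proof -
    define Inv where "Inv k s' \<longleftrightarrow> keeps ?R s1 s' \<and> same_result s1 s' \<and>
      (\<exists>L'. set L' \<subseteq> words m (Suc j) \<and> mid_step b b' L T L' (?S k) s')" for k s'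
    have wset: "mid_step b b' L T L' T' (set_reg rQ v t) \<longleftrightarrow> mid_step b b' L T L' T' t" for L' T' v t
      by (simp add: mid_step_def fixed_regs_def)
    show ?thesis
    proof (rule runs_For_const[where Inv = Inv])
      show "Inv 0 (set_reg rQ 0 s1)"
        using s1(2) by (auto simp: Inv_def wset keeps_def same_result_def intro!: exI[of _ "[]"])
      show "reg s1 rCnt = length L" using s1(2) bL(3) by (simp add: keeps_def)
      fix k t assume k: "k < length L" and t: "ok t" "reg t rQ = k" "reg t rCnt = length L" "Inv k t"
      obtain L' where L': "set L' \<subseteq> words m (Suc j)" "mid_step b b' L T L' (?S k) t"
        using t(4) unfolding Inv_def by blast
      have k1: "keeps ?R s1 t" "same_result s1 t" using t(4) by (simp_all add: Inv_def)
      have col: "at_col j t" using s1(2) k1 by (simp add: at_col_def keeps_def)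
      show "runs process t (4 * D + 18 * N + 110) (\<lambda>s'. reg s' rQ = k \<and> reg s' rCnt = length L
          \<and> reg s' rOne = 1 \<and> Inv (Suc k) (set_reg rQ (Suc k) s'))"
      proof (rule runs_mono[OF run_process[OF t(1) L'(2) col t(2) k bL(5) L'(1)]])
        fix t' assume t': "keeps {rA, rA2, rW, rV, rX, rSrc, rDst, rK, rF, rSlot, rDj, rCnt2} t t' \<and>
          (\<exists>L''. set L'' \<subseteq> words m (Suc j) \<and> mid_step b b' L T L''
              (\<lambda>U. ?S k U + contrib m j T (L ! k) U) t') \<and>
          same_result t t'"
        then obtain L'' where L'': "set L'' \<subseteq> words m (Suc j)" "mid_step b b' L T L'' (?S (Suc k)) t'" by auto
        have "keeps ?R s1 (set_reg rQ (Suc k) t')" using k1(1) t' by (simp add: keeps_def)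
        moreover have "same_result s1 (set_reg rQ (Suc k) t')" using k1(2) t'
            by (simp add: same_result_def)
        ultimately have "Inv (Suc k) (set_reg rQ (Suc k) t')" 
          unfolding Inv_def wset using L'' by blast
        moreover have "reg t' rOne = 1" using L''(2) by (simp add: mid_step_def fixed_regs_def)
        ultimately show "reg t' rQ = k \<and> reg t' rCnt = length L \<and> reg t' rOne = 1
            \<and> Inv (Suc k) (set_reg rQ (Suc k) t')"
          using t' t by (simp add: keeps_def)
      qed simp
    qed (use s1 in \<open>auto simp: Inv_def\<close>)
  qed
  have sumL: "?S (length L) U = (\<Sum>W<3 ^ m. contrib m j T W U)" for U
  proof -
    have dist: "distinct L" and zero: "\<And>W. W \<notin> set L \<Longrightarrow> T W = 0" using bL(4) by (simp_all add: stored_def)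
    have "?S (length L) U = (\<Sum>W\<in>set L. contrib m j T W U)"
      using dist by (simp add: sum.distinct_set_conv_list sum_list_sum_nth atLeast0LessThan)
    also have "\<dots> = (\<Sum>W<3 ^ m. contrib m j T W U)"
      by (rule sum.mono_neutral_left) (use bL(5) zero in \<open>auto simp: words_def contrib_def\<close>)
    finally show ?thesis .
  qed
  let ?c3 = "For rQ rCnt2 (block [arith_instr Mul rA rQ rTwo, arith_instr Add rA rA rBn, Instr (Load rV rA), Instr (Delete 0 rV)])"
  let ?T' = "\<lambda>U. \<Sum>W<3 ^ m. contrib m j T W U"
  let ?Q3 = "\<lambda>s3. keeps ({rPr, rBn} \<union> ?R) s s3 \<and> same_result s s3 \<and> conts s3 0 = Map.empty \<and>
    (\<exists>L'. set L' \<subseteq> words m (Suc j) \<and> stored b' L' ?T' s3 \<and> reg s3 rCnt2 = length L') \<and> reg s3 rBn = b'"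
  have r3: "runs ?c3 s2 (2 + K * (D + 5)) ?Q3"
    if s1: "?Q1 s1" and s2: "ok s2" "?Q2 s1 s2" for s1 s2
  proof -
    obtain L' where L': "set L' \<subseteq> words m (Suc j)" "mid_step b b' L T L' ?T' s2"
      using s2(2) unfolding sumL by blast
    have lK': "length L' \<le> K" using L' by (intro length_le_K[of _ "Suc j"]) (simp_all add: mid_step_def stored_def)
    show ?thesis
    proof (rule runs_mono[OF run_clear[OF s2(1) L'(2) lK']])
      fix s3 assume s3: "keeps {rQ, rA, rV} s2 s3 \<and> imem s3 = imem s2 \<and> cmem s3 = cmem s2
          \<and> conts s3 0 = Map.empty"
      have "stored b' L' ?T' s3" "reg s3 rCnt2 = length L'" "reg s3 rBn = b'"
        using L'(2) s3 by (simp_all add: mid_step_def stored_def keeps_def)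
      moreover have "keeps ({rPr, rBn} \<union> ?R) s s3"
        using s1 s2(2) s3 by (simp add: keeps_def)
      moreover have "same_result s s3"
        using s1 s2(2) s3 by (simp add: same_result_def same_mem_def)
      ultimately show "?Q3 s3" using L'(1) s3 by blast
    qed simp
  qed
  let ?c4 = "block [move_instr rCnt rCnt2, move_instr rB rBn, arith_instr Add rJ rJ rOne,
       Cond (Equal rJ rM) (block [const_instr rJ 0, const_instr rPj 1, const_instr rPl 1])
         (block [move_instr rPl rPj, arith_instr Mul rPj rPj rThree])]"
  have r4: "runs ?c4 s3 7 ?Q" if s3: "ok s3" "?Q3 s3" for s3
  proof (rule runs_straight[OF s3(1)])
    obtain L' where L': "set L' \<subseteq> words m (Suc j)" "stored b' L' ?T' s3" "reg s3 rCnt2 = length L'"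
      using s3(2) by blast
    have fr3: "fixed_regs s3" using fr s3(2) by (auto intro: fixed_regs_keeps)
    have r': "reg s3 rJ = j" "reg s3 rPj = 3 ^ j" "reg s3 rBn = b'" using r s3(2)
        by (simp_all add: keeps_def)
    have "(3 :: nat) ^ j < 3 ^ m" using j by simp
    then have pB: "3 ^ j * 3 < B" using B_word by linarith
    let ?s5 = "set_reg rJ (Suc j) (set_reg rB b' (set_reg rCnt (length L') s3))"
    have cur: "has_table (Suc j) ?T' (set_reg x y (set_reg x' y' s'))"
        if "x \<notin> {rB, rCnt}" "x' \<notin> {rB, rCnt}"
       "stored b' L' ?T' s'" "reg s' rB = b'" "reg s' rCnt = length L'" for x y x' y' s'
      unfolding has_table_def using L' b'(1) that by (intro exI[of _ b'] exI[of _ L']) simp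
    show "wp ?c4 ?Q s3"
    proof (cases "Suc j = m")
      case True
      let ?s = "set_reg rPl 1 (set_reg rPj 1 (set_reg rJ 0 ?s5))"
      have "has_table 0 ?T' ?s"
        using cur[of rPl rPj "set_reg rJ 0 ?s5" 1 1] L'
            unfolding True words_wrap[symmetric] has_table_def
        by (simp add: words_wrap)
      then have "?Q ?s"
        using True s3(2) fr3 m_pos by (simp add: ready_def fixed_regs_def keeps_def same_result_def)
      then show ?thesis using True fr3 r' L' mB B by (simp add: fixed_regs_def)
    next
      case False
      let ?s = "set_reg rPj (3 ^ j * 3) (set_reg rPl (3 ^ j) ?s5)"
      have "has_table (Suc j) ?T' ?s"
        using cur[of rPj rPl ?s5] L' by simp
      then have "?Q ?s"
        using False j s3(2) fr3 by (simp add: ready_def fixed_regs_def keeps_def same_result_def)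
      then show ?thesis using False fr3 r' L' mB B pB by (simp add: fixed_regs_def)
    qed
  qed simp
  have r34: "runs (Seq ?c3 ?c4) s2 ((2 + K * (D + 5)) + 7) ?Q" if "?Q1 s1" "ok s2" "?Q2 s1 s2" for s1 s2
    using r3[OF that] r4 by (rule runs_Seq)
  have r24: "runs (Seq (For rQ rCnt process) (Seq ?c3 ?c4)) s1
      ((2 + length L * ((4 * D + 18 * N + 110) + 2)) + ((2 + K * (D + 5)) + 7)) ?Q" if s1: "ok s1" "?Q1 s1" for s1
    using r2[OF s1] r34[OF s1(2)] by (rule runs_Seq)
  have "runs vertex_step s (6 + ((2 + length L * ((4 * D + 18 * N + 110) + 2)) + ((2 + K * (D + 5)) + 7))) ?Q"
    unfolding vertex_step_def using r1 r24 by (rule runs_Seq)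
  then show ?thesis
  proof (rule runs_mono)
    have "length L * ((4 * D + 18 * N + 110) + 2) \<le> K * ((4 * D + 18 * N + 110) + 2)"
      using lK by (rule mult_le_mono1)
    then show "6 + ((2 + length L * ((4 * D + 18 * N + 110) + 2)) + ((2 + K * (D + 5)) + 7))
        \<le> K * (5 * D + 18 * N + 117) + 20"
      by (simp add: algebra_simps)
  qed
qed

section \<open>The whole program\<close>

definition result_is :: "nat poly \<Rightarrow> state \<Rightarrow> bool" where
  "result_is R s \<longleftrightarrow> (\<forall>k\<le>N. cmem s k = coeff R k mod p)"

lemma result_is_cong: "result_is R s \<Longrightarrow> same_result s s' \<Longrightarrow> result_is R s'"
  by (simp add: result_is_def same_result_def)

lemma ready_set_reg: "r \<notin> {0..12} \<union> {rB, rCnt, rJ, rPj, rPl} \<Longrightarrow> ready j T (set_reg r v s) = ready j T s"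
  by (auto simp: ready_def fixed_regs_def has_table_def)

text \<open>The words of a table are distinct, so the loop meets \<open>w\<close> at most once; if it does not, the polynomial of \<open>w\<close> is 0.\<close>

lemma run_collect:
  assumes s: "ok s" "ready 0 T s" "result_is R s" "reg s rW0 = w"
  shows "runs (For rQ rCnt (Seq (block [arith_instr Mul rA rQ rTwo, arith_instr Add rA rA rB, Instr (Load rV rA)])
         (Cond (Equal rV rW0) (Seq (block [poly_addr rSrc rQ rB, const_instr rDst 0]) add_poly) Skip)))
      s (2 + K * (5 * N + 18)) (\<lambda>s'. keeps {rQ, rA, rA2, rV, rSrc, rDst, rK} s s' \<and>
      result_is (R + T w) s' \<and> conts s' 0 = Map.empty)" (is "runs (For _ _ ?c) _ _ ?Q")
proof -
  obtain b L where bL: "b \<le> 1" "reg s rB = b" "reg s rCnt = length L" "stored b L T s" "set L \<subseteq> words m 0"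
    using s(2) unfolding ready_def has_table_def by blast
  have fr: "fixed_regs s" and emp: "conts s 0 = Map.empty" using s(2) by (simp_all add: ready_def)
  have dist: "distinct L" using bL(4) by (simp add: stored_def)
  then have lK: "length L \<le> K" using bL(5) by (rule length_le_K)
  let ?R = "{rQ, rA, rA2, rV, rSrc, rDst, rK}"
  define Inv where "Inv k t \<longleftrightarrow> keeps ?R s t \<and> conts t 0 = Map.empty \<and> stored b L T t \<and>
    result_is (if w \<in> set (take k L) then R + T w else R) t" for k t
  have iset: "Inv k (set_reg rQ v t) = Inv k t" for k v t
    by (simp add: Inv_def keeps_def result_is_def)
  have "runs (For rQ rCnt ?c) s (2 + length L * ((3 + (1 + (5 + (5 * N + 7)))) + 2)) ?Q"
  proof (rule runs_For_const[where Inv = Inv])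
    show "Inv 0 (set_reg rQ 0 s)"
      using s bL emp by (simp add: Inv_def keeps_def result_is_def)
    fix k t assume k: "k < length L" and t: "ok t" "reg t rQ = k" "reg t rCnt = length L" "Inv k t"
    have kK: "k < K" using k lK by simp
    note bds = slot_addr_bounds[OF kK bL(1)]
    have frt: "fixed_regs t" using fr t(4) by (auto simp: Inv_def intro: fixed_regs_keeps)
    have r: "reg t rB = b" "reg t rW0 = w" using t(4) bL s by (simp_all add: Inv_def keeps_def)
    have im: "imem t (k * 2 + b) = L ! k" using t(4) k by (simp add: Inv_def stored_def mult.commute)
    have new: "w \<notin> set (take k L)" if "L ! k = w"
      using that dist k by (auto simp: in_set_conv_nth nth_eq_iff_index_eq)
    let ?P = "\<lambda>s'. reg s' rQ = k \<and> reg s' rCnt = length L \<and> reg s' rOne = 1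
        \<and> Inv (Suc k) (set_reg rQ (Suc k) s')"
    have P: "?P t'" if "keeps (?R - {rQ}) t t'" "Inv (Suc k) t'" for t'
      using that(1) t frt that(2) unfolding iset by (simp add: keeps_def fixed_regs_def)
    let ?b1 = "block [arith_instr Mul rA rQ rTwo, arith_instr Add rA rA rB, Instr (Load rV rA)]"
    let ?Q1 = "\<lambda>t1. keeps {rA, rV} t t1 \<and> same_mem t t1 \<and> reg t1 rV = L ! k"
    have r1: "runs ?b1 t 3 ?Q1"
      by (rule runs_straight[OF t(1)])
        (use t(2) frt r bds im in \<open>auto simp: keeps_def same_mem_def fixed_regs_def\<close>)
    have r2: "runs (Cond (Equal rV rW0) (Seq (block [poly_addr rSrc rQ rB, const_instr rDst 0]) add_poly) Skip) t1
        (1 + (5 + (5 * N + 7))) ?P" if t1: "ok t1" "?Q1 t1" for t1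
    proof (rule runs_Cond)
      have fr1: "fixed_regs t1" using frt t1(2) by (auto intro: fixed_regs_keeps)
      have r1: "reg t1 rB = b" "reg t1 rW0 = w" "reg t1 rQ = k" using t1(2) r t(2)
          by (simp_all add: keeps_def)
      {
        assume "holds (Equal rV rW0) t1"
        then have Lk: "L ! k = w" using t1(2) r1 by simp
        let ?Q2 = "\<lambda>t2. keeps {rA, rV, rSrc, rDst} t t2 \<and> same_mem t t2 \<and> reg t2 rSrc = slot_addr b k
            \<and> reg t2 rDst = 0"
        have r3: "runs (block [poly_addr rSrc rQ rB, const_instr rDst 0]) t1 5 ?Q2"
          by (rule runs_straight[OF t1(1)])
            (use t1(2) fr1 r1 bds B in \<open>auto simp: poly_addr_def fixed_regs_def keeps_def same_mem_def simp del: mult_Suc mult_Suc_right\<close>)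
        have r4: "runs add_poly t2 (5 * N + 7) ?P" if t2: "ok t2" "?Q2 t2" for t2
        proof (rule runs_mono[OF run_add_poly[OF t2(1), of "slot_addr b k" 0]])
          show "fixed_regs t2" using frt t2(2) by (auto intro: fixed_regs_keeps)
          show "slot_addr b k + N < C" by (rule bds)
          then show "0 + N < C" by linarith
          show "slot_addr b k + N < 0 \<or> 0 + N < slot_addr b k" using slot_addr_ge[of b k] by simp
          fix t3 assume t3: "keeps {rK, rA, rA2} t2 t3 \<and> imem t3 = imem t2 \<and> conts t3 = conts t2 \<and>
            (\<forall>y\<le>N. cmem t3 (0 + y) = (cmem t2 (0 + y) + cmem t2 (slot_addr b k + y)) mod p) \<and>
            (\<forall>x. x < 0 \<or> 0 + N < x \<longrightarrow> cmem t3 x = cmem t2 x)"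
          show "?P t3"
          proof (rule P)
            show kp: "keeps (?R - {rQ}) t t3" using t2(2) t3 by (simp add: keeps_def)
            have "stored b L T t" using t(4) by (simp add: Inv_def)
            then have "stored b L T t3"
            proof (rule stored_cong)
              fix q y
              have "N < slot_addr b q + y" using slot_addr_ge[of b q] by simp
              then show "cmem t3 (slot_addr b q + y) = cmem t (slot_addr b q + y)"
                using t2(2) t3 by (simp add: same_mem_def)
            qed (use t2(2) t3 in \<open>simp add: same_mem_def\<close>)
            moreover have "result_is (R + T w) t3"
              unfolding result_is_def
            proof (intro allI impI)
              fix y assume y: "y \<le> N"
              have "cmem t y = coeff R y mod p" using t(4) new[OF Lk] y
                  by (simp add: Inv_def result_is_def)
              moreover have "cmem t (slot_addr b k + y) = coeff (T w) y mod p"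
                using t(4) Lk k y by (simp add: Inv_def stored_def)
              moreover have "cmem t3 y = (cmem t y + cmem t (slot_addr b k + y)) mod p"
                using t2(2) t3 y by (simp add: same_mem_def)
              ultimately show "cmem t3 y = coeff (R + T w) y mod p" by (simp add: mod_add_eq)
            qed
            moreover have "keeps ?R s t3" using t(4) kp by (simp add: Inv_def keeps_def)
            moreover have "conts t3 0 = Map.empty" using t(4) t2(2) t3
                by (simp add: Inv_def same_mem_def)
            ultimately show "Inv (Suc k) t3"
              using Lk k by (simp add: Inv_def take_Suc_conv_app_nth)
          qed
        qed (use t2(2) in simp_all)
        show "runs (Seq (block [poly_addr rSrc rQ rB, const_instr rDst 0]) add_poly) t1 (5 + (5 * N + 7)) ?P"
          using r3 r4 by (rule runs_Seq)
      }
      assume "\<not> holds (Equal rV rW0) t1"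
      then have "L ! k \<noteq> w" using t1(2) r1 by simp
      then have "Inv (Suc k) t1"
        using t(4) t1(2) k by (simp add: Inv_def take_Suc_conv_app_nth result_is_def same_mem_def stored_def keeps_def)
      moreover have "keeps (?R - {rQ}) t t1" using t1(2) by (simp add: keeps_def)
      ultimately have "?P t1" by (intro P)
      then show "runs Skip t1 (5 + (5 * N + 7)) ?P"
        using t1(1) by (intro runs_straight) simp_all
    qed
    show "runs ?c t (3 + (1 + (5 + (5 * N + 7)))) ?P" using r1 r2 by (rule runs_Seq)
  next
    fix t assume t: "Inv (length L) t"
    have "w \<notin> set L \<Longrightarrow> T w = 0" using bL(4) by (simp add: stored_def)
    then show "?Q t" using t by (auto simp: Inv_def split: if_splits)
  qed (use s bL in simp_all)
  then show ?thesis
    by (rule runs_mono) (use mult_le_mono1[OF lK, of "5 * N + 18"] in \<open>simp_all add: add.commute\<close>)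
qed

lemma run_sweep:
  assumes s: "ok s" "fixed_regs s" "conts s 0 = Map.empty" "result_is R s" "reg s rW0 = w"
    and w: "w \<in> words m 0"
  shows "runs sweep s (N * (K * (5 * D + 18 * N + 117) + 22) + K * (5 * N + 18) + 4 * N + 20)
    (\<lambda>s'. keeps (insert rT vertex_regs) s s' \<and> result_is (R + run_poly m w N w) s'
        \<and> conts s' 0 = Map.empty)"
    (is "runs _ _ _ ?Q")
proof -
  have wl: "w < 3 ^ m" using w by (simp add: words_def)
  have K: "0 < K" using length_le_K[of "[w]" 0] w by simp
  note bds = slot_addr_bounds[OF K, of 0, simplified]
  have a0: "slot_addr 0 0 = N + 2" by (simp add: slot_addr_def)
  have dB: "N + 2 < B" "N + 2 < C" using bds(7-9) a0 by simp_all
  let ?b1 = "block [const_instr rB 0, const_instr rCnt 1, Instr (Store rZero rW0), move_instr rDst rStr]"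
  let ?b2 = "block [Instr (COne rDst), const_instr rJ 0, const_instr rPj 1, const_instr rPl 1]"
  let ?Q1 = "\<lambda>s1. keeps {rB, rCnt, rDst} s s1 \<and> reg s1 rB = 0 \<and> reg s1 rCnt = 1 \<and> reg s1 rDst = N + 2 \<and>
    imem s1 = (imem s)(0 := w) \<and> cmem s1 = cmem s \<and> conts s1 = conts s"
  have r1: "runs ?b1 s 5 ?Q1"
    by (rule runs_straight[OF s(1)]) (use s B bds in \<open>auto simp: fixed_regs_def keeps_def\<close>)
  let ?Q2 = "\<lambda>s2. keeps {rB, rCnt, rDst, rK, rA} s s2 \<and> reg s2 rB = 0 \<and> reg s2 rCnt = 1
      \<and> reg s2 rDst = N + 2 \<and>
    imem s2 0 = w \<and> conts s2 = conts s \<and> (\<forall>k\<le>N. cmem s2 (N + 2 + k) = 0) \<and> same_result s s2"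
  have r2: "runs zero_poly s1 (4 * N + 6) ?Q2" if s1: "ok s1" "?Q1 s1" for s1
  proof (rule runs_mono[OF run_zero_poly[OF s1(1), of "N + 2"]])
    show "fixed_regs s1" using s(2) s1(2) by (auto intro: fixed_regs_keeps)
    show "N + 2 + N < C" using bds(7) a0 by simp
    fix s2 assume s2: "keeps {rK, rA} s1 s2 \<and> imem s2 = imem s1 \<and> conts s2 = conts s1 \<and>
      (\<forall>k\<le>N. cmem s2 (N + 2 + k) = 0) \<and> (\<forall>x. x < N + 2 \<or> N + 2 + N < x \<longrightarrow> cmem s2 x = cmem s1 x)"
    have "keeps {rB, rCnt, rDst, rK, rA} s s2" "reg s2 rB = 0" "reg s2 rCnt = 1" "reg s2 rDst = N + 2"
      using s1(2) s2 by (simp_all add: keeps_def)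
    moreover have "same_result s s2" using s1(2) s2 by (simp add: same_result_def)
    ultimately show "?Q2 s2" using s1(2) s2 by simp
  qed (use s1 in simp_all)
  let ?U = "insert rT vertex_regs"
  let ?Q3 = "\<lambda>s3. keeps ?U s s3 \<and> same_result s s3 \<and> ready 0 (run_poly m w 0) s3"
  have r3: "runs ?b2 s2 4 ?Q3" if s2: "ok s2" "?Q2 s2" for s2
  proof (rule runs_straight[OF s2(1)])
    have fr2: "fixed_regs s2" using s(2) s2(2) by (auto intro: fixed_regs_keeps)
    let ?s = "set_reg rPl 1 (set_reg rPj 1 (set_reg rJ 0 (set_coeff (N + 2) (1 mod p) s2)))"
    have "stored 0 [w] (run_poly m w 0) ?s"
      using s2(2) a0 by (auto simp: stored_def)
    then have "has_table 0 (run_poly m w 0) ?s"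
      unfolding has_table_def using s2(2) w by (intro exI[of _ 0] exI[of _ "[w]"]) simp
    then have "ready 0 (run_poly m w 0) ?s"
      using fr2 m_pos s2(2) s(3) by (simp add: ready_def fixed_regs_def)
    moreover have "same_result s ?s" using s2(2) by (simp add: same_result_def)
    moreover have "keeps ?U s ?s" using s2(2) by (simp add: keeps_def)
    ultimately have "?Q3 ?s" by blast
    then show "wp ?b2 ?Q3 s2" using s2(2) B dB by simp
  qed simp
  let ?VT = "K * (5 * D + 18 * N + 117) + 20"
  let ?Q4 = "\<lambda>s4. keeps ?U s s4 \<and> same_result s s4 \<and> ready 0 (run_poly m w N) s4"
  have r4: "runs (For rT rN vertex_step) s3 (2 + N * (?VT + 2)) ?Q4" if s3: "ok s3" "?Q3 s3" for s3
  proof -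
    define Inv where "Inv t s' \<longleftrightarrow> keeps ?U s s' \<and> same_result s s'
        \<and> ready (t mod m) (run_poly m w t) s'" for t s'
    have iset: "Inv t (set_reg rT v s') = Inv t s'" for t v s'
      by (simp add: Inv_def ready_set_reg keeps_def same_result_def)
    show ?thesis
    proof (rule runs_For_const[where Inv = Inv])
      show "Inv 0 (set_reg rT 0 s3)" unfolding iset using s3(2) by (simp add: Inv_def)
      show "reg s3 rN = N" using s3(2) by (simp add: ready_def fixed_regs_def)
      fix t s' assume t: "t < N" and s': "ok s'" "reg s' rT = t" "reg s' rN = N" "Inv t s'"
      have rd: "ready (t mod m) (run_poly m w t) s'" using s'(4) by (simp add: Inv_def)
      show "runs vertex_step s' ?VT (\<lambda>s''. reg s'' rT = t \<and> reg s'' rN = N \<and> reg s'' rOne = 1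
          \<and> Inv (Suc t) (set_reg rT (Suc t) s''))"
      proof (rule runs_mono[OF run_vertex_step[OF s'(1) rd]])
        fix s'' assume s'': "keeps vertex_regs s' s'' \<and>
          ready (Suc (t mod m) mod m) (\<lambda>U. \<Sum>W<3 ^ m. contrib m (t mod m) (run_poly m w t) W U) s''
              \<and> same_result s' s''"
        have eq: "(\<lambda>U. \<Sum>W<3 ^ m. contrib m (t mod m) (run_poly m w t) W U) = run_poly m w (Suc t)"
          by (rule ext) (rule run_poly_Suc[symmetric])
        have "ready (Suc t mod m) (run_poly m w (Suc t)) s''"
          using s'' unfolding eq mod_Suc_eq by simp
        moreover have "keeps ?U s s''" using s'(4) s'' by (simp add: Inv_def keeps_def)
        moreover have "same_result s s''" using s'(4) s'' by (simp add: Inv_def same_result_def)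
        ultimately have "Inv (Suc t) s''" by (simp add: Inv_def)
        moreover have "reg s'' rOne = 1" using s'' by (simp add: ready_def fixed_regs_def)
        ultimately show "reg s'' rT = t \<and> reg s'' rN = N \<and> reg s'' rOne = 1
            \<and> Inv (Suc t) (set_reg rT (Suc t) s'')"
          unfolding iset using s' s'' by (simp add: keeps_def)
      qed simp
    next
      fix s' assume "Inv N s'"
      then show "?Q4 s'" by (simp add: Inv_def N_eq)
    qed (use s3 in simp_all)
  qed
  let ?c5 = "For rQ rCnt (Seq (block [arith_instr Mul rA rQ rTwo, arith_instr Add rA rA rB, Instr (Load rV rA)])
         (Cond (Equal rV rW0) (Seq (block [poly_addr rSrc rQ rB, const_instr rDst 0]) add_poly) Skip))"
  have r5: "runs ?c5 s4 (2 + K * (5 * N + 18)) ?Q" if s4: "ok s4" "?Q4 s4" for s4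
  proof (rule runs_mono[OF run_collect[OF s4(1)]])
    show "ready 0 (run_poly m w N) s4" using s4(2) by blast
    show "result_is R s4" using s(4) s4(2) result_is_cong by blast
    show "reg s4 rW0 = w" using s4(2) s(5) by (simp add: keeps_def)
    fix s5 assume s5: "keeps {rQ, rA, rA2, rV, rSrc, rDst, rK} s4 s5
        \<and> result_is (R + run_poly m w N w) s5 \<and> conts s5 0 = Map.empty"
    have "keeps ?U s s5" using s4(2) s5 by (simp add: keeps_def)
    then show "?Q s5" using s5 by blast
  qed simp
  have r45: "runs (Seq (For rT rN vertex_step) ?c5) s3 ((2 + N * (?VT + 2)) + (2 + K * (5 * N + 18))) ?Q"
    if "ok s3" "?Q3 s3" for s3 using r4[OF that] r5 by (rule runs_Seq)
  have r35: "runs (Seq ?b2 (Seq (For rT rN vertex_step) ?c5)) s2 (4 + ((2 + N * (?VT + 2)) + (2 + K * (5 * N + 18)))) ?Q"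
    if "ok s2" "?Q2 s2" for s2 using r3[OF that] r45 by (rule runs_Seq)
  have r25: "runs (Seq zero_poly (Seq ?b2 (Seq (For rT rN vertex_step) ?c5))) s1
      ((4 * N + 6) + (4 + ((2 + N * (?VT + 2)) + (2 + K * (5 * N + 18))))) ?Q"
    if "ok s1" "?Q1 s1" for s1 using r2[OF that] r35 by (rule runs_Seq)
  have "runs sweep s (5 + ((4 * N + 6) + (4 + ((2 + N * (?VT + 2)) + (2 + K * (5 * N + 18)))))) ?Q"
    unfolding sweep_def using r1 r25 by (rule runs_Seq)
  then show ?thesis by (rule runs_mono) (simp_all add: algebra_simps)
qed

lemma run_check_word:
  assumes s: "ok s" "fixed_regs s" "reg s rW0 = w" and w: "w < 3 ^ m"
  shows "runs check_word s (7 * m + 4) (\<lambda>s'. keeps {rF, rV, rI, rA} s s' \<and> same_mem s s' \<and>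
    reg s' rF = (if w \<in> words m 0 then 1 else 0))" (is "runs _ _ _ ?Q")
proof -
  have wB: "w div 3 ^ k < B" for k
    using w B_word div_le_dividend[of w "3 ^ k"] by linarith
  let ?Q1 = "\<lambda>s1. keeps {rF, rV} s s1 \<and> same_mem s s1 \<and> reg s1 rF = 1 \<and> reg s1 rV = w"
  have r1: "runs (block [const_instr rF 1, move_instr rV rW0]) s 2 ?Q1"
    by (rule runs_straight[OF s(1)]) (use s B in \<open>auto simp: keeps_def same_mem_def\<close>)
  let ?c = "block [arith_instr Mod rA rV rNine,
       Cond (Equal rA rTwo) (const_instr rF 0) (Cond (Equal rA rSix) (const_instr rF 0) Skip),
       arith_instr Div rV rV rThree]"
  have r2: "runs (For rI rM1 ?c) s1 (2 + (m - 1) * (5 + 2)) ?Q" if s1: "ok s1" "?Q1 s1" for s1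
  proof -
    define Inv where "Inv k t \<longleftrightarrow> keeps {rF, rV, rI, rA} s t \<and> same_mem s t \<and> reg t rV = w div 3 ^ k \<and>
      reg t rF = (if \<exists>i<k. clash w i then 0 else 1)" for k t
    show ?thesis
    proof (rule runs_For_const[where Inv = Inv])
      show "Inv 0 (set_reg rI 0 s1)" using s1(2) by (simp add: Inv_def keeps_def same_mem_def)
      show "reg s1 rM1 = m - 1" using s1(2) s(2) by (simp add: keeps_def fixed_regs_def)
      fix k t assume t: "ok t" "reg t rI = k" "reg t rM1 = m - 1" "Inv k t"
      have fr: "fixed_regs t" using s(2) t(4) by (auto simp: Inv_def intro: fixed_regs_keeps)
      have r: "reg t rV = w div 3 ^ k" using t(4) by (simp add: Inv_def)
      have d: "w div 3 ^ k div 3 = w div 3 ^ Suc k" by (simp add: div_mult2_eq power_Suc2 del: power_Suc)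
      have b9: "w div 3 ^ k mod 9 < B" using wB[of k] mod_less_eq_dividend[of "w div 3 ^ k" 9] by linarith
      have cl: "clash w k \<longleftrightarrow> w div 3 ^ k mod 9 = 2 \<or> w div 3 ^ k mod 9 = 6" by (rule clash_iff_mod)
      show "runs ?c t 5 (\<lambda>s'. reg s' rI = k \<and> reg s' rM1 = m - 1 \<and> reg s' rOne = 1
          \<and> Inv (Suc k) (set_reg rI (Suc k) s'))"
        by (rule runs_straight[OF t(1)])
          (use t fr r d wB[of "Suc k"] b9 cl B in
            \<open>auto simp: Inv_def fixed_regs_def keeps_def same_mem_def less_Suc_eq simp del: power_Suc\<close>)
    next
      fix t assume "Inv (m - 1) t"
      moreover have "w \<in> words m 0 \<longleftrightarrow> \<not> (\<exists>i<m - 1. clash w i)"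
        using w by (auto simp: words_def less_diff_conv)
      ultimately show "?Q t" by (simp add: Inv_def)
    qed (use s1 in simp_all)
  qed
  have "runs check_word s (2 + (2 + (m - 1) * (5 + 2))) ?Q"
    unfolding check_word_def using r1 r2 by (rule runs_Seq)
  then show ?thesis by (rule runs_mono) simp_all
qed

definition total_time :: nat where
  "total_time = 3 ^ m * (7 * m + 7) + K * (N * (K * (5 * D + 18 * N + 117) + 22) + K * (5 * N + 18) + 4 * N + 20) +
     3 * m + 14"

lemma run_torus_prog:
  assumes nB: "n < B" "N + 2 < B"
  shows "runs torus_prog (initial_state m n) total_time
    (\<lambda>s'. \<forall>k\<le>N. cmem s' k = coeff (domination_poly (torus_graph m n)) k mod p)" (is "runs _ ?s0 _ ?Q")
proof -
  have m3: "m < 3 ^ m" by (rule less_exp[THEN order.strict_trans2]) (simp add: power_mono)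
  then have mB: "m < B" "3 ^ m < B" "10 < B" using B_word by linarith+
  have ok0: "ok ?s0"
    using mB nB by (auto simp: ok_def ints_below_def initial_state_def)
  let ?b1 = "block [const_instr rOne 1, const_instr rTwo 2, const_instr rThree 3, const_instr rSix 6, const_instr rNine 9,
       arith_instr Mul rN 0 1, arith_instr Add rN1 rN rOne, arith_instr Add rStr rN1 rOne,
       arith_instr Sub rM1 rM rOne, const_instr rP 1]"
  define pre where "pre k t \<longleftrightarrow> (\<forall>y. cmem t y = 0) \<and> conts t 0 = Map.empty \<and>
     reg t rM = m \<and> reg t rOne = 1 \<and> reg t rTwo = 2 \<and> reg t rThree = 3 \<and>
     reg t rSix = 6 \<and> reg t rNine = 9 \<and> reg t rZero = 0 \<and> reg t rN = N \<and> reg t rN1 = N + 1 \<and>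
     reg t rStr = N + 2 \<and> reg t rP = 3 ^ k \<and> reg t rM1 = m - 1" for k and t :: state
  have r1: "runs ?b1 ?s0 10 (pre 0)"
    by (rule runs_straight[OF ok0]) (use mB nB N_eq in \<open>auto simp: pre_def initial_state_def\<close>)
  have r2: "runs (For rI rM (arith_instr Mul rP rP rThree)) s1 (2 + m * (1 + 2)) (pre m)"
    if s1: "ok s1" "pre 0 s1" for s1
  proof (rule runs_For_const[where Inv = pre])
    show "pre 0 (set_reg rI 0 s1)" using s1(2) by (simp add: pre_def)
    show "reg s1 rM = m" using s1(2) by (simp add: pre_def)
    fix k t assume k: "k < m" and t: "ok t" "reg t rI = k" "reg t rM = m" "pre k t"
    have "(3 :: nat) ^ Suc k \<le> 3 ^ m" using k by (intro power_increasing) simp_all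
    then have "3 ^ k * 3 < B" using mB by simp
    then show "runs (arith_instr Mul rP rP rThree) t 1 (\<lambda>s'. reg s' rI = k \<and> reg s' rM = m
        \<and> reg s' rOne = 1 \<and> pre (Suc k) (set_reg rI (Suc k) s'))"
      by (intro runs_straight t(1)) (use t in \<open>simp_all add: pre_def\<close>)
  qed (use s1 in simp_all)
  let ?SW = "N * (K * (5 * D + 18 * N + 117) + 22) + K * (5 * N + 18) + 4 * N + 20"
  let ?R = "\<lambda>k. \<Sum>v | v < k \<and> v \<in> words m 0. run_poly m v N v"
  let ?T = "\<lambda>w. (7 * m + 4) + (1 + (if w \<in> words m 0 then ?SW else 0))"
  let ?c = "Seq check_word (Cond (Equal rF rOne) sweep Skip)"
  have r3: "runs (For rW0 rP ?c) s2 (2 + (\<Sum>w<3 ^ m. ?T w + 2)) ?Q" if s2: "ok s2" "pre m s2" for s2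
  proof -
    define Inv where "Inv k t \<longleftrightarrow> fixed_regs t \<and> conts t 0 = Map.empty \<and> result_is (?R k) t" for k t
    have iset: "Inv k (set_reg rW0 v t) = Inv k t" for k v t
      by (simp add: Inv_def fixed_regs_def result_is_def)
    show ?thesis
    proof (rule runs_For[where Inv = Inv])
      show "Inv 0 (set_reg rW0 0 s2)"
        unfolding iset using s2(2) by (simp add: Inv_def pre_def fixed_regs_def result_is_def)
      show "reg s2 rP = 3 ^ m" using s2(2) by (simp add: pre_def)
      fix w t assume w: "w < 3 ^ m" and t: "ok t" "reg t rW0 = w" "reg t rP = 3 ^ m" "Inv w t"
      have I: "fixed_regs t" "conts t 0 = Map.empty" "result_is (?R w) t" using t(4)
          by (simp_all add: Inv_def)
      let ?P = "\<lambda>s'. reg s' rW0 = w \<and> reg s' rP = 3 ^ m \<and> reg s' rOne = 1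
          \<and> Inv (Suc w) (set_reg rW0 (Suc w) s')"
      have RS: "?R (Suc w) = ?R w + (if w \<in> words m 0 then run_poly m w N w else 0)"
      proof -
        have "{v. v < Suc w \<and> v \<in> words m 0} = (if w \<in> words m 0 then insert w {v. v < w \<and> v \<in> words m 0}
            else {v. v < w \<and> v \<in> words m 0})"
          by (auto simp: less_Suc_eq)
        then show ?thesis by (simp add: add.commute)
      qed
      have P: "?P t'" if "fixed_regs t'" "reg t' rW0 = w" "conts t' 0 = Map.empty" "result_is (?R (Suc w)) t'" for t'
        unfolding iset using that by (simp add: Inv_def fixed_regs_def)
      let ?Q1 = "\<lambda>t1. keeps {rF, rV, rI, rA} t t1 \<and> same_mem t t1
          \<and> reg t1 rF = (if w \<in> words m 0 then 1 else 0)"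
      have c1: "runs check_word t (7 * m + 4) ?Q1" using t(1) I(1) t(2) w by (rule run_check_word)
      have c2: "runs (Cond (Equal rF rOne) sweep Skip) t1 (1 + (if w \<in> words m 0 then ?SW else 0)) ?P"
        if t1: "ok t1" "?Q1 t1" for t1
      proof (rule runs_Cond)
        have fr1: "fixed_regs t1" using I(1) t1(2) by (auto intro: fixed_regs_keeps)
        have F: "reg t1 rF = (if w \<in> words m 0 then 1 else 0)" using t1(2) by blast
        have I1: "reg t1 rOne = 1" "reg t1 rW0 = w" "conts t1 0 = Map.empty" "result_is (?R w) t1"
          using fr1 t(2) I t1(2) by (simp_all add: fixed_regs_def keeps_def same_mem_def result_is_def)
        {
          assume "holds (Equal rF rOne) t1"
          then have ww: "w \<in> words m 0" using F I1(1) by (cases "w \<in> words m 0") simp_all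
          have "runs sweep t1 ?SW ?P"
          proof (rule runs_mono[OF run_sweep[OF t1(1) fr1 I1(3,4,2) ww]])
            fix t2 assume t2: "keeps (insert rT vertex_regs) t1 t2
                \<and> result_is (?R w + run_poly m w N w) t2 \<and> conts t2 0 = Map.empty"
            show "?P t2"
            proof (rule P)
              show "fixed_regs t2" using fr1 t2 by (auto intro: fixed_regs_keeps)
              show "result_is (?R (Suc w)) t2" unfolding RS if_P[OF ww] using t2 by blast
              show "reg t2 rW0 = w" using t2 I1 by (simp add: keeps_def)
            qed (use t2 in simp)
          qed simp
          then show "runs sweep t1 (if w \<in> words m 0 then ?SW else 0) ?P" using ww by simp
        }
        assume "\<not> holds (Equal rF rOne) t1"
        then have "w \<notin> words m 0" using F I1(1) by (cases "w \<in> words m 0") simp_all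
        then have "?R (Suc w) = ?R w" unfolding RS by simp
        then have "?P t1" using fr1 I1 by (intro P) simp_all
        then show "runs Skip t1 (if w \<in> words m 0 then ?SW else 0) ?P"
          using t1(1) by (intro runs_straight) simp_all
      qed
      show "runs ?c t (?T w) ?P" using c1 c2 by (rule runs_Seq)
    next
      fix t assume "Inv (3 ^ m) t"
      moreover have "{v. v < 3 ^ m \<and> v \<in> words m 0} = words m 0" by (auto simp: words_def)
      ultimately show "?Q t"
        using trace_run_poly[OF m_pos n_pos, folded N_eq] by (simp add: Inv_def result_is_def)
    qed (use s2 in simp_all)
  qed
  have r23: "runs (Seq (For rI rM (arith_instr Mul rP rP rThree)) (For rW0 rP ?c)) s1
      ((2 + m * (1 + 2)) + (2 + (\<Sum>w<3 ^ m. ?T w + 2))) ?Q" if "ok s1" "pre 0 s1" for s1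
    using r2[OF that] r3 by (rule runs_Seq)
  have "runs torus_prog ?s0 (10 + ((2 + m * (1 + 2)) + (2 + (\<Sum>w<3 ^ m. ?T w + 2)))) ?Q"
    unfolding torus_prog_def using r1 r23 by (rule runs_Seq)
  then show ?thesis
  proof (rule runs_mono)
    have "(\<Sum>w<3 ^ m. ?T w + 2) = (\<Sum>w<3 ^ m. (7 * m + 7) + (if w \<in> words m 0 then ?SW else 0))"
      by (rule sum.cong) simp_all
    also have "\<dots> = 3 ^ m * (7 * m + 7) + (\<Sum>w<3 ^ m. if w \<in> words m 0 then ?SW else 0)"
      unfolding sum.distrib by (simp add: distrib_left)
    also have "(\<Sum>w<3 ^ m. if w \<in> words m 0 then ?SW else 0) = card (words m 0) * ?SW"
    proof -
      have "{..<3 ^ m} \<inter> words m 0 = words m 0" by (auto simp: words_def)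
      then show ?thesis by (simp add: sum.If_cases)
    qed
    also have "card (words m 0) * ?SW \<le> K * ?SW" by (rule mult_le_mono1) (rule card_words_K)
    finally show "10 + ((2 + m * (1 + 2)) + (2 + (\<Sum>w<3 ^ m. ?T w + 2))) \<le> total_time"
      unfolding total_time_def by simp
  qed
qed

end

section \<open>Time and space\<close>

lemma silver_ratio_bounds: "1 \<le> silver_ratio" "silver_ratio \<le> 3" "3 \<le> silver_ratio ^ 2"
proof -
  have "sqrt 2 \<le> sqrt 4" by (simp only: real_sqrt_le_iff)
  then have "sqrt 2 \<le> (2 :: real)" by simp
  moreover have "1 \<le> sqrt (2 :: real)" by simp
  ultimately show "1 \<le> silver_ratio" "silver_ratio \<le> 3" "3 \<le> silver_ratio ^ 2"
    by (simp_all add: silver_ratio_def power2_sum)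
qed

text \<open>With \<open>N = m * n\<close>, everything is estimated by multiples of \<open>K\<^sup>2 * N\<^sup>2\<close>, apart from the test of all
\<open>3 ^ m\<close> words. The constant is chosen generously.\<close>

lemma total_time_bound:
  fixes K m n N :: nat
  assumes m: "1 \<le> m" and n: "1 \<le> n" and K: "real K \<le> 2 * silver_ratio ^ m" and N: "N = m * n" and K1: "1 \<le> K"
  shows "real (3 ^ m * (7 * m + 7) + K * (N * (K * (5 * (3 * m) + 18 * N + 117) + 22) + K * (5 * N + 18) + 4 * N + 20) +
     3 * m + 14) \<le> 2000 * real m ^ 3 * real n ^ 2 * silver_ratio ^ (2 * m)"
proof -
  have N1: "1 \<le> N" and mN: "m \<le> N" using m n N by simp_all
  have NN: "N \<le> N * N" using N1 by simp
  have a: "5 * (3 * m) + 18 * N + 117 \<le> 150 * N" using mN N1 by linarith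
  have KN: "1 \<le> K * N" using K1 N1 by simp
  have "K * (5 * (3 * m) + 18 * N + 117) \<le> K * (150 * N)" using a by (rule mult_le_mono2)
  also have "\<dots> = 150 * (K * N)" by simp
  finally have "K * (5 * (3 * m) + 18 * N + 117) + 22 \<le> 172 * (K * N)" using KN by linarith
  then have "N * (K * (5 * (3 * m) + 18 * N + 117) + 22) \<le> N * (172 * (K * N))" by (rule mult_le_mono2)
  also have "\<dots> = 172 * (K * (N * N))" by simp
  finally have "N * (K * (5 * (3 * m) + 18 * N + 117) + 22) \<le> 172 * (K * (N * N))" .
  moreover have "K * (5 * N + 18) \<le> 23 * (K * (N * N))"
  proof -
    have "5 * N + 18 \<le> 23 * (N * N)" using NN N1 by linarith
    then have "K * (5 * N + 18) \<le> K * (23 * (N * N))" by (rule mult_le_mono2)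
    then show ?thesis by simp
  qed
  moreover have "4 * N + 20 \<le> 24 * (K * (N * N))"
  proof -
    have "N * N \<le> K * (N * N)" using K1 by simp
    then show ?thesis using NN N1 by linarith
  qed
  ultimately have "N * (K * (5 * (3 * m) + 18 * N + 117) + 22) + K * (5 * N + 18) + 4 * N + 20 \<le> 219 * (K * (N * N))"
    by linarith
  then have "K * (N * (K * (5 * (3 * m) + 18 * N + 117) + 22) + K * (5 * N + 18) + 4 * N + 20) \<le> K * (219 * (K * (N * N)))"
    by (rule mult_le_mono2)
  also have "\<dots> = 219 * (K\<^sup>2 * N\<^sup>2)" by (simp add: power2_eq_square)
  finally have "real (K * (N * (K * (5 * (3 * m) + 18 * N + 117) + 22) + K * (5 * N + 18) + 4 * N + 20)) \<le>
      real (219 * (K\<^sup>2 * N\<^sup>2))" by (simp only: of_nat_le_iff)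
  then have 1: "real (K * (N * (K * (5 * (3 * m) + 18 * N + 117) + 22) + K * (5 * N + 18) + 4 * N + 20)) \<le>
      219 * (real K ^ 2 * real N ^ 2)"
    by (simp only: of_nat_mult of_nat_power of_nat_numeral)
  let ?X = "real m ^ 3 * real n ^ 2 * silver_ratio ^ (2 * m)"
  have L: "1 \<le> silver_ratio ^ (2 * m)" using silver_ratio_bounds by (simp add: one_le_power)
  have m1: "1 \<le> real m" and n1: "1 \<le> real n" using m n by simp_all
  have n2: "1 \<le> real n ^ 2" using n1 by (rule one_le_power)
  have m2: "real m \<le> real m ^ 3" "real m ^ 2 \<le> real m ^ 3" "1 \<le> real m ^ 3"
    using m1 power_increasing[of 1 3 "real m"] power_increasing[of 2 3 "real m"] power_increasing[of 0 3 "real m"] by simp_all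
  have mn: "real m \<le> real m ^ 3 * real n ^ 2" using mult_mono[OF m2(1) n2] m1 by simp
  have "real K ^ 2 \<le> (2 * silver_ratio ^ m) ^ 2" using K by (intro power_mono) simp_all
  also have "\<dots> = 4 * silver_ratio ^ (2 * m)"
      by (simp add: power_mult_distrib power_mult[symmetric] mult.commute)
  finally have "real K ^ 2 * real N ^ 2 \<le> 4 * silver_ratio ^ (2 * m) * (real m ^ 2 * real n ^ 2)"
    unfolding N by (simp add: power_mult_distrib mult_right_mono)
  also have "\<dots> \<le> 4 * silver_ratio ^ (2 * m) * (real m ^ 3 * real n ^ 2)"
    using m2 L by (intro mult_left_mono mult_right_mono) simp_all
  finally have 2: "real K ^ 2 * real N ^ 2 \<le> 4 * ?X" by (simp add: mult_ac)
  have "(3 :: real) ^ m \<le> (silver_ratio ^ 2) ^ m" using silver_ratio_bounds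
      by (intro power_mono) simp_all
  then have 3: "3 ^ m \<le> silver_ratio ^ (2 * m)" by (simp add: power_mult)
  have "3 ^ m * (7 * real m + 7) \<le> silver_ratio ^ (2 * m) * (14 * (real m ^ 3 * real n ^ 2))"
    using 3 mn m1 by (intro mult_mono) simp_all
  then have 4: "3 ^ m * (7 * real m + 7) \<le> 14 * ?X" by (simp add: mult_ac)
  have "real m * 1 \<le> real m ^ 3 * real n ^ 2 * silver_ratio ^ (2 * m)"
    using mn L m1 by (intro mult_mono) simp_all
  then have 5: "3 * real m + 14 \<le> 17 * ?X" using m1 by linarith
  have "real (3 ^ m * (7 * m + 7) + K * (N * (K * (5 * (3 * m) + 18 * N + 117) + 22) + K * (5 * N + 18) + 4 * N + 20) + 3 * m + 14) =
      3 ^ m * (7 * real m + 7) + real (K * (N * (K * (5 * (3 * m) + 18 * N + 117) + 22) + K * (5 * N + 18) + 4 * N + 20)) + (3 * real m + 14)"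
    by (simp only: of_nat_add of_nat_mult of_nat_power of_nat_numeral add.assoc)
  also have "\<dots> \<le> 14 * ?X + 219 * (4 * ?X) + 17 * ?X"
    using 1 2 4 5 by linarith
  also have "\<dots> \<le> 2000 * ?X" using L m1 n1 by simp
  finally show ?thesis by (simp add: mult.assoc)
qed

theorem mainTheorem4:
  fixes lam :: real
  assumes "lam = 1 + sqrt 2"
  shows "\<exists>(P :: prog) (C :: real) (d :: nat).
    \<forall>m n p :: nat. m \<ge> 1 \<longrightarrow> n \<ge> 1 \<longrightarrow> prime p \<longrightarrow>
      (\<exists>T S s. exec p (int_bound d m n) S P (initial_state m n) T s
        \<and> real T \<le> C * real m ^ 3 * real n ^ 2 * lam ^ (2 * m)
        \<and> real S \<le> C * real m * real n * lam ^ m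
        \<and> (\<forall>k \<le> m * n. cmem s k = coeff (domination_poly (torus_graph m n)) k mod p))"
proof (rule exI[of _ torus_prog], rule exI[of _ 2000], rule exI[of _ 5], intro allI impI)
  fix m n p :: nat
  assume m: "m \<ge> 1" and n: "n \<ge> 1"
  have lam: "lam = silver_ratio" using assms by (simp add: silver_ratio_def)
  let ?L = "silver_ratio ^ m"
  define K where "K = nat \<lfloor>2 * ?L\<rfloor>"
  define N where "N = m * n"
  have L1: "1 \<le> ?L" using silver_ratio_bounds by (simp add: one_le_power)
  have K: "real K \<le> 2 * ?L" unfolding K_def using L1 by simp
  have K1: "1 \<le> K" unfolding K_def using L1 by (simp add: le_nat_floor)
  have cards: "card (words m j) \<le> K" for j
    unfolding K_def using card_words[of m j] by (rule le_nat_floor)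
  have "?L \<le> 3 ^ m" using silver_ratio_bounds by (intro power_mono) simp_all
  then have "real K \<le> real (2 * 3 ^ m)" using K by simp
  then have K3: "K \<le> 2 * 3 ^ m" by (simp only: of_nat_le_iff)
  define X where "X = 3 ^ m * n"
  have m3: "m < 3 ^ m" by (rule less_exp[THEN order.strict_trans2]) (simp add: power_mono)
  have three: "(3 :: nat) \<le> 3 ^ m" using m power_increasing[of 1 m "3 :: nat"] by simp
  have X3: "3 ^ m \<le> X" using n by (simp add: X_def)
  have X: "3 \<le> X" using three X3 by linarith
  have nX: "n \<le> X" by (simp add: X_def)
  have NX: "N \<le> X" unfolding N_def X_def using m3 by (intro mult_le_mono1) simp
  \<comment> \<open>The largest integers are addresses in the coefficient memory, below \<open>10 * X ^ 2\<close>, and sums of powers of 3 in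
    computations with words, below \<open>19 * X\<close>.\<close>
  have int: "int_bound 5 m n = X ^ 5" by (simp add: int_bound_def X_def)
  have "27 * X ^ 2 \<le> X ^ 3 * X ^ 2"
    using power_mono[OF X, of 3] by (intro mult_le_mono1) simp
  then have X5: "27 * X ^ 2 \<le> X ^ 5" by (simp add: power_add[symmetric])
  have XX: "3 * X \<le> X ^ 2" using X by (simp add: power2_eq_square)
  have "(2 * K + 1) * (N + 2) \<le> (5 * X) * (2 * X)"
    using K3 X3 X NX by (intro mult_le_mono) linarith+
  then have CX: "(2 * K + 1) * (N + 2) \<le> X ^ 5" using X5 by (simp add: power2_eq_square)
  have D: "K + 2 \<le> 2 ^ (3 * m)"
  proof -
    have "2 * 3 ^ m + 2 \<le> (8 :: nat) ^ m" using m
      by (induction m rule: dec_induct) simp_all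
    then show ?thesis using K3 by (simp add: power_mult)
  qed
  interpret torus_machine p "X ^ 5" "2 * K" "(2 * K + 1) * (N + 2)" K "3 * m" m n N
  proof
    show "2 \<le> X ^ 5" "2 * K \<le> X ^ 5" "9 * 3 ^ m + 10 \<le> X ^ 5"
      using X5 XX X X3 K3 by linarith+
  qed (use CX D cards m n N_def in simp_all)
  have "n < X ^ 5" "N + 2 < X ^ 5" using X5 XX X nX NX by linarith+
  then have "runs torus_prog (initial_state m n) total_time
      (\<lambda>s'. \<forall>k\<le>N. cmem s' k = coeff (domination_poly (torus_graph m n)) k mod p)"
    by (rule run_torus_prog)
  then obtain t s where ts: "exec p (X ^ 5) (2 * K + (2 * K + 1) * (N + 2) + K) torus_prog (initial_state m n) t s"
      "t \<le> total_time" "\<forall>k\<le>N. cmem s k = coeff (domination_poly (torus_graph m n)) k mod p"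
    unfolding runs_def by blast
  show "\<exists>T S s. exec p (int_bound 5 m n) S torus_prog (initial_state m n) T s
        \<and> real T \<le> 2000 * real m ^ 3 * real n ^ 2 * lam ^ (2 * m)
        \<and> real S \<le> 2000 * real m * real n * lam ^ m
        \<and> (\<forall>k \<le> m * n. cmem s k = coeff (domination_poly (torus_graph m n)) k mod p)"
  proof (intro exI conjI)
    show "exec p (int_bound 5 m n) (2 * K + (2 * K + 1) * (N + 2) + K) torus_prog (initial_state m n) t s"
      unfolding int by (rule ts(1))
    have "real t \<le> real total_time" using ts(2) by simp
    also have "\<dots> \<le> 2000 * real m ^ 3 * real n ^ 2 * lam ^ (2 * m)"
      unfolding total_time_def lam using m n K N_def K1 by (rule total_time_bound)
    finally show "real t \<le> 2000 * real m ^ 3 * real n ^ 2 * lam ^ (2 * m)" .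
    have N1: "1 \<le> N" using m n by (simp add: N_def)
    have "K * 1 \<le> K * N" using N1 by (rule mult_le_mono2)
    moreover have "(2 * K + 1) * (N + 2) \<le> (3 * K) * (3 * N)"
      using K1 N1 by (intro mult_le_mono) linarith+
    moreover have "(3 * K) * (3 * N) = 9 * (K * N)" by simp
    ultimately have "2 * K + (2 * K + 1) * (N + 2) + K \<le> 12 * (K * N)" by linarith
    then have "real (2 * K + (2 * K + 1) * (N + 2) + K) \<le> real (12 * (K * N))"
        by (simp only: of_nat_le_iff)
    also have "\<dots> = real K * (12 * real N)" by simp
    also have "\<dots> \<le> (2 * ?L) * (12 * real N)" using K by (rule mult_right_mono) simp
    also have "\<dots> \<le> 2000 * real m * real n * lam ^ m" unfolding lam N_def using L1 by simp
    finally show "real (2 * K + (2 * K + 1) * (N + 2) + K) \<le> 2000 * real m * real n * lam ^ m" .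
    show "\<forall>k \<le> m * n. cmem s k = coeff (domination_poly (torus_graph m n)) k mod p"
      using ts(3) unfolding N_def .
  qed
qed

end
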